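(* There exists a computable unique factorization domain $A$ such that the set of primes of $A$ is $\Pi_2^0$-complete in every computable presentation of $A$, uniformly in an index for the presentation.
   Context: A computable ring is a ring whose underlying set is a computable set $A \subseteq \mathbb{N}$ such that $+$ and $\cdot$ are computable functions from $A \times A$ to $A$; a computable UFD is a computable ring that is a unique factorization domain. A computable presentation of a ring $A$ is a computable ring isomorphic (as a ring) to $A$; an index for it consists of indices of programs computing its underlying set, its addition and its multiplication. An element $p$ of an integral domain is prime if it is nonzero, not a unit, and whenever $p \mid ab$, either $p \mid a$ or $p \mid b$. A set $Z \subseteq \mathbb{N}$ is $\Pi_2^0$ if there is a computable $R \subseteq \mathbb{N}^3$ such that for all $i$: $i \in Z \Longleftrightarrow (\forall x)(\exists y) R(x,y,i)$. A set $P \subseteq \mathbb{N}$ is $\Pi_2^0$-complete if it is $\Pi_2^0$ and for every $\Pi_2^0$ set $Z$ there is a total computable function $f$ with $i \in Z \Longleftrightarrow f(i) \in P$ for all $i$. "Uniformly in an index for the presentation" means: for each $\Pi_2^0$ set $Z$ there is an algorithm which, given an index for any computable presentation $A'$ of $A$, outputs an index of a total computable function $f$ such that for all $i$: $i \in Z$ if and only if $f(i)$ belongs to the set of primes of $A'$. *)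

theory Defs
  imports "HOL-Algebra.Ring_Divisibility" "HOL-Library.Nat_Bijection"
begin

section \<open>Programs, indices and computable functions\<close>

text \<open>
  Programs are terms for Kleene's partial recursive functions.  Programs carry no arity: one
  program may be run on argument lists of any length.  For each fixed \<open>k\<close> the functions
  computed on argument lists of length \<open>k\<close> are exactly the \<open>k\<close>-ary partial recursive functions.
\<close>

datatype prog =
    PZero
  | PSucc
  | PProj nat
  | PComp prog "prog list"
  | PRec prog prog
  | PMin prog

text \<open>
  \<open>None\<close> stands for divergence.  Composition is strict.  Primitive recursion is on the first
  argument, and its step program receives the counter, the previous value and the parameters.
  Minimisation requires convergence below the zero found.
\<close>

fun eval :: "prog \<Rightarrow> nat list \<Rightarrow> nat option" where
  "eval PZero xs = Some 0"
| "eval PSucc xs = (case xs of [] \<Rightarrow> None | x # _ \<Rightarrow> Some (Suc x))"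
| "eval (PProj i) xs = (if i < length xs then Some (xs ! i) else None)"
| "eval (PComp p qs) xs = Option.bind (those (map (\<lambda>q. eval q xs) qs)) (eval p)"
| "eval (PRec p q) xs = (case xs of [] \<Rightarrow> None
     | n # ys \<Rightarrow> rec_nat (eval p ys) (\<lambda>m r. Option.bind r (\<lambda>v. eval q (m # v # ys))) n)"
| "eval (PMin p) xs =
     (if \<exists>n. eval p (n # xs) = Some 0 \<and> (\<forall>m<n. eval p (m # xs) \<noteq> None)
      then Some (LEAST n. eval p (n # xs) = Some 0) else None)"

fun encode :: "prog \<Rightarrow> nat" where
  "encode PZero = prod_encode (0, 0)"
| "encode PSucc = prod_encode (1, 0)"
| "encode (PProj i) = prod_encode (2, i)"
| "encode (PComp p qs) = prod_encode (3, prod_encode (encode p, list_encode (map encode qs)))"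
| "encode (PRec p q) = prod_encode (4, prod_encode (encode p, encode q))"
| "encode (PMin p) = prod_encode (5, encode p)"

lemma encode_eqD: "encode p = encode q \<Longrightarrow> p = q"
proof (induction p arbitrary: q)
  case (PComp p qs)
  then obtain p' qs' where q: "q = PComp p' qs'" "encode p = encode p'"
      "map encode qs = map encode qs'"
    by (cases q) (auto simp: prod_encode_eq list_encode_eq)
  have "qs = qs'"
    by (rule list.inj_map_strong[OF _ q(3)]) (use PComp.IH(2) in blast)
  with q PComp.IH(1) show ?case by blast
qed (case_tac q; auto simp: prod_encode_eq)+

lemma inj_encode: "inj encode"
  by (auto intro: injI encode_eqD)

text \<open>The partial function with index \<open>e\<close>; numbers that encode no program index the empty function.\<close>

definition phi :: "nat \<Rightarrow> nat list \<Rightarrow> nat option" where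
  "phi e xs = (if e \<in> range encode then eval (the_inv encode e) xs else None)"

lemma phi_encode [simp]: "phi (encode p) = eval p"
  by (simp add: phi_def fun_eq_iff the_inv_f_f[OF inj_encode])

definition decides :: "nat \<Rightarrow> nat set \<Rightarrow> bool" where
  "decides e A \<longleftrightarrow> (\<forall>x. phi e [x] = Some (if x \<in> A then 1 else 0))"

definition decides3 :: "nat \<Rightarrow> (nat \<Rightarrow> nat \<Rightarrow> nat \<Rightarrow> bool) \<Rightarrow> bool" where
  "decides3 e R \<longleftrightarrow> (\<forall>x y z. phi e [x, y, z] = Some (if R x y z then 1 else 0))"

text \<open>The program is unconstrained, and may diverge, on arguments outside \<open>A\<close>.\<close>

definition computes_binop_on :: "nat \<Rightarrow> nat set \<Rightarrow> (nat \<Rightarrow> nat \<Rightarrow> nat) \<Rightarrow> bool" where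
  "computes_binop_on e A f \<longleftrightarrow> (\<forall>x\<in>A. \<forall>y\<in>A. phi e [x, y] = Some (f x y))"

section \<open>The arithmetical class \<open>\<Pi>\<^sub>2\<^sup>0\<close>\<close>

definition Pi02 :: "nat set \<Rightarrow> bool" where
  "Pi02 Z \<longleftrightarrow> (\<exists>R. (\<exists>e. decides3 e R) \<and> (\<forall>i. i \<in> Z \<longleftrightarrow> (\<forall>x. \<exists>y. R x y i)))"

definition reduces_via :: "nat \<Rightarrow> nat set \<Rightarrow> nat set \<Rightarrow> bool" where
  "reduces_via e Z P \<longleftrightarrow>
     (\<exists>f. (\<forall>i. phi e [i] = Some (f i)) \<and> (\<forall>i. i \<in> Z \<longleftrightarrow> f i \<in> P))"

definition Pi02_complete :: "nat set \<Rightarrow> bool" where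
  "Pi02_complete P \<longleftrightarrow> Pi02 P \<and> (\<forall>Z. Pi02 Z \<longrightarrow> (\<exists>e. reduces_via e Z P))"

section \<open>Computable rings and their presentations\<close>

definition ring_index :: "nat ring \<Rightarrow> nat \<Rightarrow> nat \<Rightarrow> nat \<Rightarrow> bool" where
  "ring_index A d s m \<longleftrightarrow> decides d (carrier A) \<and>
     computes_binop_on s (carrier A) (add A) \<and> computes_binop_on m (carrier A) (mult A)"

definition computable_ring :: "nat ring \<Rightarrow> bool" where
  "computable_ring A \<longleftrightarrow> ring A \<and> (\<exists>d s m. ring_index A d s m)"

definition computable_UFD :: "nat ring \<Rightarrow> bool" where
  "computable_UFD A \<longleftrightarrow> computable_ring A \<and> factorial_domain A"

definition computable_presentation :: "nat ring \<Rightarrow> nat ring \<Rightarrow> bool" where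
  "computable_presentation A A' \<longleftrightarrow> computable_ring A' \<and> A' \<simeq> A"

definition primes_of :: "nat ring \<Rightarrow> nat set" where
  "primes_of A = {p \<in> carrier A. ring_prime\<^bsub>A\<^esub> p}"

definition uniformly_Pi02_hard_primes :: "nat ring \<Rightarrow> bool" where
  "uniformly_Pi02_hard_primes A \<longleftrightarrow>
     (\<forall>Z. Pi02 Z \<longrightarrow>
       (\<exists>g. \<forall>A' d s m. computable_presentation A A' \<and> ring_index A' d s m \<longrightarrow>
         (\<exists>e. phi g [d, s, m] = Some e \<and> reduces_via e Z (primes_of A'))))"

end

theory Submission
  imports Defs "HOL-Library.Poly_Mapping" "HOL-Computational_Algebra.Fraction_Field"
    "HOL-Computational_Algebra.Primes"
begin

text \<open>
  Let \<open>k\<close> range over (codes of) instances of a universal \<open>\<Pi>\<^sub>2\<^sup>0\<close> predicate, and attach to \<open>k\<close> the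
  \<open>k\<close>-th rational prime \<open>p\<close> and a decidable set of stages which is infinite iff the instance holds.
  Every stage \<open>j\<close> has its own variable \<open>t\<^sub>j\<close>.  As long as \<open>j\<close> is the last known stage of \<open>k\<close>, the ring
  contains \<open>t\<^sub>j\<close> and \<open>p / t\<^sub>j\<close>, so that \<open>p\<close> splits into two primes; when a later stage appears, \<open>t\<^sub>j\<close>
  becomes a unit.  Hence \<open>p\<close> stays prime iff there is no last stage.

  Everything else is made invertible: in the field of rational functions in the \<open>t\<^sub>j\<close>, the ring is cut
  out by the Gauss valuations over the rational primes and, for every last stage \<open>j\<close>, the Gauss
  valuation over \<open>p\<close> that gives weight one to \<open>t\<^sub>j\<close>.  These valuations have uniformizers at which all
  others vanish, so every nonzero element is a unit times a unique product of uniformizers.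
  The ring is only recursively enumerable in the field, but a numbering with decidable equality and
  decidable graphs of the operations suffices.  The reductions work in every presentation since
  the rational integers can be found there from the identity element.
\<close>

text \<open>The verdict on \<open>p\<close> may change with every new stage, but elements once
  enumerated cannot be withdrawn. Inverting \<open>t\<close> resolves this: \<open>p / t\<close>
  stays in the ring and becomes an associate of \<open>p\<close>, so a splitting is undone by adding
  elements only, and a fresh variable can split \<open>p\<close> again. Being the last stage is a
  co-enumerable condition: the constraint imposed by a stage may be dropped once a later stage has
  been seen, so membership in the ring can be confirmed but not refuted. A code of an element
  therefore carries, besides a fraction, a bound on the stages to be inspected, and it counts only
  if every constraint that fails for the fraction has been dropped by that bound. Equality of two
  such codes is cross multiplication of the fractions and does not involve the bounds.\<close>

hide_const (open) Divisibility.prime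

section \<open>Computable functions of an environment\<close>

text \<open>
  A \<open>k\<close>-ary function reads its arguments off an environment \<open>e :: nat \<Rightarrow> nat\<close>.  A bound variable
  is the new entry \<open>0\<close> of the environment, so the rules for binders shift all other entries.
\<close>

definition computable :: "nat \<Rightarrow> ((nat \<Rightarrow> nat) \<Rightarrow> nat) \<Rightarrow> bool" where
  "computable k f \<longleftrightarrow> (\<exists>p. \<forall>e. eval p (map e [0..<k]) = Some (f e))"

definition decidable :: "nat \<Rightarrow> ((nat \<Rightarrow> nat) \<Rightarrow> bool) \<Rightarrow> bool" where
  "decidable k P \<longleftrightarrow> computable k (\<lambda>e. of_bool (P e))"

named_theorems comp_intros

lemma computableI: "(\<And>e. eval p (map e [0..<k]) = Some (f e)) \<Longrightarrow> computable k f"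
  by (auto simp: computable_def)

lemma computable_var [comp_intros]: "i < k \<Longrightarrow> computable k (\<lambda>e. e i)"
  by (rule computableI[of "PProj i"]) simp

lemma those_map_Some: "those (map (\<lambda>x. Some (f x)) xs) = Some (map f xs)"
  by (induction xs) auto

lemma computable_compose:
  assumes "computable n f" "\<And>i. i < n \<Longrightarrow> computable k (g i)"
  shows "computable k (\<lambda>e. f (\<lambda>i. g i e))"
proof -
  obtain p where p: "\<And>e. eval p (map e [0..<n]) = Some (f e)"
    using assms(1) by (auto simp: computable_def)
  have "\<forall>i. \<exists>q. i < n \<longrightarrow> (\<forall>e. eval q (map e [0..<k]) = Some (g i e))"
    using assms(2) by (auto simp: computable_def)
  then obtain q where q: "\<And>i e. i < n \<Longrightarrow> eval (q i) (map e [0..<k]) = Some (g i e)"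
    by metis
  show ?thesis
  proof (rule computableI[of "PComp p (map q [0..<n])"])
    fix e
    have "map (\<lambda>x. eval x (map e [0..<k])) (map q [0..<n]) = map (\<lambda>i. Some (g i e)) [0..<n]"
      using q by simp
    thus "eval (PComp p (map q [0..<n])) (map e [0..<k]) = Some (f (\<lambda>i. g i e))"
      by (simp add: those_map_Some p del: map_map)
  qed
qed

text \<open>Many closure rules below are proved on an environment that lists just the arguments and
  are then transferred by this rule and its analogues, so that recursions and searches are set up
  for bare variables only.\<close>

lemma computable_app1:
  assumes "computable 1 (\<lambda>e. f (e 0))" "computable k g"
  shows "computable k (\<lambda>e. f (g e))"
  using computable_compose[OF assms(1), of k "\<lambda>_. g"] assms(2) by simp

lemma computable_app2:
  assumes "computable 2 (\<lambda>e. f (e 0) (e 1))" "computable k g" "computable k h"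
  shows "computable k (\<lambda>e. f (g e) (h e))"
  using computable_compose[OF assms(1), of k "\<lambda>i. if i = 0 then g else h"] assms(2,3) by simp

lemma computable_app3:
  assumes "computable 3 (\<lambda>e. f (e 0) (e 1) (e 2))" "computable k g" "computable k h" "computable k l"
  shows "computable k (\<lambda>e. f (g e) (h e) (l e))"
  using computable_compose[OF assms(1), of k "\<lambda>i. if i = 0 then g else if i = 1 then h else l"]
    assms(2-) by simp

lemma computable_Suc [comp_intros]: "computable k f \<Longrightarrow> computable k (\<lambda>e. Suc (f e))"
  by (rule computable_app1) (rule computableI[of PSucc], simp)

lemma computable_const [comp_intros]: "computable k (\<lambda>e. c)"
proof (induction c)
  case 0
  show ?case by (rule computableI[of PZero]) simp
qed (rule computable_Suc)

lemma map_upt_case_nat: "map (case_nat m e) [0..<Suc k] = m # map e [0..<k]"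
  by (simp add: map_upt_Suc del: upt_Suc)

lemma computable_rec [comp_intros]:
  assumes "computable k a" "computable (Suc (Suc k)) (\<lambda>e. h (e 0) (e (Suc 0)) (\<lambda>i. e (Suc (Suc i))))"
    "computable k n"
  shows "computable k (\<lambda>e. rec_nat (a e) (\<lambda>m v. h m v e) (n e))"
proof -
  obtain p where p: "\<And>e. eval p (map e [0..<k]) = Some (a e)"
    using assms(1) by (auto simp: computable_def)
  obtain q where q: "\<And>e. eval q (map e [0..<Suc (Suc k)]) = Some (h (e 0) (e (Suc 0)) (\<lambda>i. e (Suc (Suc i))))"
    using assms(2) by (auto simp: computable_def)
  obtain r where r: "\<And>e. eval r (map e [0..<k]) = Some (n e)"
    using assms(3) by (auto simp: computable_def)
  have q': "eval q (m # v # map e [0..<k]) = Some (h m v e)" for m v e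
    using q[of "case_nat m (case_nat v e)"] by (simp only: map_upt_case_nat) simp
  have projs: "those (map (\<lambda>q. eval q (map e [0..<k])) (map PProj [0..<k])) = Some (map e [0..<k])" for e
  proof -
    have "map (\<lambda>q. eval q (map e [0..<k])) (map PProj [0..<k]) = map (\<lambda>i. Some (e i)) [0..<k]"
      by simp
    thus ?thesis by (metis those_map_Some)
  qed
  have rec: "eval (PRec p q) (m # map e [0..<k]) = Some (rec_nat (a e) (\<lambda>m v. h m v e) m)" for m e
    by (induction m) (simp_all add: p q')
  \<comment> \<open>\<open>PRec\<close> expects the counter in front of the parameters, so the
    program for \<open>n\<close> is followed by projections that copy the whole environment.\<close>
  show ?thesis
    by (rule computableI[of "PComp (PRec p q) (r # map PProj [0..<k])"])
      (simp add: r projs rec del: map_map eval.simps(5))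
qed

lemma computable_add [comp_intros]:
  assumes "computable k f" "computable k g" shows "computable k (\<lambda>e. f e + g e)"
proof (rule computable_app2[OF _ assms])
  have "rec_nat y (\<lambda>m v. Suc v) x = x + y" for x y :: nat by (induction x) auto
  moreover have "computable 2 (\<lambda>e. rec_nat (e 1) (\<lambda>m v. Suc v) (e 0))"
    by (intro comp_intros) auto
  ultimately show "computable 2 (\<lambda>e. e 0 + e 1)" by simp
qed

lemma computable_mult [comp_intros]:
  assumes "computable k f" "computable k g" shows "computable k (\<lambda>e. f e * g e)"
proof (rule computable_app2[OF _ assms])
  have "rec_nat 0 (\<lambda>m v. v + y) x = x * y" for x y :: nat by (induction x) auto
  moreover have "computable 2 (\<lambda>e. rec_nat 0 (\<lambda>m v. v + e 1) (e 0))"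
    by (intro comp_intros) auto
  ultimately show "computable 2 (\<lambda>e. e 0 * e 1)" by simp
qed

lemma computable_power [comp_intros]:
  assumes "computable k f" "computable k g" shows "computable k (\<lambda>e. f e ^ g e)"
proof (rule computable_app2[OF _ assms])
  have "rec_nat 1 (\<lambda>m v. v * x) y = x ^ y" for x y :: nat by (induction y) auto
  moreover have "computable 2 (\<lambda>e. rec_nat 1 (\<lambda>m v. v * e 0) (e 1))"
    by (intro comp_intros) auto
  ultimately show "computable 2 (\<lambda>e. e 0 ^ e 1)" by simp
qed

lemma computable_diff [comp_intros]:
  assumes "computable k f" "computable k g" shows "computable k (\<lambda>e. f e - g e)"
proof (rule computable_app2[OF _ assms])
  have pred: "computable k (\<lambda>e. f e - 1)" if "computable k f" for k f
  proof (rule computable_app1[OF _ that])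
    have "rec_nat 0 (\<lambda>m v. m) x = x - 1" for x :: nat by (induction x) auto
    moreover have "computable 1 (\<lambda>e. rec_nat 0 (\<lambda>m v. m) (e 0))"
      by (intro comp_intros) auto
    ultimately show "computable 1 (\<lambda>e. e 0 - 1)" by simp
  qed
  have "rec_nat x (\<lambda>m v. v - 1) y = x - y" for x y :: nat by (induction y) auto
  moreover have "computable 2 (\<lambda>e. rec_nat (e 0) (\<lambda>m v. v - 1) (e 1))"
    by (intro comp_intros pred) auto
  ultimately show "computable 2 (\<lambda>e. e 0 - e 1)" by simp
qed

lemma computable_sum [comp_intros]:
  assumes "computable k b" "computable (Suc k) (\<lambda>e. f (e 0) (\<lambda>i. e (Suc i)))"
  shows "computable k (\<lambda>e. \<Sum>i<b e. f i e)"
proof -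
  \<comment> \<open>In the recursion the accumulated sum sits at entry 1, between the index and the
    environment; this substitution skips it.\<close>
  have "computable (Suc (Suc k)) (\<lambda>e. if i = 0 then e 0 else e (Suc i))" if "i < Suc k" for i
    using that by (cases i) (auto intro!: comp_intros)
  from computable_compose[OF assms(2), of _ "\<lambda>i e. if i = 0 then e 0 else e (Suc i)", OF this]
  have "computable (Suc (Suc k)) (\<lambda>e. f (e 0) (\<lambda>i. e (Suc (Suc i))))" by simp
  hence "computable k (\<lambda>e. rec_nat 0 (\<lambda>m v. v + f m e) (b e))"
    by (intro comp_intros assms) auto
  moreover have "rec_nat 0 (\<lambda>m v. v + f m e) n = (\<Sum>i<n. f i e)" for n e
    by (induction n) auto
  ultimately show ?thesis by simp
qed

lemma decidable_computable [comp_intros]: "decidable k P \<Longrightarrow> computable k (\<lambda>e. of_bool (P e))"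
  by (simp add: decidable_def)

lemma decidable_not [comp_intros]: "decidable k P \<Longrightarrow> decidable k (\<lambda>e. \<not> P e)"
proof -
  assume "decidable k P"
  hence "computable k (\<lambda>e. 1 - of_bool (P e))" by (intro comp_intros)
  moreover have "1 - of_bool (P e) = (of_bool (\<not> P e) :: nat)" for e by simp
  ultimately show ?thesis by (simp add: decidable_def)
qed

lemma decidable_conj [comp_intros]:
  "decidable k P \<Longrightarrow> decidable k Q \<Longrightarrow> decidable k (\<lambda>e. P e \<and> Q e)"
  using computable_mult[of k "\<lambda>e. of_bool (P e)" "\<lambda>e. of_bool (Q e)"]
  by (simp add: decidable_def of_bool_conj)

lemma decidable_disj [comp_intros]:
  "decidable k P \<Longrightarrow> decidable k Q \<Longrightarrow> decidable k (\<lambda>e. P e \<or> Q e)"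
  using decidable_not[OF decidable_conj[OF decidable_not decidable_not], of k P Q] by simp

lemma decidable_imp [comp_intros]:
  "decidable k P \<Longrightarrow> decidable k Q \<Longrightarrow> decidable k (\<lambda>e. P e \<longrightarrow> Q e)"
  using decidable_disj[OF decidable_not, of k P Q] by (simp only: imp_conv_disj)

lemma decidable_le [comp_intros]:
  assumes "computable k f" "computable k g" shows "decidable k (\<lambda>e. f e \<le> g e)"
proof -
  have "computable k (\<lambda>e. 1 - (f e - g e))" by (intro comp_intros assms)
  moreover have "1 - (f e - g e) = of_bool (f e \<le> g e)" for e by simp
  ultimately show ?thesis by (simp add: decidable_def)
qed

lemma decidable_less [comp_intros]:
  "computable k f \<Longrightarrow> computable k g \<Longrightarrow> decidable k (\<lambda>e. f e < g e)"
  using decidable_le[OF computable_Suc, of k f g] by (simp add: Suc_le_eq)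

lemma decidable_eq [comp_intros]:
  assumes "computable k f" "computable k g" shows "decidable k (\<lambda>e. f e = g e)"
proof -
  have "decidable k (\<lambda>e. f e \<le> g e \<and> g e \<le> f e)" by (intro comp_intros assms)
  thus ?thesis by (simp only: order_eq_iff[symmetric])
qed

lemma decidable_iff [comp_intros]:
  assumes "decidable k P" "decidable k Q" shows "decidable k (\<lambda>e. P e \<longleftrightarrow> Q e)"
proof -
  have "decidable k (\<lambda>e. (P e \<longrightarrow> Q e) \<and> (Q e \<longrightarrow> P e))" by (intro comp_intros assms)
  thus ?thesis by (simp only: iff_conv_conj_imp[symmetric])
qed

lemma decidable_ex_less [comp_intros]:
  assumes "computable k b" "decidable (Suc k) (\<lambda>e. P (e 0) (\<lambda>i. e (Suc i)))"
  shows "decidable k (\<lambda>e. \<exists>i<b e. P i e)"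
proof -
  have "decidable k (\<lambda>e. 0 < (\<Sum>i<b e. of_bool (P i e) :: nat))"
    by (intro comp_intros assms)
  moreover have "0 < (\<Sum>i<n. of_bool (P i e) :: nat) \<longleftrightarrow> (\<exists>i<n. P i e)" for n e
    by (induction n) (auto simp: less_Suc_eq)
  ultimately show ?thesis by simp
qed

lemma decidable_all_less [comp_intros]:
  assumes "computable k b" "decidable (Suc k) (\<lambda>e. P (e 0) (\<lambda>i. e (Suc i)))"
  shows "decidable k (\<lambda>e. \<forall>i<b e. P i e)"
proof -
  have "decidable k (\<lambda>e. \<not> (\<exists>i<b e. \<not> P i e))"
    by (intro comp_intros assms)
  thus ?thesis by simp
qed

lemma decidable_ex_le [comp_intros]:
  assumes "computable k b" "decidable (Suc k) (\<lambda>e. P (e 0) (\<lambda>i. e (Suc i)))"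
  shows "decidable k (\<lambda>e. \<exists>i\<le>b e. P i e)"
  using decidable_ex_less[OF computable_Suc[OF assms(1)] assms(2)] by (simp add: less_Suc_eq_le)

lemma decidable_all_le [comp_intros]:
  assumes "computable k b" "decidable (Suc k) (\<lambda>e. P (e 0) (\<lambda>i. e (Suc i)))"
  shows "decidable k (\<lambda>e. \<forall>i\<le>b e. P i e)"
  using decidable_all_less[OF computable_Suc[OF assms(1)] assms(2)] by (simp add: less_Suc_eq_le)

lemma computable_if [comp_intros]:
  assumes "decidable k P" "computable k f" "computable k g"
  shows "computable k (\<lambda>e. if P e then f e else g e)"
proof -
  have "computable k (\<lambda>e. of_bool (P e) * f e + of_bool (\<not> P e) * g e)"
    by (intro comp_intros assms)
  moreover have "(of_bool (P e) * f e + of_bool (\<not> P e) * g e) = (if P e then f e else g e)" for e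
    by simp
  ultimately show ?thesis by simp
qed

lemma decidable_if [comp_intros]:
  assumes "decidable k P" "decidable k Q" "decidable k R"
  shows "decidable k (\<lambda>e. if P e then Q e else R e)"
  using decidable_conj[OF decidable_imp[OF assms(1,2)] decidable_imp[OF decidable_not[OF assms(1)] assms(3)]]
  by (simp add: if_bool_eq_conj)

lemma computable_Least [comp_intros]:
  assumes "decidable (Suc k) (\<lambda>e. P (e 0) (\<lambda>i. e (Suc i)))" "\<And>e. \<exists>n. P n e"
  shows "computable k (\<lambda>e. LEAST n. P n e)"
proof -
  \<comment> \<open>\<open>PMin\<close> searches for a zero, hence the negation.\<close>
  have "computable (Suc k) (\<lambda>e. of_bool (\<not> P (e 0) (\<lambda>i. e (Suc i))))"
    by (intro comp_intros assms)
  then obtain p where p: "\<And>e. eval p (map e [0..<Suc k]) = Some (of_bool (\<not> P (e 0) (\<lambda>i. e (Suc i))))"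
    by (auto simp: computable_def)
  have p': "eval p (n # map e [0..<k]) = Some (of_bool (\<not> P n e))" for n e
    using p[of "case_nat n e"] by (simp only: map_upt_case_nat) simp
  show ?thesis
    by (rule computableI[of "PMin p"]) (simp add: p' assms(2))
qed

lemma decidable_app1:
  assumes "decidable 1 (\<lambda>e. P (e 0))" "computable k g"
  shows "decidable k (\<lambda>e. P (g e))"
  using computable_app1[of "\<lambda>x. of_bool (P x)"] assms by (simp add: decidable_def)

lemma decidable_app2:
  assumes "decidable 2 (\<lambda>e. P (e 0) (e 1))" "computable k g" "computable k h"
  shows "decidable k (\<lambda>e. P (g e) (h e))"
  using computable_app2[of "\<lambda>x y. of_bool (P x y)"] assms by (simp add: decidable_def)

lemma decidable_app3:
  assumes "decidable 3 (\<lambda>e. P (e 0) (e 1) (e 2))" "computable k g" "computable k h" "computable k l"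
  shows "decidable k (\<lambda>e. P (g e) (h e) (l e))"
  using computable_app3[of "\<lambda>x y z. of_bool (P x y z)"] assms by (simp add: decidable_def)

subsection \<open>Arithmetic and codes\<close>

lemma decidable_dvd [comp_intros]:
  assumes "computable k f" "computable k g" shows "decidable k (\<lambda>e. f e dvd g e)"
proof (rule decidable_app2[OF _ assms])
  have "(\<exists>i\<le>n. n = m * i) \<longleftrightarrow> m dvd n" for m n :: nat
    by (cases "n = 0"; cases "m = 0") (auto simp: dvd_def)
  moreover have "decidable 2 (\<lambda>e. \<exists>i\<le>e 1. e 1 = e 0 * i)"
    by (intro comp_intros) auto
  ultimately show "decidable 2 (\<lambda>e. e 0 dvd e 1)" by simp
qed

lemma computable_triangle [comp_intros]:
  assumes "computable k f" shows "computable k (\<lambda>e. triangle (f e))"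
proof (rule computable_app1[OF _ assms])
  have "(\<Sum>i<n. Suc i) = triangle n" for n by (induction n) auto
  moreover have "computable 1 (\<lambda>e. \<Sum>i<e 0. Suc i)" by (intro comp_intros) auto
  ultimately show "computable 1 (\<lambda>e. triangle (e 0))" by simp
qed

lemma computable_prod_encode [comp_intros]:
  "computable k f \<Longrightarrow> computable k g \<Longrightarrow> computable k (\<lambda>e. prod_encode (f e, g e))"
  unfolding prod_encode_def by (auto intro!: comp_intros)

definition pfst :: "nat \<Rightarrow> nat" where "pfst z = fst (prod_decode z)"
definition psnd :: "nat \<Rightarrow> nat" where "psnd z = snd (prod_decode z)"

lemma pfst_encode [simp]: "pfst (prod_encode (a, b)) = a"
  and psnd_encode [simp]: "psnd (prod_encode (a, b)) = b"
  by (simp_all add: pfst_def psnd_def)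

lemma encode_pfst_psnd [simp]: "prod_encode (pfst z, psnd z) = z"
  by (simp add: pfst_def psnd_def)

lemma pfst_le: "pfst z \<le> z" and psnd_le: "psnd z \<le> z"
  using le_prod_encode_1[of "pfst z" "psnd z"] le_prod_encode_2[of "psnd z" "pfst z"] by simp_all

lemma computable_pfst [comp_intros]:
  assumes "computable k f" shows "computable k (\<lambda>e. pfst (f e))"
proof (rule computable_app1[OF _ assms])
  have "(LEAST a. \<exists>b\<le>z. prod_encode (a, b) = z) = pfst z" for z
    by (rule Least_equality) (auto intro!: exI[of _ "psnd z"] simp: psnd_le)
  moreover have "computable 1 (\<lambda>e. LEAST a. \<exists>b\<le>e 0. prod_encode (a, b) = e 0)"
    by (rule computable_Least) ((intro comp_intros; simp), metis encode_pfst_psnd psnd_le)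
  ultimately show "computable 1 (\<lambda>e. pfst (e 0))" by simp
qed

lemma computable_psnd [comp_intros]:
  assumes "computable k f" shows "computable k (\<lambda>e. psnd (f e))"
proof (rule computable_app1[OF _ assms])
  have "(LEAST b. prod_encode (pfst z, b) = z) = psnd z" for z
    by (rule Least_equality) (use psnd_encode in \<open>auto, metis order.refl\<close>)
  moreover have "computable 1 (\<lambda>e. LEAST b. prod_encode (pfst (e 0), b) = e 0)"
    by (rule computable_Least) ((intro comp_intros; simp), metis encode_pfst_psnd)
  ultimately show "computable 1 (\<lambda>e. psnd (e 0))" by simp
qed

text \<open>\<open>list_encode\<close> gives the empty list the code 0 and a nonempty list the
  successor of the pair of head and coded tail, hence the predecessor. Since
  \<open>ltl 0 = 0\<close>, dropping past the end stays at 0, and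
  \<open>ldrop k c \<noteq> 0\<close> says that \<open>k\<close> is a position of the coded
  list.\<close>

definition lhd :: "nat \<Rightarrow> nat" where "lhd x = pfst (x - 1)"
definition ltl :: "nat \<Rightarrow> nat" where "ltl x = psnd (x - 1)"
definition ldrop :: "nat \<Rightarrow> nat \<Rightarrow> nat" where "ldrop n x = (ltl ^^ n) x"

lemma computable_lhd [comp_intros]: "computable k f \<Longrightarrow> computable k (\<lambda>e. lhd (f e))"
  unfolding lhd_def by (auto intro!: comp_intros)

lemma computable_ltl [comp_intros]: "computable k f \<Longrightarrow> computable k (\<lambda>e. ltl (f e))"
  unfolding ltl_def by (auto intro!: comp_intros)

lemma computable_ldrop [comp_intros]:
  assumes "computable k f" "computable k g" shows "computable k (\<lambda>e. ldrop (f e) (g e))"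
proof (rule computable_app2[OF _ assms])
  have "rec_nat x (\<lambda>m v. ltl v) n = ldrop n x" for n x by (induction n) (auto simp: ldrop_def)
  moreover have "computable 2 (\<lambda>e. rec_nat (e 1) (\<lambda>m v. ltl v) (e 0))"
    by (intro comp_intros) auto
  ultimately show "computable 2 (\<lambda>e. ldrop (e 0) (e 1))" by simp
qed

lemma lhd_Cons [simp]: "lhd (list_encode (x # xs)) = x"
  and ltl_Cons [simp]: "ltl (list_encode (x # xs)) = list_encode xs"
  by (simp_all add: lhd_def ltl_def)

lemma ltl_list: "ltl (list_encode xs) = list_encode (tl xs)"
  using psnd_le[of 0] by (cases xs) (auto simp: ltl_def)

lemma ldrop_list: "ldrop n (list_encode xs) = list_encode (drop n xs)"
  unfolding ldrop_def by (induction n) (auto simp: ltl_list drop_Suc tl_drop)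

lemma list_encode_eq_0: "list_encode xs = 0 \<longleftrightarrow> xs = []"
  by (cases xs) auto

lemma length_le_list_encode: "length xs \<le> list_encode xs"
proof (induction xs)
  case (Cons x xs)
  thus ?case using le_prod_encode_2[of "list_encode xs" x] by simp
qed simp

lemma member_le_list_encode: "x \<in> set xs \<Longrightarrow> x \<le> list_encode xs"
proof (induction xs)
  case (Cons y ys)
  thus ?case using le_prod_encode_1[of y "list_encode ys"] le_prod_encode_2[of "list_encode ys" y] by auto
qed simp

text \<open>The length of a list is at most its code, so \<open>k < c\<close> reaches every
  position.\<close>

definition lmem :: "nat \<Rightarrow> nat \<Rightarrow> bool" where
  "lmem x c \<longleftrightarrow> (\<exists>k<c. ldrop k c \<noteq> 0 \<and> lhd (ldrop k c) = x)"

lemma lmem_list: "lmem x (list_encode xs) \<longleftrightarrow> x \<in> set xs"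
proof -
  have "lmem x (list_encode xs) \<longleftrightarrow> (\<exists>k<list_encode xs. k < length xs \<and> xs ! k = x)"
    unfolding lmem_def ldrop_list list_encode_eq_0
    by (intro ex_cong1 conj_cong refl) (auto simp: Cons_nth_drop_Suc[symmetric] simp del: list_encode.simps)
  also have "\<dots> \<longleftrightarrow> x \<in> set xs"
    using length_le_list_encode[of xs] by (auto simp: in_set_conv_nth intro: less_le_trans)
  finally show ?thesis .
qed

lemma decidable_lmem [comp_intros]:
  assumes "computable k f" "computable k g" shows "decidable k (\<lambda>e. lmem (f e) (g e))"
  by (rule decidable_app2[OF _ assms]) (unfold lmem_def, (intro comp_intros)+, auto)

subsection \<open>Primes\<close>

lemma decidable_prime [comp_intros]:
  assumes "computable k f" shows "decidable k (\<lambda>e. prime (f e))"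
proof (rule decidable_app1[OF _ assms])
  have "prime n \<longleftrightarrow> 1 < n \<and> (\<forall>d\<le>n. d dvd n \<longrightarrow> d = 1 \<or> d = n)" for n :: nat
    unfolding prime_nat_iff by (cases "n = 0") (auto dest: dvd_imp_le)
  moreover have "decidable 1 (\<lambda>e. 1 < e 0 \<and> (\<forall>d\<le>e 0. d dvd e 0 \<longrightarrow> d = 1 \<or> d = e 0))"
    by (intro comp_intros) auto
  ultimately show "decidable 1 (\<lambda>e. prime (e 0))" by simp
qed

primrec pr :: "nat \<Rightarrow> nat" where
  "pr 0 = 2"
| "pr (Suc n) = (LEAST p. prime p \<and> pr n < p)"

lemma pr_Suc: "prime (pr (Suc n)) \<and> pr n < pr (Suc n)"
  unfolding pr.simps(2)[of n] using bigger_prime[of "pr n"] by (intro LeastI_ex[of "\<lambda>p. prime p \<and> pr n < p"]) auto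

lemma prime_pr: "prime (pr n)"
  by (cases n) (simp_all add: pr_Suc del: pr.simps(2))

lemma strict_mono_pr: "strict_mono pr"
  using pr_Suc by (simp add: strict_mono_Suc_iff)

lemma pr_eq_iff [simp]: "pr m = pr n \<longleftrightarrow> m = n"
  using strict_mono_pr by (simp add: strict_mono_eq)

lemma pr_gt: "n < pr n"
  by (induction n) (use pr_Suc in \<open>auto simp del: pr.simps(2) intro: less_le_trans Suc_leI le_less_trans\<close>)

lemma computable_pr [comp_intros]:
  assumes "computable k f" shows "computable k (\<lambda>e. pr (f e))"
proof (rule computable_app1[OF _ assms])
  have "rec_nat 2 (\<lambda>m v. LEAST p. prime p \<and> v < p) n = pr n" for n by (induction n) auto
  moreover have "computable 1 (\<lambda>e. rec_nat 2 (\<lambda>m v. LEAST p. prime p \<and> v < p) (e 0))"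
    by (intro comp_intros) (use bigger_prime in auto)
  ultimately show "computable 1 (\<lambda>e. pr (e 0))" by simp
qed

lemma multiplicity_le: "prime p \<Longrightarrow> multiplicity p x \<le> (x :: nat)"
proof (cases "x = 0")
  case False
  assume "prime p"
  hence "2 ^ multiplicity p x \<le> p ^ multiplicity p x" by (intro power_mono) (auto simp: prime_ge_2_nat)
  also have "\<dots> \<le> x" using multiplicity_dvd False by (intro dvd_imp_le) auto
  finally show ?thesis using less_exp[of "multiplicity p x"] by linarith
qed simp

text \<open>The multiplicity counts the \<open>i\<close> for which the power with exponent
  \<open>Suc i\<close> divides; being at most \<open>x\<close>, it is reached by counting below
  \<open>x\<close>. For \<open>x = 0\<close> the empty sum agrees with the convention that the
  multiplicity is 0.\<close>

lemma computable_multiplicity [comp_intros]: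
  assumes "computable k f" "computable k g" shows "computable k (\<lambda>e. multiplicity (pr (f e)) (g e))"
proof (rule computable_app2[OF _ assms, of "\<lambda>n x. multiplicity (pr n) x"])
  have "(\<Sum>i<x. of_bool (pr n ^ Suc i dvd x)) = multiplicity (pr n) x" for n x
  proof (cases "x = 0")
    case False
    have "(\<Sum>i<x. of_bool (pr n ^ Suc i dvd x)) = (\<Sum>i<x. of_bool (i < multiplicity (pr n) x))"
    proof (intro sum.cong refl arg_cong[of _ _ of_bool])
      fix i
      show "pr n ^ Suc i dvd x \<longleftrightarrow> i < multiplicity (pr n) x"
        using power_dvd_iff_le_multiplicity[of x "pr n" "Suc i"] False not_prime_unit[of "pr n"] prime_pr[of n]
        by (metis Suc_le_eq)
    qed
    also have "\<dots> = card {i. i < x \<and> i < multiplicity (pr n) x}"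
      by (simp add: sum_of_bool_eq Collect_conj_eq lessThan_def)
    also have "{i. i < x \<and> i < multiplicity (pr n) x} = {..<multiplicity (pr n) x}"
      using multiplicity_le[OF prime_pr, of n x] by auto
    finally show ?thesis by simp
  qed simp
  moreover have "computable 2 (\<lambda>e. \<Sum>i<e 1. of_bool (pr (e 0) ^ Suc i dvd e 1))"
    by (intro comp_intros) auto
  ultimately show "computable 2 (\<lambda>e. multiplicity (pr (e 0)) (e 1))" by simp
qed

section \<open>A universal \<open>\<Pi>\<^sub>2\<^sup>0\<close> predicate\<close>

text \<open>
  A computation is certified by a list of facts \<open>\<langle>p, \<langle>xs, r\<rangle>\<rangle>\<close>, read ``program \<open>p\<close> on
  arguments \<open>xs\<close> returns \<open>r\<close>'', in which every fact follows from facts later in the list.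
\<close>

definition fact_code :: "nat \<Rightarrow> nat \<Rightarrow> nat \<Rightarrow> nat" where
  "fact_code p xs r = prod_encode (p, prod_encode (xs, r))"

definition lcons :: "nat \<Rightarrow> nat \<Rightarrow> nat" where "lcons x xs = Suc (prod_encode (x, xs))"

text \<open>\<open>ys\<close> codes the list of intermediate values. It occurs inside a fact of
  \<open>d\<close>, hence the bound \<open>ys \<le> d\<close>. Requiring the two coded lists to be
  exhausted at the same positions forces equal lengths.\<close>

definition follows_comp :: "nat \<Rightarrow> nat \<Rightarrow> nat \<Rightarrow> nat \<Rightarrow> bool" where
  "follows_comp a xs r d \<longleftrightarrow> (\<exists>ys\<le>d. lmem (fact_code (pfst a) ys r) d \<and>
     (\<forall>k\<le>psnd a. (ldrop k (psnd a) = 0 \<longleftrightarrow> ldrop k ys = 0) \<and>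
       (ldrop k ys = 0 \<or> lmem (fact_code (lhd (ldrop k (psnd a))) xs (lhd (ldrop k ys))) d)))"

text \<open>\<open>p\<close> is the code of the recursion itself, needed for the fact about the
  previous value; \<open>a\<close> is the pair of its two components.\<close>

definition follows_rec :: "nat \<Rightarrow> nat \<Rightarrow> nat \<Rightarrow> nat \<Rightarrow> nat \<Rightarrow> bool" where
  "follows_rec p a xs r d \<longleftrightarrow> xs \<noteq> 0 \<and>
     (if lhd xs = 0 then lmem (fact_code (pfst a) (ltl xs) r) d
      else \<exists>v\<le>d. lmem (fact_code p (lcons (lhd xs - 1) (ltl xs)) v) d \<and>
             lmem (fact_code (psnd a) (lcons (lhd xs - 1) (lcons v (ltl xs))) r) d)"

definition follows_min :: "nat \<Rightarrow> nat \<Rightarrow> nat \<Rightarrow> nat \<Rightarrow> bool" where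
  "follows_min a xs r d \<longleftrightarrow> lmem (fact_code a (lcons r xs) 0) d \<and>
     (\<forall>m<r. \<exists>v\<le>d. 0 < v \<and> lmem (fact_code a (lcons m xs) v) d)"

text \<open>\<open>t\<close> is the constructor tag of \<open>encode\<close>. Tags above 5 belong to
  no program and fall into the last branch; soundness is claimed only for facts about codes of
  programs.\<close>

definition follows :: "nat \<Rightarrow> nat \<Rightarrow> nat \<Rightarrow> nat \<Rightarrow> nat \<Rightarrow> bool" where
  "follows t a xs r d \<longleftrightarrow>
     (if t = 0 then r = 0
      else if t = 1 then xs \<noteq> 0 \<and> r = Suc (lhd xs)
      else if t = 2 then ldrop a xs \<noteq> 0 \<and> r = lhd (ldrop a xs)
      else if t = 3 then follows_comp a xs r d
      else if t = 4 then follows_rec (prod_encode (t, a)) a xs r d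
      else follows_min a xs r d)"

definition valid_cert :: "nat \<Rightarrow> bool" where
  "valid_cert c \<longleftrightarrow> (\<forall>k<c. ldrop k c \<noteq> 0 \<longrightarrow>
     (let f = lhd (ldrop k c) in
       follows (pfst (pfst f)) (psnd (pfst f)) (pfst (psnd f)) (psnd (psnd f)) (ltl (ldrop k c))))"

lemma fact_code_sel [simp]:
  "pfst (fact_code p xs r) = p" "pfst (psnd (fact_code p xs r)) = xs" "psnd (psnd (fact_code p xs r)) = r"
  by (simp_all add: fact_code_def)

lemma computable_fact_code [comp_intros]:
  "computable k f \<Longrightarrow> computable k g \<Longrightarrow> computable k h \<Longrightarrow> computable k (\<lambda>e. fact_code (f e) (g e) (h e))"
  unfolding fact_code_def by (intro comp_intros)

lemma computable_lcons [comp_intros]: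
  "computable k f \<Longrightarrow> computable k g \<Longrightarrow> computable k (\<lambda>e. lcons (f e) (g e))"
  unfolding lcons_def by (intro comp_intros)

lemma computable_app4:
  assumes "computable 4 (\<lambda>e. f (e 0) (e 1) (e 2) (e 3))"
    "computable k a" "computable k b" "computable k c" "computable k d"
  shows "computable k (\<lambda>e. f (a e) (b e) (c e) (d e))"
  using computable_compose[OF assms(1), of k "\<lambda>i. if i = 0 then a else if i = 1 then b else if i = 2 then c else d"]
    assms(2-) by simp

lemma decidable_app4:
  assumes "decidable 4 (\<lambda>e. P (e 0) (e 1) (e 2) (e 3))"
    "computable k a" "computable k b" "computable k c" "computable k d"
  shows "decidable k (\<lambda>e. P (a e) (b e) (c e) (d e))"
  using computable_app4[of "\<lambda>x y z w. of_bool (P x y z w)"] assms by (simp add: decidable_def)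

lemma decidable_follows_comp [comp_intros]:
  assumes "computable k a" "computable k b" "computable k c" "computable k d"
  shows "decidable k (\<lambda>e. follows_comp (a e) (b e) (c e) (d e))"
  by (rule decidable_app4[OF _ assms]) (unfold follows_comp_def, intro comp_intros; simp)

lemma decidable_follows_min [comp_intros]:
  assumes "computable k a" "computable k b" "computable k c" "computable k d"
  shows "decidable k (\<lambda>e. follows_min (a e) (b e) (c e) (d e))"
  by (rule decidable_app4[OF _ assms]) (unfold follows_min_def, intro comp_intros; simp)

lemma decidable_follows_rec [comp_intros]:
  assumes "computable k p" "computable k a" "computable k b" "computable k c" "computable k d"
  shows "decidable k (\<lambda>e. follows_rec (p e) (a e) (b e) (c e) (d e))"
proof -
  have "decidable 4 (\<lambda>e. follows_rec (pfst (e 0)) (psnd (e 0)) (e 1) (e 2) (e 3))"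
    unfolding follows_rec_def by (intro comp_intros; simp)
  from decidable_app4[OF this, of k "\<lambda>e. prod_encode (p e, a e)"] show ?thesis
    using assms by (simp add: computable_prod_encode)
qed

lemma decidable_follows [comp_intros]:
  assumes "computable k p" "computable k a" "computable k b" "computable k c" "computable k d"
  shows "decidable k (\<lambda>e. follows (p e) (a e) (b e) (c e) (d e))"
  unfolding follows_def by (intro comp_intros assms)

lemma decidable_valid_cert [comp_intros]:
  assumes "computable k f" shows "decidable k (\<lambda>e. valid_cert (f e))"
  by (rule decidable_app1[OF _ assms]) (unfold valid_cert_def Let_def, intro comp_intros; simp)

lemma lcons_list [simp]: "lcons x (list_encode xs) = list_encode (x # xs)"
  by (simp add: lcons_def)

section \<open>Certificates as lists of facts\<close>

definition fact_of :: "prog \<Rightarrow> nat list \<Rightarrow> nat \<Rightarrow> nat" where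
  "fact_of p xs r = fact_code (encode p) (list_encode xs) r"

definition follows_from :: "nat \<Rightarrow> nat list \<Rightarrow> bool" where
  "follows_from f ds \<longleftrightarrow>
     follows (pfst (pfst f)) (psnd (pfst f)) (pfst (psnd f)) (psnd (psnd f)) (list_encode ds)"

fun valid_facts :: "nat list \<Rightarrow> bool" where
  "valid_facts [] = True"
| "valid_facts (f # ds) \<longleftrightarrow> follows_from f ds \<and> valid_facts ds"

lemma valid_facts_iff_drop:
  "valid_facts cs \<longleftrightarrow> (\<forall>k<length cs. follows_from (cs ! k) (drop (Suc k) cs))"
  by (induction cs) (auto simp: nth_Cons' less_Suc_eq_0_disj)

lemma valid_cert_list: "valid_cert (list_encode cs) \<longleftrightarrow> valid_facts cs"
proof -
  have "valid_cert (list_encode cs) \<longleftrightarrow>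
      (\<forall>k<list_encode cs. k < length cs \<longrightarrow> follows_from (cs ! k) (drop (Suc k) cs))"
    unfolding valid_cert_def ldrop_list list_encode_eq_0
    by (intro all_cong1 imp_cong refl)
       (auto simp: Cons_nth_drop_Suc[symmetric] Let_def follows_from_def simp del: list_encode.simps)
  also have "\<dots> \<longleftrightarrow> valid_facts cs"
    using length_le_list_encode[of cs] by (auto simp: valid_facts_iff_drop intro: less_le_trans)
  finally show ?thesis .
qed

lemma fact_code_le: "xs \<le> fact_code p xs r" "r \<le> fact_code p xs r"
  unfolding fact_code_def
  using le_prod_encode_1[of xs r] le_prod_encode_2[of r xs] le_prod_encode_2[of "prod_encode (xs, r)" p]
  by linarith+

lemma drop_Cons_nth: "k < length xs \<Longrightarrow> list_encode (drop k xs) = list_encode (xs ! k # drop (Suc k) xs)"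
  by (simp add: Cons_nth_drop_Suc)

lemma follows_comp_list:
  "follows_comp (prod_encode (p, list_encode qs)) xs r (list_encode ds) \<longleftrightarrow>
    (\<exists>ys. fact_code p (list_encode ys) r \<in> set ds \<and> length ys = length qs \<and>
      (\<forall>k<length qs. fact_code (qs ! k) xs (ys ! k) \<in> set ds))" (is "?L \<longleftrightarrow> ?R")
proof
  assume ?L
  then obtain y where y: "lmem (fact_code p y r) (list_encode ds)"
    "\<And>k. k \<le> list_encode qs \<Longrightarrow> ldrop k (list_encode qs) = 0 \<longleftrightarrow> ldrop k y = 0"
    "\<And>k. k \<le> list_encode qs \<Longrightarrow> ldrop k y = 0 \<or>
        lmem (fact_code (lhd (ldrop k (list_encode qs))) xs (lhd (ldrop k y))) (list_encode ds)"
    unfolding follows_comp_def psnd_encode pfst_encode by metis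
  define ys where "ys = list_decode y"
  have ys: "y = list_encode ys" by (simp add: ys_def)
  \<comment> \<open>Only positions up to the length of \<open>qs\<close> are compared; testing at
    the two lengths rules out that either list is shorter.\<close>
  have len: "length qs \<le> k \<longleftrightarrow> length ys \<le> k" if "k \<le> length qs" for k
    using y(2)[of k] that length_le_list_encode[of qs] by (simp add: ys ldrop_list list_encode_eq_0)
  have l: "length ys = length qs"
  proof (rule ccontr)
    assume "length ys \<noteq> length qs"
    thus False using len[of "length ys"] len[of "length qs"] by (cases "length ys \<le> length qs") auto
  qed
  have "fact_code (qs ! k) xs (ys ! k) \<in> set ds" if "k < length qs" for k
    using y(3)[of k] that l length_le_list_encode[of qs]
    by (simp add: ys ldrop_list list_encode_eq_0 lmem_list)
       (simp only: drop_Cons_nth lhd_Cons)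
  with y(1) l ys show ?R by (auto simp: lmem_list)
next
  assume ?R
  then obtain ys where ys: "fact_code p (list_encode ys) r \<in> set ds" "length ys = length qs"
      "\<And>k. k<length qs \<Longrightarrow> fact_code (qs ! k) xs (ys ! k) \<in> set ds" by blast
  have "list_encode ys \<le> list_encode ds"
    using fact_code_le(1) member_le_list_encode[OF ys(1)] by (rule order.trans)
  moreover have "lmem (fact_code (lhd (ldrop k (list_encode qs))) xs (lhd (ldrop k (list_encode ys)))) (list_encode ds)"
    if "k < length qs" for k
    unfolding ldrop_list drop_Cons_nth[OF that] drop_Cons_nth[OF that[folded ys(2)]] lhd_Cons lmem_list
    using ys(3) that by blast
  ultimately show ?L
    unfolding follows_comp_def psnd_encode pfst_encode
    using ys(1,2) by (intro exI[of _ "list_encode ys"]) (auto simp: lmem_list ldrop_list list_encode_eq_0, metis not_le)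
qed

lemma follows_rec_list:
  "follows_rec f (prod_encode (p, q)) (list_encode xs) r (list_encode ds) \<longleftrightarrow>
    (case xs of [] \<Rightarrow> False | x # ys \<Rightarrow>
      (case x of 0 \<Rightarrow> fact_code p (list_encode ys) r \<in> set ds
       | Suc m \<Rightarrow> \<exists>v. fact_code f (list_encode (m # ys)) v \<in> set ds \<and>
           fact_code q (list_encode (m # v # ys)) r \<in> set ds))"
proof (cases xs)
  case (Cons x ys)
  have "\<exists>v\<le>list_encode ds. fact_code f a v \<in> set ds \<and> P v" if "fact_code f a v \<in> set ds" "P v" for a v P
    using that fact_code_le(2)[where r = v] member_le_list_encode[OF that(1)] order.trans by blast
  hence "(\<exists>v\<le>list_encode ds. fact_code f a v \<in> set ds \<and> P v) \<longleftrightarrow> (\<exists>v. fact_code f a v \<in> set ds \<and> P v)" for a P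
    by blast
  moreover have "list_encode (x # ys) \<noteq> 0" by simp
  ultimately show ?thesis using Cons
    by (cases x) (simp_all add: follows_rec_def lmem_list del: list_encode.simps)
qed (simp add: follows_rec_def)

lemma follows_min_list:
  "follows_min p (list_encode xs) r (list_encode ds) \<longleftrightarrow>
    fact_code p (list_encode (r # xs)) 0 \<in> set ds \<and>
    (\<forall>m<r. \<exists>v>0. fact_code p (list_encode (m # xs)) v \<in> set ds)"
proof -
  have "\<exists>v\<le>list_encode ds. 0 < v \<and> fact_code p a v \<in> set ds" if "fact_code p a v \<in> set ds" "v > 0" for a v
    using that fact_code_le(2)[where r = v] member_le_list_encode[OF that(1)] order.trans by blast
  hence "(\<exists>v\<le>list_encode ds. 0 < v \<and> fact_code p a v \<in> set ds) \<longleftrightarrow> (\<exists>v>0. fact_code p a v \<in> set ds)" for a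
    by blast
  thus ?thesis
    by (simp add: follows_min_def lmem_list del: list_encode.simps)
qed

lemma follows_from_fact_of:
  "follows_from (fact_of PZero xs r) ds \<longleftrightarrow> r = 0"
  "follows_from (fact_of PSucc xs r) ds \<longleftrightarrow> xs \<noteq> [] \<and> r = Suc (hd xs)"
  "follows_from (fact_of (PProj i) xs r) ds \<longleftrightarrow> i < length xs \<and> r = xs ! i"
  "follows_from (fact_of (PComp p qs) xs r) ds \<longleftrightarrow>
    (\<exists>ys. fact_of p ys r \<in> set ds \<and> length ys = length qs \<and>
      (\<forall>k<length qs. fact_of (qs ! k) xs (ys ! k) \<in> set ds))"
  "follows_from (fact_of (PRec p q) xs r) ds \<longleftrightarrow>
    (case xs of [] \<Rightarrow> False | x # ys \<Rightarrow>
      (case x of 0 \<Rightarrow> fact_of p ys r \<in> set ds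
       | Suc m \<Rightarrow> \<exists>v. fact_of (PRec p q) (m # ys) v \<in> set ds \<and> fact_of q (m # v # ys) r \<in> set ds))"
  "follows_from (fact_of (PMin p) xs r) ds \<longleftrightarrow>
    fact_of p (r # xs) 0 \<in> set ds \<and> (\<forall>m<r. \<exists>v>0. fact_of p (m # xs) v \<in> set ds)"
proof -
  note d = follows_from_def fact_of_def follows_def
  show "follows_from (fact_of PZero xs r) ds \<longleftrightarrow> r = 0"
    by (simp add: d)
  show "follows_from (fact_of PSucc xs r) ds \<longleftrightarrow> xs \<noteq> [] \<and> r = Suc (hd xs)"
    by (cases xs) (simp_all add: d list_encode_eq_0 del: list_encode.simps)
  show "follows_from (fact_of (PProj i) xs r) ds \<longleftrightarrow> i < length xs \<and> r = xs ! i"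
    by (cases "i < length xs") (simp_all add: d list_encode_eq_0 ldrop_list drop_Cons_nth del: list_encode.simps)
  show "follows_from (fact_of (PComp p qs) xs r) ds \<longleftrightarrow>
    (\<exists>ys. fact_of p ys r \<in> set ds \<and> length ys = length qs \<and>
      (\<forall>k<length qs. fact_of (qs ! k) xs (ys ! k) \<in> set ds))"
    unfolding d by (simp add: follows_comp_list cong: conj_cong)
  show "follows_from (fact_of (PRec p q) xs r) ds \<longleftrightarrow>
    (case xs of [] \<Rightarrow> False | x # ys \<Rightarrow>
      (case x of 0 \<Rightarrow> fact_of p ys r \<in> set ds
       | Suc m \<Rightarrow> \<exists>v. fact_of (PRec p q) (m # ys) v \<in> set ds \<and> fact_of q (m # v # ys) r \<in> set ds))"
    unfolding d by (simp add: follows_rec_list del: list_encode.simps split: list.split nat.split)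
  show "follows_from (fact_of (PMin p) xs r) ds \<longleftrightarrow>
    fact_of p (r # xs) 0 \<in> set ds \<and> (\<forall>m<r. \<exists>v>0. fact_of p (m # xs) v \<in> set ds)"
    unfolding d by (simp add: follows_min_list del: list_encode.simps)
qed

section \<open>Soundness of certificates\<close>

lemma those_eq_Some_iff: "those xs = Some ys \<longleftrightarrow> length xs = length ys \<and> (\<forall>k<length xs. xs ! k = Some (ys ! k))"
proof (induction xs arbitrary: ys)
  case (Cons x xs)
  show ?case
    by (cases ys) (auto simp: Cons.IH less_Suc_eq_0_disj split: option.splits)
qed auto

lemma follows_from_sound:
  assumes "follows_from (fact_of p xs r) ds"
    "\<And>p xs r. fact_of p xs r \<in> set ds \<Longrightarrow> eval p xs = Some r"
  shows "eval p xs = Some r"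
proof (cases p)
  case (PComp p' qs)
  obtain ys where ys: "fact_of p' ys r \<in> set ds" "length ys = length qs"
      "\<forall>k<length qs. fact_of (qs ! k) xs (ys ! k) \<in> set ds"
    using assms(1) unfolding PComp follows_from_fact_of by blast
  hence "eval p' ys = Some r" "\<forall>k<length qs. eval (qs ! k) xs = Some (ys ! k)"
    using assms(2) by blast+
  hence "those (map (\<lambda>q. eval q xs) qs) = Some ys"
    using ys(2) by (simp add: those_eq_Some_iff)
  with PComp \<open>eval p' ys = Some r\<close> show ?thesis by simp
next
  case (PRec p' q)
  have *: "case xs of [] \<Rightarrow> False | x # ys \<Rightarrow>
      (case x of 0 \<Rightarrow> fact_of p' ys r \<in> set ds
       | Suc m \<Rightarrow> \<exists>v. fact_of (PRec p' q) (m # ys) v \<in> set ds \<and> fact_of q (m # v # ys) r \<in> set ds)"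
    using assms(1) unfolding PRec follows_from_fact_of .
  then obtain x ys where xs: "xs = x # ys" by (cases xs) auto
  show ?thesis
  proof (cases x)
    case 0
    with * xs have "eval p' ys = Some r" by (simp add: assms(2))
    with PRec xs 0 show ?thesis by simp
  next
    case (Suc m)
    with * xs obtain v where "fact_of (PRec p' q) (m # ys) v \<in> set ds" "fact_of q (m # v # ys) r \<in> set ds"
      by auto
    hence "eval (PRec p' q) (m # ys) = Some v" "eval q (m # v # ys) = Some r"
      using assms(2) by blast+
    with PRec xs Suc show ?thesis by simp
  qed
next
  case (PMin p')
  with assms have z: "eval p' (r # xs) = Some 0" and m: "\<forall>m<r. \<exists>v>0. eval p' (m # xs) = Some v"
    unfolding PMin follows_from_fact_of by blast+
  hence "(LEAST n. eval p' (n # xs) = Some 0) = r"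
    by (intro Least_equality) (auto simp: not_less[symmetric])
  moreover have "\<exists>n. eval p' (n # xs) = Some 0 \<and> (\<forall>m<n. eval p' (m # xs) \<noteq> None)"
    using z m by (metis option.distinct(1))
  ultimately show ?thesis using PMin by simp
qed (use assms in \<open>auto simp: follows_from_fact_of neq_Nil_conv\<close>)

lemma valid_facts_sound:
  "valid_facts ds \<Longrightarrow> fact_of p xs r \<in> set ds \<Longrightarrow> eval p xs = Some r"
proof (induction ds arbitrary: p xs r)
  case (Cons f ds)
  thus ?case using follows_from_sound[of p xs r ds] by auto
qed simp

section \<open>Completeness of certificates\<close>

lemma follows_from_mono:
  assumes "follows_from (fact_of p xs r) ds" "set ds \<subseteq> set ds'"
  shows "follows_from (fact_of p xs r) ds'"
  using assms by (cases p) (auto simp: follows_from_fact_of subset_iff split: list.splits nat.splits | meson)+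

text \<open>All facts are required to concern programs because certificates get concatenated, and
  \<open>follows_from_mono\<close> speaks of such facts only.\<close>

definition certified :: "prog \<Rightarrow> nat list \<Rightarrow> nat \<Rightarrow> bool" where
  "certified p xs r \<longleftrightarrow> (\<exists>ds. valid_facts ds \<and> fact_of p xs r \<in> set ds \<and> (\<forall>f\<in>set ds. \<exists>p xs r. f = fact_of p xs r))"

lemma valid_facts_append:
  assumes "valid_facts as" "valid_facts bs" "\<forall>f\<in>set as. \<exists>p xs r. f = fact_of p xs r"
  shows "valid_facts (as @ bs)"
  using assms by (induction as) (auto intro: follows_from_mono)

lemma certified_finite:
  assumes "\<forall>k<(n::nat). certified (P k) (X k) (R k)"
  shows "\<exists>ds. valid_facts ds \<and> (\<forall>f\<in>set ds. \<exists>p xs r. f = fact_of p xs r) \<and> (\<forall>k<n. fact_of (P k) (X k) (R k) \<in> set ds)"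
  using assms
proof (induction n)
  case 0
  thus ?case by (intro exI[of _ "[]"]) simp
next
  case (Suc n)
  then obtain ds where ds: "valid_facts ds" "\<forall>f\<in>set ds. \<exists>p xs r. f = fact_of p xs r"
      "\<forall>k<n. fact_of (P k) (X k) (R k) \<in> set ds" by auto
  moreover obtain es where "valid_facts es" "\<forall>f\<in>set es. \<exists>p xs r. f = fact_of p xs r"
      "fact_of (P n) (X n) (R n) \<in> set es" using Suc.prems by (auto simp: certified_def)
  ultimately show ?case
    by (intro exI[of _ "ds @ es"]) (auto simp: valid_facts_append less_Suc_eq)
qed

text \<open>Certificates of the premises are concatenated and the conclusion is put in front.
  Indexing the premises by numbers below \<open>n\<close> lets one rule serve compositions of any
  arity, recursion steps with two premises and minimisation with \<open>r + 1\<close>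
  premises.\<close>

lemma certifiedI:
  assumes "\<forall>k<(n::nat). certified (P k) (X k) (R k)"
    "\<And>ds. (\<forall>k<n. fact_of (P k) (X k) (R k) \<in> set ds) \<Longrightarrow> follows_from (fact_of p xs r) ds"
  shows "certified p xs r"
proof -
  obtain ds where ds: "valid_facts ds" "\<forall>f\<in>set ds. \<exists>p xs r. f = fact_of p xs r"
      "\<forall>k<n. fact_of (P k) (X k) (R k) \<in> set ds"
    using certified_finite[OF assms(1)] by blast
  thus ?thesis
    using assms(2)[OF ds(3)] unfolding certified_def by (intro exI[of _ "fact_of p xs r # ds"]) auto
qed

lemma eval_certified: "eval p xs = Some r \<Longrightarrow> certified p xs r"
proof (induction p arbitrary: xs r)
  case PZero
  thus ?case by (intro certifiedI[of 0]) (auto simp: follows_from_fact_of)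
next
  case PSucc
  thus ?case by (intro certifiedI[of 0]) (auto simp: follows_from_fact_of split: list.splits)
next
  case (PProj i)
  thus ?case by (intro certifiedI[of 0]) (auto simp: follows_from_fact_of split: if_splits)
next
  case (PComp p qs)
  then obtain ys where ys: "those (map (\<lambda>q. eval q xs) qs) = Some ys" "eval p ys = Some r"
    by (auto simp: bind_eq_Some_conv)
  hence len: "length ys = length qs" and q: "\<forall>k<length qs. eval (qs ! k) xs = Some (ys ! k)"
    by (auto simp: those_eq_Some_iff)
  show ?case
  proof (rule certifiedI[of "Suc (length qs)" "case_nat p ((!) qs)" "case_nat ys (\<lambda>_. xs)" "case_nat r ((!) ys)"])
    show "\<forall>k<Suc (length qs). certified (case k of 0 \<Rightarrow> p | Suc k \<Rightarrow> qs ! k)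
        (case k of 0 \<Rightarrow> ys | Suc _ \<Rightarrow> xs) (case k of 0 \<Rightarrow> r | Suc k \<Rightarrow> ys ! k)"
      using PComp.IH ys(2) q by (auto split: nat.splits)
  qed (use len in \<open>force simp: follows_from_fact_of All_less_Suc2\<close>)
next
  case (PRec p q)
  from PRec.prems obtain n ys where xs: "xs = n # ys" by (auto split: list.splits)
  have "eval (PRec p q) (n # ys) = Some r \<Longrightarrow> certified (PRec p q) (n # ys) r" for r
  proof (induction n arbitrary: r)
    case 0
    thus ?case using PRec.IH(1)
      by (intro certifiedI[of 1 "\<lambda>_. p" "\<lambda>_. ys" "\<lambda>_. r"]) (auto simp: follows_from_fact_of)
  next
    case (Suc n)
    then obtain v where v: "eval (PRec p q) (n # ys) = Some v" "eval q (n # v # ys) = Some r"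
      by (auto simp: bind_eq_Some_conv)
    show ?case
    proof (rule certifiedI[of 2 "case_nat (PRec p q) (\<lambda>_. q)" "case_nat (n # ys) (\<lambda>_. n # v # ys)" "case_nat v (\<lambda>_. r)"])
      show "\<forall>k<2. certified (case k of 0 \<Rightarrow> PRec p q | Suc _ \<Rightarrow> q)
          (case k of 0 \<Rightarrow> n # ys | Suc _ \<Rightarrow> n # v # ys) (case k of 0 \<Rightarrow> v | Suc _ \<Rightarrow> r)"
        using Suc.IH[OF v(1)] PRec.IH(2)[OF v(2)] by (auto split: nat.splits)
    qed (auto simp: follows_from_fact_of numeral_2_eq_2 All_less_Suc2)
  qed
  with PRec.prems xs show ?case by blast
next
  case (PMin p)
  hence ex: "\<exists>n. eval p (n # xs) = Some 0 \<and> (\<forall>m<n. eval p (m # xs) \<noteq> None)"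
    and r: "r = (LEAST n. eval p (n # xs) = Some 0)"
    by (auto split: if_splits)
  have r0: "eval p (r # xs) = Some 0" using ex LeastI_ex[of "\<lambda>n. eval p (n # xs) = Some 0"] r by blast
  \<comment> \<open>\<open>r\<close> is the least zero, irrespective of divergence; that all smaller
    arguments converge comes from the comparison with the witness \<open>n\<close>.\<close>
  from ex obtain n where n: "eval p (n # xs) = Some 0" "\<forall>m<n. eval p (m # xs) \<noteq> None" by blast
  have "r \<le> n" unfolding r using n(1) by (rule Least_le)
  hence "\<forall>m<r. \<exists>v. eval p (m # xs) = Some v \<and> 0 < v"
    using n(2) not_less_Least[of _ "\<lambda>n. eval p (n # xs) = Some 0", folded r]
    by (metis gr0I less_le_trans not_None_eq)
  then obtain v where v: "\<And>m. m < r \<Longrightarrow> eval p (m # xs) = Some (v m) \<and> 0 < v m" by metis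
  show ?case
  proof (rule certifiedI[of "Suc r" "\<lambda>_. p" "\<lambda>m. m # xs" "\<lambda>m. if m < r then v m else 0"])
    show "\<forall>k<Suc r. certified p (k # xs) (if k < r then v k else 0)"
      using PMin.IH r0 v by (auto simp: less_Suc_eq)
  next
    fix ds assume *: "\<forall>k<Suc r. fact_of p (k # xs) (if k < r then v k else 0) \<in> set ds"
    have "\<exists>u>0. fact_of p (m # xs) u \<in> set ds" if "m < r" for m
      using *[rule_format, of m] that v[OF that] by auto
    with *[rule_format, of r] show "follows_from (fact_of (PMin p) xs r) ds"
      by (simp add: follows_from_fact_of)
  qed
qed

section \<open>The universal matrix\<close>

definition halts_with :: "nat \<Rightarrow> nat \<Rightarrow> nat \<Rightarrow> nat \<Rightarrow> nat \<Rightarrow> bool" where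
  "halts_with e x y i c \<longleftrightarrow> valid_cert c \<and> lmem (fact_code e (lcons x (lcons y (lcons i 0))) 1) c"

lemma halts_with_iff:
  "(\<exists>c. halts_with (encode p) x y i c) \<longleftrightarrow> eval p [x, y, i] = Some 1"
proof -
  have l: "lcons x (lcons y (lcons i 0)) = list_encode [x, y, i]" by (simp add: lcons_def)
  have "(\<exists>c. halts_with (encode p) x y i c) \<longleftrightarrow> (\<exists>cs. halts_with (encode p) x y i (list_encode cs))"
    by (metis list_decode_inverse)
  also have "\<dots> \<longleftrightarrow> (\<exists>cs. valid_facts cs \<and> fact_of p [x, y, i] 1 \<in> set cs)"
    unfolding halts_with_def l lmem_list valid_cert_list fact_of_def ..
  also have "\<dots> \<longleftrightarrow> eval p [x, y, i] = Some 1"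
    using valid_facts_sound eval_certified[of p "[x, y, i]" 1] unfolding certified_def by blast
  finally show ?thesis .
qed

text \<open>\<open>k\<close> packs the index of a decision procedure with the argument
  \<open>i\<close>; \<open>w\<close> packs the witness \<open>y\<close> with a certificate that the
  procedure returns 1. The relation is thereby decidable for all \<open>k\<close>, also when
  \<open>pfst k\<close> indexes no total procedure.\<close>

definition matrix :: "nat \<Rightarrow> nat \<Rightarrow> nat \<Rightarrow> bool" where
  "matrix k x w \<longleftrightarrow> halts_with (pfst k) x (pfst w) (psnd k) (psnd w)"

lemma decidable_matrix [comp_intros]:
  assumes "computable k f" "computable k g" "computable k h"
  shows "decidable k (\<lambda>e. matrix (f e) (g e) (h e))"
  by (rule decidable_app3[OF _ assms]) (unfold matrix_def halts_with_def, intro comp_intros; simp)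

lemma Pi02_universal:
  assumes "Pi02 Z"
  obtains e where "\<And>i. i \<in> Z \<longleftrightarrow> (\<forall>x. \<exists>w. matrix (prod_encode (e, i)) x w)"
proof -
  obtain R e where R: "decides3 e R" "\<And>i. i \<in> Z \<longleftrightarrow> (\<forall>x. \<exists>y. R x y i)"
    using assms by (auto simp: Pi02_def)
  \<comment> \<open>Numbers that encode no program index the empty function, so one convergent value
    shows that \<open>e\<close> is a code.\<close>
  have "phi e [0, 0, 0] \<noteq> None" using R(1) by (simp add: decides3_def)
  then obtain p where p: "e = encode p" by (auto simp: phi_def split: if_splits)
  have "R x y i \<longleftrightarrow> (\<exists>c. matrix (prod_encode (e, i)) x (prod_encode (y, c)))" for x y i
    using R(1) halts_with_iff[of p x y i] by (auto simp: decides3_def p matrix_def split: if_splits)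
  hence "(\<exists>y. R x y i) \<longleftrightarrow> (\<exists>w. matrix (prod_encode (e, i)) x w)" for x i
    by (metis encode_pfst_psnd)
  with R(2) that show ?thesis by metis
qed

text \<open>
  Stage \<open>s\<close> is active for \<open>k\<close> if \<open>s = \<langle>m, b\<rangle>\<close> where \<open>b\<close> is the least common bound of witnesses
  for all \<open>x < m\<close>; then the number of active stages is infinite iff all \<open>x\<close> have witnesses.
\<close>

definition active :: "nat \<Rightarrow> bool" where
  "active j \<longleftrightarrow> (let k = pfst j; m = pfst (psnd j); b = psnd (psnd j) in
     (\<forall>x<m. \<exists>w<b. matrix k x w) \<and> (b = 0 \<or> \<not> (\<forall>x<m. \<exists>w<b - 1. matrix k x w)))"

lemma decidable_active [comp_intros]:
  assumes "computable k f" shows "decidable k (\<lambda>e. active (f e))"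
  by (rule decidable_app1[OF _ assms]) (unfold active_def Let_def, intro comp_intros; simp)

text \<open>Stages of one instance are ordered by their codes; only the existence of a last one
  matters, not the order in which \<open>m\<close> grows.\<close>

definition final :: "nat \<Rightarrow> bool" where
  "final j \<longleftrightarrow> active j \<and> (\<forall>j'>j. pfst j' = pfst j \<longrightarrow> \<not> active j')"

lemma final_unique: "final j \<Longrightarrow> final j' \<Longrightarrow> pfst j = pfst j' \<Longrightarrow> j = j'"
  unfolding final_def by (metis linorder_neqE_nat)

text \<open>At most one active stage belongs to each \<open>m\<close>, and one exists precisely when
  all \<open>x < m\<close> have witnesses. So the instance holds iff there are infinitely many
  active stages; otherwise their set, nonempty because of \<open>m = 0\<close>, has a greatest
  element.\<close>

lemma final_iff: "(\<exists>j. final j \<and> pfst j = k) \<longleftrightarrow> \<not> (\<forall>x. \<exists>w. matrix k x w)"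
proof -
  define S where "S = {j. active j \<and> pfst j = k}"
  have "(\<exists>j. final j \<and> pfst j = k) \<longleftrightarrow> S \<noteq> {} \<and> finite S"
  proof
    assume "\<exists>j. final j \<and> pfst j = k"
    then obtain j where "final j" "pfst j = k" by blast
    hence "j \<in> S" "S \<subseteq> {..j}" unfolding S_def final_def by (auto simp: not_less[symmetric])
    thus "S \<noteq> {} \<and> finite S" using finite_subset by auto
  next
    assume S: "S \<noteq> {} \<and> finite S"
    hence "Max S \<in> S" "\<And>j. j \<in> S \<Longrightarrow> j \<le> Max S" by auto
    hence "final (Max S) \<and> pfst (Max S) = k"
      unfolding final_def S_def by (auto simp: not_less[symmetric])
    thus "\<exists>j. final j \<and> pfst j = k" by blast
  qed
  also have "S \<noteq> {}"
  proof -
    have "prod_encode (k, prod_encode (0, 0)) \<in> S" by (simp add: S_def active_def)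
    thus ?thesis by blast
  qed
  moreover have "finite S \<longleftrightarrow> \<not> (\<forall>x. \<exists>w. matrix k x w)"
  proof
    assume fin: "finite S"
    show "\<not> (\<forall>x. \<exists>w. matrix k x w)"
    proof
      assume "\<forall>x. \<exists>w. matrix k x w"
      then obtain w where w: "\<And>x. matrix k x (w x)" by metis
      define b where "b m = (LEAST b. \<forall>x<m. \<exists>w<b. matrix k x w)" for m
      have ex: "\<exists>b. \<forall>x<m. \<exists>w<b. matrix k x w" for m
        using w by (intro exI[of _ "Suc (Max (w ` {..<m}))"]) (metis Max_ge finite_imageI finite_lessThan imageI lessThan_iff less_Suc_eq_le)
      have "prod_encode (k, prod_encode (m, b m)) \<in> S" for m
        using LeastI_ex[OF ex, of m, folded b_def] not_less_Least[of "b m - 1" "\<lambda>b. \<forall>x<m. \<exists>w<b. matrix k x w", folded b_def]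
        by (cases "b m = 0") (auto simp: S_def active_def Let_def)
      hence "range (\<lambda>m. prod_encode (k, prod_encode (m, b m))) \<subseteq> S" by blast
      moreover have "inj (\<lambda>m. prod_encode (k, prod_encode (m, b m)))" by (rule injI) simp
      ultimately show False using fin finite_subset range_inj_infinite by blast
    qed
  next
    assume "\<not> (\<forall>x. \<exists>w. matrix k x w)"
    then obtain x where x: "\<And>w. \<not> matrix k x w" by blast
    have "S \<subseteq> (\<lambda>m. prod_encode (k, prod_encode (m, LEAST b. \<forall>x<m. \<exists>w<b. matrix k x w))) ` {..x}"
    proof
      fix j assume j: "j \<in> S"
      define m b where "m = pfst (psnd j)" and "b = psnd (psnd j)"
      have jm: "j = prod_encode (k, prod_encode (m, b))" using j by (auto simp: m_def b_def S_def)
      have b: "\<forall>x<m. \<exists>w<b. matrix k x w" "b = 0 \<or> \<not> (\<forall>x<m. \<exists>w<b - 1. matrix k x w)"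
        using j by (auto simp: S_def active_def jm)
      have "m \<le> x" using b(1) x by (metis not_less)
      moreover have "(LEAST b. \<forall>x<m. \<exists>w<b. matrix k x w) = b"
      proof (rule Least_equality)
        show "\<forall>x<m. \<exists>w<b. matrix k x w" by (rule b(1))
      next
        fix c assume c: "\<forall>x<m. \<exists>w<c. matrix k x w"
        show "b \<le> c"
        proof (rule ccontr)
          assume "\<not> b \<le> c"
          hence "c \<le> b - 1" "b \<noteq> 0" by auto
          with c b(2) show False by (meson less_le_trans)
        qed
      qed
      ultimately show "j \<in> (\<lambda>m. prod_encode (k, prod_encode (m, LEAST b. \<forall>x<m. \<exists>w<b. matrix k x w))) ` {..x}"
        using jm by auto
    qed
    thus "finite S" by (rule finite_subset) simp
  qed
  ultimately show ?thesis by blast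
qed

section \<open>Domains with a complete family of discrete valuations\<close>

text \<open>The axioms say that modulo units the nonzero elements form the free commutative monoid
  on the \<open>\<pi> i\<close>, with the \<open>V i\<close> as exponents.\<close>

locale valued_domain = domain R for R (structure) +
  fixes I :: "'i set" and V :: "'i \<Rightarrow> 'a \<Rightarrow> nat" and \<pi> :: "'i \<Rightarrow> 'a"
  assumes V_mult: "\<lbrakk>i \<in> I; x \<in> carrier R - {\<zero>}; y \<in> carrier R - {\<zero>}\<rbrakk> \<Longrightarrow> V i (x \<otimes> y) = V i x + V i y"
    and V_le_imp_divides: "\<lbrakk>x \<in> carrier R - {\<zero>}; y \<in> carrier R - {\<zero>}; \<And>i. i \<in> I \<Longrightarrow> V i x \<le> V i y\<rbrakk> \<Longrightarrow> x divides y"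
    and finite_V: "x \<in> carrier R - {\<zero>} \<Longrightarrow> finite {i \<in> I. V i x \<noteq> 0}"
    and pi_closed: "i \<in> I \<Longrightarrow> \<pi> i \<in> carrier R - {\<zero>}"
    and V_pi: "\<lbrakk>i \<in> I; j \<in> I\<rbrakk> \<Longrightarrow> V j (\<pi> i) = of_bool (j = i)"
begin

lemma divides_iff:
  assumes "x \<in> carrier R - {\<zero>}" "y \<in> carrier R - {\<zero>}"
  shows "x divides y \<longleftrightarrow> (\<forall>i\<in>I. V i x \<le> V i y)"
proof
  assume "x divides y"
  then obtain c where c: "c \<in> carrier R" "y = x \<otimes> c" by (auto simp: factor_def)
  hence "c \<in> carrier R - {\<zero>}" using assms by auto
  thus "\<forall>i\<in>I. V i x \<le> V i y" using c assms V_mult by simp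
qed (use V_le_imp_divides assms in blast)

lemma V_one: "i \<in> I \<Longrightarrow> V i \<one> = 0"
  using V_mult[of i \<one> \<one>] by simp

lemma Units_iff:
  assumes "x \<in> carrier R - {\<zero>}" shows "x \<in> Units R \<longleftrightarrow> (\<forall>i\<in>I. V i x = 0)"
proof -
  have "x \<in> Units R \<longleftrightarrow> x divides \<one>" using assms by (simp add: divides_one)
  also have "\<dots> \<longleftrightarrow> (\<forall>i\<in>I. V i x \<le> V i \<one>)" using assms by (intro divides_iff) auto
  also have "\<dots> \<longleftrightarrow> (\<forall>i\<in>I. V i x = 0)" by (intro ball_cong refl) (simp add: V_one)
  finally show ?thesis .
qed

text \<open>For a prime \<open>x\<close> choose \<open>i\<close> with \<open>V i x\<close> nonzero
  and write \<open>x\<close> as \<open>\<pi> i\<close> times \<open>y\<close>. Since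
  \<open>V i y\<close> is smaller than \<open>V i x\<close>, \<open>x\<close> does not divide
  \<open>y\<close>, so it divides \<open>\<pi> i\<close> and shares its values. Conversely,
  divisibility by an element with these values only asks for a nonzero value at \<open>i\<close>,
  and values add up.\<close>

lemma ring_prime_iff:
  assumes "x \<in> carrier R - {\<zero>}"
  shows "ring_prime x \<longleftrightarrow> (\<exists>i\<in>I. \<forall>j\<in>I. V j x = of_bool (j = i))"
proof
  assume "ring_prime x"
  hence nu: "x \<notin> Units R"
    and p: "\<And>a b. a \<in> carrier R \<Longrightarrow> b \<in> carrier R \<Longrightarrow> x divides a \<otimes> b \<Longrightarrow> x divides a \<or> x divides b"
    by (auto simp: ring_prime_def Divisibility.prime_def)
  obtain i where i: "i \<in> I" "V i x \<noteq> 0" using nu Units_iff assms by blast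
  have "\<pi> i divides x"
    using i V_pi by (intro V_le_imp_divides pi_closed assms) (auto simp: Suc_le_eq)
  then obtain y where y: "y \<in> carrier R" "x = \<pi> i \<otimes> y" by (auto simp: factor_def)
  hence y0: "y \<in> carrier R - {\<zero>}" using assms pi_closed[OF i(1)] by auto
  have "\<not> x divides y"
    using i(1) V_mult[OF i(1) pi_closed[OF i(1)] y0] V_pi[OF i(1) i(1)] divides_iff[OF assms y0]
    unfolding y(2)[symmetric] by fastforce
  moreover have "x divides x" using assms by (auto simp: factor_def intro!: bexI[of _ \<one>])
  hence "x divides \<pi> i \<otimes> y" by (simp flip: y(2))
  hence "x divides \<pi> i \<or> x divides y"
    using p[of "\<pi> i" y] y(1) pi_closed[OF i(1)] by blast
  ultimately have "\<forall>j\<in>I. V j x \<le> of_bool (j = i)"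
    using divides_iff[OF assms pi_closed[OF i(1)]] V_pi[OF i(1)] by auto
  hence "V j x = of_bool (j = i)" if "j \<in> I" for j
    using that i(2) by (cases "j = i") (auto simp: le_Suc_eq)
  with i(1) show "\<exists>i\<in>I. \<forall>j\<in>I. V j x = of_bool (j = i)" by blast
next
  assume "\<exists>i\<in>I. \<forall>j\<in>I. V j x = of_bool (j = i)"
  then obtain i where i: "i \<in> I" "\<And>j. j \<in> I \<Longrightarrow> V j x = of_bool (j = i)" by blast
  have dvd: "x divides a" if "a \<in> carrier R" "a = \<zero> \<or> V i a \<noteq> 0" for a
    using that i assms divides_zero[of x] by (cases "a = \<zero>") (auto simp: divides_iff)
  show "ring_prime x"
    unfolding ring_prime_def Divisibility.prime_def
  proof (intro conjI ballI impI)
    show "x \<noteq> \<zero>" using assms by simp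
    show "x \<notin> Units R" using i assms by (auto simp: Units_iff)
    fix a b assume ab: "a \<in> carrier R" "b \<in> carrier R" "x divides a \<otimes> b"
    show "x divides a \<or> x divides b"
    proof (cases "a = \<zero> \<or> b = \<zero>")
      case False
      hence "a \<otimes> b \<in> carrier R - {\<zero>}" using ab integral by auto
      hence "V i x \<le> V i (a \<otimes> b)" using ab(3) i(1) divides_iff[OF assms] by blast
      hence "V i (a \<otimes> b) \<noteq> 0" using i by simp
      hence "V i a \<noteq> 0 \<or> V i b \<noteq> 0" using V_mult[OF i(1), of a b] ab False by auto
      thus ?thesis using dvd ab by blast
    qed (use dvd ab in blast)
  qed
qed

text \<open>The criterion used is that irreducibles are prime and chains of proper divisors stop. An
  irreducible is divisible by some uniformizer, hence associated to it.\<close>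

lemma factorial_domain: "factorial_domain R"
proof -
  have "primeness_condition_monoid (mult_of R)"
  proof unfold_locales
    fix a assume a: "a \<in> carrier (mult_of R)" "Divisibility.irreducible (mult_of R) a"
    hence a': "a \<in> carrier R - {\<zero>}" by simp
    have nu: "a \<notin> Units (mult_of R)" using a(2) by (simp add: Divisibility.irreducible_def)
    then obtain i where i: "i \<in> I" "V i a \<noteq> 0" using a' Units_iff[OF a'] by auto
    have pi: "\<pi> i \<in> carrier R - {\<zero>}" "\<pi> i \<notin> Units R"
      using i pi_closed V_pi Units_iff by fastforce+
    have "\<pi> i divides a"
      using i V_pi by (intro V_le_imp_divides pi_closed a') (auto simp: Suc_le_eq)
    hence "\<pi> i divides\<^bsub>mult_of R\<^esub> a" using pi a' by simp
    hence "a divides\<^bsub>mult_of R\<^esub> \<pi> i"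
      using a(2) pi by (auto simp: Divisibility.irreducible_def properfactor_def)
    hence "a divides \<pi> i" by simp
    hence "\<forall>j\<in>I. V j a \<le> of_bool (j = i)"
      using divides_iff[OF a' pi(1)] V_pi[OF i(1)] by auto
    hence "V j a = of_bool (j = i)" if "j \<in> I" for j
      using that i(2) by (cases "j = i") (auto simp: le_Suc_eq)
    hence "ring_prime a" using ring_prime_iff[OF a'] i(1) by blast
    thus "Divisibility.prime (mult_of R) a" using a' prime_eq_prime_mult[of a] by (simp add: ring_prime_def)
  qed
  moreover have "divisor_chain_condition_monoid (mult_of R)"
  proof unfold_locales
    \<comment> \<open>The total value, a finite sum by \<open>finite_V\<close>, drops strictly from
      an element to a proper divisor.\<close>
    define n where "n x = (\<Sum>i | i \<in> I \<and> V i x \<noteq> 0. V i x)" for x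
    have "n x < n y" if x: "x \<in> carrier R - {\<zero>}" and y: "y \<in> carrier R - {\<zero>}"
      and xy: "properfactor (mult_of R) x y" for x y
    proof -
      have "x divides y" "\<not> y divides x"
        using xy x y by (auto simp: properfactor_def)
      hence le: "\<And>i. i \<in> I \<Longrightarrow> V i x \<le> V i y" and "\<exists>i\<in>I. V i x < V i y"
        using divides_iff[OF x y] divides_iff[OF y x] by (auto simp: not_le)
      then obtain i where i: "i \<in> I" "V i x < V i y" by blast
      have "n x = (\<Sum>i | i \<in> I \<and> V i y \<noteq> 0. V i x)"
        unfolding n_def using le by (intro sum.mono_neutral_left finite_V[OF y]) force+
      also have "\<dots> < n y"
        unfolding n_def using le i by (intro sum_strict_mono_ex1 finite_V[OF y]) auto
      finally show ?thesis .
    qed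
    hence "{(x, y). x \<in> carrier (mult_of R) \<and> y \<in> carrier (mult_of R) \<and> properfactor (mult_of R) x y} \<subseteq> measure n"
      by auto
    thus "wf {(x, y). x \<in> carrier (mult_of R) \<and> y \<in> carrier (mult_of R) \<and> properfactor (mult_of R) x y}"
      by (rule wf_subset[OF wf_measure])
  qed
  ultimately have "factorial_monoid (mult_of R)" using factorial_condition_one by blast
  thus ?thesis by (intro factorial_domain.intro domain_axioms)
qed

end

section \<open>Dirichlet polynomials\<close>

text \<open>
  Polynomials over the integers in countably many variables \<open>t\<^sub>0, t\<^sub>1, \<dots>\<close>: the monomial
  \<open>\<Prod>t\<^sub>j ^ a j\<close> is represented by the positive number \<open>\<Prod>pr j ^ a j\<close>, so the sum of exponent
  vectors is the product of numbers, and the usual order of numbers is a monomial order.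
\<close>

typedef mon = "{n::nat. 0 < n}" morphisms rep_mon Mon by auto

setup_lifting type_definition_mon

text \<open>A linear order compatible with addition makes the polynomials an integral domain, so
  that their field of fractions exists; the same order picks the leading terms in
  \<open>gval_mult\<close>. The subtraction demanded by the class is integer division, kept positive
  by \<open>max 1\<close>.\<close>

instantiation mon :: "{linorder, ordered_cancel_comm_monoid_add}"
begin

lift_definition zero_mon :: mon is 1 by simp
lift_definition plus_mon :: "mon \<Rightarrow> mon \<Rightarrow> mon" is "(*)" by simp
lift_definition minus_mon :: "mon \<Rightarrow> mon \<Rightarrow> mon" is "\<lambda>a b. max 1 (a div b)" by simp
lift_definition less_eq_mon :: "mon \<Rightarrow> mon \<Rightarrow> bool" is "(\<le>)" .
lift_definition less_mon :: "mon \<Rightarrow> mon \<Rightarrow> bool" is "(<)" .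

instance
proof
  fix a b c :: mon
  show "a - b - c = a - (b + c)"
  proof transfer
    fix a b c :: nat assume "0 < a" "0 < b" "0 < c"
    thus "max 1 (max 1 (a div b) div c) = max 1 (a div (b * c))"
      using div_le_dividend[of "Suc 0" c, THEN le_antisym] by (cases "a div b = 0") (auto simp: div_mult2_eq max_def)
  qed
  show "(a + b) - a = b" by transfer (auto simp: max_def)
qed (transfer; auto simp: ac_simps)+

end

abbreviation lookup where "lookup \<equiv> Poly_Mapping.lookup"
abbreviation keys where "keys \<equiv> Poly_Mapping.keys"

type_synonym dpol = "mon \<Rightarrow>\<^sub>0 int"

section \<open>Products and weighted Gauss valuations\<close>

lemma lookup_mult_keys:
  fixes f g :: dpol
  shows "lookup (f * g) k = (\<Sum>l\<in>keys f. \<Sum>q\<in>keys g. if k = l + q then lookup f l * lookup g q else 0)"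
proof -
  have "(\<Sum>q. lookup g q when k = l + q) = (\<Sum>q\<in>keys g. if k = l + q then lookup g q else 0)" for l
    by (subst Sum_any.expand_superset[of "keys g"]) (auto simp: when_def in_keys_iff intro!: sum.cong)
  thus ?thesis
    unfolding lookup_mult
    by (subst Sum_any.expand_superset[of "keys f"])
       (auto simp: in_keys_iff sum_distrib_left intro!: sum.cong)
qed

text \<open>The Gauss extension of the \<open>p\<close>-adic valuation in which the monomial
  \<open>m\<close> gets value \<open>w m\<close>. At the zero polynomial this is a
  \<open>Min\<close> over the empty set and carries no information.\<close>

definition gval :: "int \<Rightarrow> (mon \<Rightarrow> nat) \<Rightarrow> dpol \<Rightarrow> nat" where
  "gval p w f = Min ((\<lambda>m. multiplicity p (lookup f m) + w m) ` keys f)"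

lemma gval_le: "m \<in> keys f \<Longrightarrow> gval p w f \<le> multiplicity p (lookup f m) + w m"
  by (simp add: gval_def)

lemma gval_attained:
  assumes "f \<noteq> 0" obtains m where "m \<in> keys f" "multiplicity p (lookup f m) + w m = gval p w f"
proof -
  have "gval p w f \<in> (\<lambda>m. multiplicity p (lookup f m) + w m) ` keys f"
    unfolding gval_def using assms by (intro Min_in) auto
  thus ?thesis using that by force
qed

lemma gval_ge_iff:
  assumes "f \<noteq> 0"
  shows "n \<le> gval p w f \<longleftrightarrow> (\<forall>m\<in>keys f. n \<le> multiplicity p (lookup f m) + w m)"
  unfolding gval_def using assms by simp

text \<open>Together with \<open>gval_geI\<close> this restates lower bounds as divisibility of all
  coefficients, vanishing ones included, a form that is stable under sums. Truncated subtraction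
  covers monomials whose weight alone reaches \<open>n\<close>.\<close>

lemma gval_dvd:
  assumes "n \<le> gval p w f" shows "p ^ (n - w m) dvd lookup f m"
proof (cases "m \<in> keys f")
  case True
  hence "n - w m \<le> multiplicity p (lookup f m)" using assms gval_le[OF True, of p w] by linarith
  thus ?thesis by (rule multiplicity_dvd')
qed (simp add: in_keys_iff)

lemma gval_geI:
  assumes "f \<noteq> 0" "prime p" "\<And>m. p ^ (n - w m) dvd lookup f m"
  shows "n \<le> gval p w f"
proof -
  have "n - w m \<le> multiplicity p (lookup f m)" if "m \<in> keys f" for m
    using assms(3)[of m] that assms(2) power_dvd_iff_le_multiplicity[of "lookup f m" p "n - w m"]
    by (auto simp: in_keys_iff)
  thus ?thesis unfolding gval_ge_iff[OF assms(1)] by fastforce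
qed

lemma gval_add:
  assumes "f + g \<noteq> 0" "prime p" "n \<le> gval p w f" "n \<le> gval p w g"
  shows "n \<le> gval p w (f + g)"
  by (rule gval_geI[OF assms(1,2)]) (simp add: lookup_add dvd_add gval_dvd assms)

text \<open>Gauss's lemma. Among the terms of minimal value in each factor, those with the largest
  monomials \<open>a\<close> and \<open>b\<close> are taken. At \<open>a + b\<close> every other
  contribution has strictly larger value, so nothing can cancel the minimal one.\<close>

lemma gval_mult:
  assumes p: "prime p" and w: "\<And>a b. w (a + b) = w a + w b" and nz: "f \<noteq> 0" "g \<noteq> 0"
  shows "gval p w (f * g) = gval p w f + gval p w g"
proof -
  define F where "F = {m \<in> keys f. multiplicity p (lookup f m) + w m = gval p w f}"
  define G where "G = {m \<in> keys g. multiplicity p (lookup g m) + w m = gval p w g}"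
  have fin: "finite F" "finite G" by (auto simp: F_def G_def)
  have ne: "F \<noteq> {}" "G \<noteq> {}"
    by (rule gval_attained[OF nz(1), of p w], auto simp: F_def)
       (rule gval_attained[OF nz(2), of p w], auto simp: G_def)
  define a where "a = Max F"
  define b where "b = Max G"
  have ab: "a \<in> F" "b \<in> G" using fin ne by (auto simp: a_def b_def)
  define M where "M = multiplicity p (lookup f a * lookup g b)"
  have a0: "lookup f a \<noteq> 0" and b0: "lookup g b \<noteq> 0" using ab by (auto simp: F_def G_def in_keys_iff)
  have Mm: "M = multiplicity p (lookup f a) + multiplicity p (lookup g b)"
    unfolding M_def using p a0 b0 by (intro prime_elem_multiplicity_mult_distrib) auto
  have M: "M + w (a + b) = gval p w f + gval p w g"
    using ab by (auto simp: Mm w F_def G_def)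
  define S where "S = (keys f \<times> keys g) - {(a, b)}"
  have other: "p ^ Suc M dvd (if a + b = l + q then lookup f l * lookup g q else 0)" if "(l, q) \<in> S" for l q
  proof (cases "a + b = l + q")
    case True
    have keys: "l \<in> keys f" "q \<in> keys g" "\<not> (l = a \<and> q = b)" using that by (auto simp: S_def)
    \<comment> \<open>From \<open>a + b = l + q\<close> and \<open>(l, q) \<noteq> (a, b)\<close>
      either \<open>l\<close> exceeds \<open>a\<close> or \<open>q\<close> exceeds \<open>b\<close>.
      That term lies beyond the largest one of minimal value, so its own value is not
      minimal.\<close>
    have "multiplicity p (lookup f l) + w l + (multiplicity p (lookup g q) + w q) > gval p w f + gval p w g"
    proof (cases "a < l")
      case True
      hence "l \<notin> F" using Max_ge[OF fin(1), of l] by (auto simp: a_def)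
      hence "multiplicity p (lookup f l) + w l > gval p w f" using keys gval_le[of l f p w] by (auto simp: F_def)
      thus ?thesis using gval_le[OF keys(2), of p w] by linarith
    next
      case False
      have "b < q"
      proof (rule ccontr)
        assume "\<not> b < q"
        hence "q \<le> b" "l \<le> a" using False by auto
        hence "l + q \<le> a + q" "a + q \<le> a + b" by (auto intro: add_mono)
        hence "l + q = a + q" "a + q = a + b" using True by auto
        hence "l = a" "q = b" by auto
        thus False using keys by blast
      qed
      hence "q \<notin> G" using Max_ge[OF fin(2), of q] by (auto simp: b_def)
      hence "multiplicity p (lookup g q) + w q > gval p w g" using keys gval_le[of q g p w] by (auto simp: G_def)
      thus ?thesis using gval_le[OF keys(1), of p w] by linarith
    qed
    moreover have "w l + w q = w (a + b)" by (simp add: True w)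
    ultimately have "Suc M \<le> multiplicity p (lookup f l) + multiplicity p (lookup g q)"
      using M by linarith
    also have "\<dots> = multiplicity p (lookup f l * lookup g q)"
      using p keys by (intro prime_elem_multiplicity_mult_distrib[symmetric]) (auto simp: in_keys_iff)
    finally have "p ^ Suc M dvd lookup f l * lookup g q" by (rule multiplicity_dvd')
    thus ?thesis using True by simp
  qed simp
  define r where "r = (\<Sum>(l, q)\<in>S. if a + b = l + q then lookup f l * lookup g q else 0)"
  have "lookup (f * g) (a + b) = (\<Sum>(l, q)\<in>keys f \<times> keys g. if a + b = l + q then lookup f l * lookup g q else 0)"
    by (simp add: lookup_mult_keys sum.cartesian_product)
  also have "\<dots> = lookup f a * lookup g b + r"
    unfolding r_def S_def using ab by (subst sum.remove[of _ "(a, b)"]) (auto simp: F_def G_def)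
  finally have c: "lookup (f * g) (a + b) = lookup f a * lookup g b + r" .
  have r: "p ^ Suc M dvd r" unfolding r_def using other by (intro dvd_sum) (simp only: split_paired_all prod.case)
  have nd: "\<not> p ^ Suc M dvd lookup f a * lookup g b"
    using p a0 b0 power_dvd_iff_le_multiplicity[of "lookup f a * lookup g b" p "Suc M"]
    unfolding M_def by (auto simp del: power_Suc)
  hence nd': "\<not> p ^ Suc M dvd lookup (f * g) (a + b)"
    unfolding c using r by (simp add: dvd_add_left_iff del: power_Suc)
  hence key: "a + b \<in> keys (f * g)" by (auto simp: in_keys_iff)
  have "multiplicity p (lookup (f * g) (a + b)) \<le> M"
    using nd' multiplicity_dvd'[of "Suc M" p] by (meson not_less_eq_eq)
  hence "gval p w (f * g) \<le> gval p w f + gval p w g"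
    using gval_le[OF key, of p w] M by linarith
  moreover have "gval p w f + gval p w g \<le> gval p w (f * g)"
  proof (rule gval_geI[OF _ p])
    fix m
    have "p ^ (gval p w f + gval p w g - w m) dvd (if m = l + q then lookup f l * lookup g q else 0)" for l q
    proof (cases "m = l + q")
      case True
      have "p ^ (gval p w f - w l) * p ^ (gval p w g - w q) dvd lookup f l * lookup g q"
        by (intro mult_dvd_mono gval_dvd order.refl)
      moreover have "gval p w f + gval p w g - w m \<le> (gval p w f - w l) + (gval p w g - w q)"
        by (simp add: True w)
      ultimately show ?thesis using True by (simp flip: power_add) (meson dvd_trans le_imp_power_dvd)
    qed simp
    thus "p ^ (gval p w f + gval p w g - w m) dvd lookup (f * g) m"
      unfolding lookup_mult_keys by (intro dvd_sum) auto
  qed (use nz in simp)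
  ultimately show ?thesis by simp
qed

section \<open>Valuations of the field of fractions\<close>

definition fval :: "int \<Rightarrow> (mon \<Rightarrow> nat) \<Rightarrow> dpol fract \<Rightarrow> int" where
  "fval p w x = (SOME n. \<exists>g h. x = Fract g h \<and> g \<noteq> 0 \<and> h \<noteq> 0 \<and> n = int (gval p w g) - int (gval p w h))"

locale gauss_valuation =
  fixes p :: int and w :: "mon \<Rightarrow> nat"
  assumes prime_p: "prime p" and w_add: "w (a + b) = w a + w b"
begin

text \<open>Equal fractions have equal cross products, so multiplicativity makes the difference of
  values independent of the representation.\<close>

lemma fval_Fract:
  assumes "g \<noteq> 0" "h \<noteq> 0" shows "fval p w (Fract g h) = int (gval p w g) - int (gval p w h)"
  unfolding fval_def
proof (rule someI2)
  show "\<exists>g' h'. Fract g h = Fract g' h' \<and> g' \<noteq> 0 \<and> h' \<noteq> 0 \<and>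
      int (gval p w g) - int (gval p w h) = int (gval p w g') - int (gval p w h')"
    using assms by blast
next
  fix n assume "\<exists>g' h'. Fract g h = Fract g' h' \<and> g' \<noteq> 0 \<and> h' \<noteq> 0 \<and> n = int (gval p w g') - int (gval p w h')"
  then obtain g' h' where *: "Fract g h = Fract g' h'" "g' \<noteq> 0" "h' \<noteq> 0"
      "n = int (gval p w g') - int (gval p w h')" by blast
  hence "g * h' = g' * h" using assms by (simp add: eq_fract)
  hence "gval p w (g * h') = gval p w (g' * h)" by simp
  hence "gval p w g + gval p w h' = gval p w g' + gval p w h"
    using gval_mult[OF prime_p w_add] assms * by simp
  thus "n = int (gval p w g) - int (gval p w h)" using * by linarith
qed

lemma fval_mult:
  assumes "x \<noteq> 0" "y \<noteq> 0" shows "fval p w (x * y) = fval p w x + fval p w y"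
proof (cases x, cases y)
  fix a b c d assume x: "x = Fract a b" "b \<noteq> 0" and y: "y = Fract c d" "d \<noteq> 0"
  have "a \<noteq> 0" "c \<noteq> 0" using assms x y by (auto simp: fract_collapse)
  thus ?thesis using x y by (simp add: fval_Fract gval_mult[OF prime_p w_add])
qed

lemma fval_nonneg_add:
  assumes "x \<noteq> 0" "y \<noteq> 0" "x + y \<noteq> 0" "0 \<le> fval p w x" "0 \<le> fval p w y"
  shows "0 \<le> fval p w (x + y)"
proof (cases x, cases y)
  fix a b c d assume x: "x = Fract a b" "b \<noteq> 0" and y: "y = Fract c d" "d \<noteq> 0"
  have nz: "a \<noteq> 0" "c \<noteq> 0" using assms x y by (auto simp: fract_collapse)
  have xy: "x + y = Fract (a * d + c * b) (b * d)" using x y by simp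
  hence s: "a * d + c * b \<noteq> 0" using assms(3) by (auto simp: fract_collapse)
  have "gval p w b \<le> gval p w a" "gval p w d \<le> gval p w c"
    using assms x y nz by (simp_all add: fval_Fract)
  hence "gval p w (b * d) \<le> gval p w (a * d + c * b)"
    using nz x y s by (intro gval_add prime_p) (simp_all add: gval_mult[OF prime_p w_add])
  thus ?thesis unfolding xy using x y s by (simp add: fval_Fract)
qed

lemma fval_one: "fval p w 1 = 0"
  using fval_mult[of 1 1] by simp

text \<open>The square of \<open>-1\<close> is 1 and has value 0; as values are integers,
  \<open>-1\<close> has value 0 too.\<close>

lemma fval_uminus: "x \<noteq> 0 \<Longrightarrow> fval p w (- x) = fval p w x"
  using fval_mult[of "-1" x] fval_mult[of "-1" "-1"] by (simp add: fval_one)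

lemma fval_divide: "x \<noteq> 0 \<Longrightarrow> y \<noteq> 0 \<Longrightarrow> fval p w (x / y) = fval p w x - fval p w y"
  using fval_mult[of "x / y" y] by simp

end

section \<open>The ring\<close>

text \<open>
  For every \<open>i\<close> there is the Gauss valuation \<open>Inl i\<close> over \<open>pr i\<close>, and for every final \<open>j\<close> a second
  valuation \<open>Inr j\<close> over \<open>pr (pfst j)\<close> with weight one at the variable \<open>t\<^sub>j\<close>.  If \<open>j\<close> is final,
  then \<open>pr (pfst j)\<close> is the product of \<open>t\<^sub>j\<close> and \<open>pr (pfst j) / t\<^sub>j\<close>, which are nonunits.
\<close>

definition vidx :: "(nat + nat) set" where
  "vidx = range Inl \<union> Inr ` {j. final j}"

fun base :: "nat + nat \<Rightarrow> nat" where
  "base (Inl i) = i"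
| "base (Inr j) = pfst j"

fun weight :: "nat + nat \<Rightarrow> mon \<Rightarrow> nat" where
  "weight (Inl i) m = 0"
| "weight (Inr j) m = multiplicity (pr j) (rep_mon m)"

definition pval :: "nat + nat \<Rightarrow> dpol \<Rightarrow> nat" where
  "pval v = gval (int (pr (base v))) (weight v)"

definition kval :: "nat + nat \<Rightarrow> dpol fract \<Rightarrow> int" where
  "kval v = fval (int (pr (base v))) (weight v)"

text \<open>Zero is added by hand because \<open>kval v 0\<close> is an unspecified number.\<close>

definition val_ring :: "dpol fract set" where
  "val_ring = {x. x = 0 \<or> (\<forall>v\<in>vidx. 0 \<le> kval v x)}"

lemma rep_mon_pos [simp]: "0 < rep_mon m"
  using rep_mon[of m] by simp

lemma rep_mon_neq_0 [simp]: "rep_mon m \<noteq> 0"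
  using rep_mon_pos[of m] by (simp del: rep_mon_pos)

lemma weight_add: "weight v (a + b) = weight v a + weight v b"
proof (cases v)
  case (Inr j)
  have "prime_elem (pr j)" using prime_pr by blast
  thus ?thesis using Inr by (simp add: plus_mon.rep_eq prime_elem_multiplicity_mult_distrib)
qed simp

lemma gauss_valuation: "gauss_valuation (int (pr (base v))) (weight v)"
  by unfold_locales (simp_all add: prime_pr weight_add)

lemmas kval_Fract = gauss_valuation.fval_Fract[OF gauss_valuation, folded kval_def pval_def]
lemmas kval_mult = gauss_valuation.fval_mult[OF gauss_valuation, folded kval_def]
lemmas kval_nonneg_add = gauss_valuation.fval_nonneg_add[OF gauss_valuation, folded kval_def]
lemmas kval_one = gauss_valuation.fval_one[OF gauss_valuation, folded kval_def]
lemmas kval_uminus = gauss_valuation.fval_uminus[OF gauss_valuation, folded kval_def]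
lemmas kval_divide = gauss_valuation.fval_divide[OF gauss_valuation, folded kval_def]

lemma val_ring_0: "0 \<in> val_ring" and val_ring_1: "1 \<in> val_ring"
  by (simp_all add: val_ring_def kval_one)

lemma val_ring_add: "x \<in> val_ring \<Longrightarrow> y \<in> val_ring \<Longrightarrow> x + y \<in> val_ring"
  unfolding val_ring_def using kval_nonneg_add[of x y]
  by (cases "x = 0 \<or> y = 0 \<or> x + y = 0") auto

lemma val_ring_mult: "x \<in> val_ring \<Longrightarrow> y \<in> val_ring \<Longrightarrow> x * y \<in> val_ring"
  unfolding val_ring_def using kval_mult[of x y] by (cases "x = 0 \<or> y = 0") auto

lemma val_ring_uminus: "x \<in> val_ring \<Longrightarrow> - x \<in> val_ring"
  unfolding val_ring_def using kval_uminus[of x] by (cases "x = 0") auto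

section \<open>Values of integers and variables, uniformizers\<close>

lemma multiplicity_int_abs: "multiplicity (int p) x = multiplicity p (nat \<bar>x\<bar>)"
proof -
  have "int p ^ n dvd x \<longleftrightarrow> p ^ n dvd nat \<bar>x\<bar>" for n
    by (metis dvd_abs_iff int_dvd_int_iff nat_abs_int_diff int_nat_eq abs_ge_zero of_nat_power)
  thus ?thesis unfolding multiplicity_def by simp
qed

lemma pval_single: "c \<noteq> 0 \<Longrightarrow> pval v (Poly_Mapping.single m c) = multiplicity (pr (base v)) (nat \<bar>c\<bar>) + weight v m"
  by (simp add: pval_def gval_def multiplicity_int_abs)

definition tvar :: "nat \<Rightarrow> dpol fract" where
  "tvar j = Fract (Poly_Mapping.single (Mon (pr j)) 1) 1"

lemma weight_0 [simp]: "weight v 0 = 0"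
  using weight_add[of v 0 0] by simp

lemma multiplicity_pr: "multiplicity (pr i) (pr j) = of_bool (i = j)"
proof (cases "i = j")
  case True
  thus ?thesis using prime_pr[of j] by (auto simp: multiplicity_self)
next
  case False
  thus ?thesis using prime_multiplicity_other[OF prime_pr prime_pr, of i j] by simp
qed

lemma Fract_eq_0_iff: "b \<noteq> 0 \<Longrightarrow> Fract a b = 0 \<longleftrightarrow> a = 0"
  by (simp add: Zero_fract_def eq_fract)

lemma pval_one: "pval v 1 = 0"
  using pval_single[of 1 v 0] by simp

lemma kval_of_nat: "n \<noteq> 0 \<Longrightarrow> kval v (of_nat n) = int (multiplicity (pr (base v)) n)"
proof -
  assume n: "n \<noteq> 0"
  have "pval v (of_nat n) = multiplicity (pr (base v)) n"
    using n pval_single[of "int n" v 0] by simp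
  thus ?thesis
    using n kval_Fract[of "of_nat n" 1 v] by (simp add: pval_one Fract_of_nat_eq)
qed

lemma of_nat_fract_nz: "n \<noteq> 0 \<Longrightarrow> (of_nat n :: dpol fract) \<noteq> 0"
  by (simp add: of_nat_fract Fract_eq_0_iff)

lemma tvar_nz: "tvar j \<noteq> 0"
  by (simp add: tvar_def Fract_eq_0_iff)

lemma kval_tvar: "kval v (tvar j) = of_bool (v = Inr j)"
proof -
  have "rep_mon (Mon (pr j)) = pr j" using prime_pr[of j] by (intro Mon_inverse) (auto simp: prime_gt_0_nat)
  hence "weight v (Mon (pr j)) = of_bool (v = Inr j)"
    by (cases v) (auto simp: multiplicity_pr)
  hence "pval v (Poly_Mapping.single (Mon (pr j)) 1) = of_bool (v = Inr j)"
    by (simp add: pval_single)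
  thus ?thesis
    unfolding tvar_def by (simp add: kval_Fract pval_one)
qed

text \<open>For a final \<open>j\<close> over \<open>i\<close>, the number \<open>pr i\<close> has
  value 1 at both \<open>Inl i\<close> and \<open>Inr j\<close>, whereas \<open>tvar j\<close> has
  value 1 at \<open>Inr j\<close> only; the quotient is therefore left with value 1 at
  \<open>Inl i\<close> alone.\<close>

definition uniformizer :: "nat + nat \<Rightarrow> dpol fract" where
  "uniformizer u = (case u of Inr j \<Rightarrow> tvar j
     | Inl i \<Rightarrow> if \<exists>j. final j \<and> pfst j = i then of_nat (pr i) / tvar (THE j. final j \<and> pfst j = i)
                else of_nat (pr i))"

lemma pr_nz: "(of_nat (pr i) :: dpol fract) \<noteq> 0"
  using prime_pr[of i] by (intro of_nat_fract_nz) auto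

lemma uniformizer_nz: "uniformizer u \<noteq> 0"
  by (auto simp: uniformizer_def pr_nz tvar_nz split: sum.splits)

lemma kval_uniformizer:
  assumes "v \<in> vidx" "u \<in> vidx" shows "kval v (uniformizer u) = of_bool (v = u)"
proof (cases u)
  case (Inr j)
  thus ?thesis by (simp add: uniformizer_def kval_tvar)
next
  case (Inl i)
  have pr0: "pr i \<noteq> 0" using prime_pr[of i] by auto
  show ?thesis
  proof (cases "\<exists>j. final j \<and> pfst j = i")
    case True
    then obtain j where j: "final j" "pfst j = i" by blast
    hence "(THE j. final j \<and> pfst j = i) = j" using final_unique by blast
    hence "kval v (uniformizer u) = of_bool (base v = i) - of_bool (v = Inr j)"
      using True Inl by (simp add: uniformizer_def kval_divide pr_nz tvar_nz kval_of_nat pr0 kval_tvar multiplicity_pr)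
    \<comment> \<open>By uniqueness of the final stage, \<open>Inl i\<close> and
      \<open>Inr j\<close> are the only valuations in \<open>vidx\<close> over
      \<open>pr i\<close>.\<close>
    thus ?thesis using Inl assms(1) j final_unique by (cases v) (auto simp: vidx_def)
  next
    case False
    thus ?thesis using Inl assms(1)
      by (cases v) (auto simp: uniformizer_def kval_of_nat pr0 multiplicity_pr vidx_def)
  qed
qed

lemma pr_le_of_multiplicity:
  assumes "multiplicity (pr n) a \<noteq> 0" shows "n < a"
proof -
  have "a \<noteq> 0" using assms by (cases "a = 0") auto
  moreover have "pr n dvd a" using assms by (metis not_dvd_imp_multiplicity_0)
  ultimately show ?thesis using pr_gt[of n] dvd_imp_le[of "pr n" a] by linarith
qed

text \<open>A single term \<open>m\<close> of \<open>f\<close> bounds all values from above. A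
  nonzero value at \<open>v\<close> forces \<open>pr (base v)\<close> to divide the coefficient or,
  for \<open>Inr j\<close>, the variable \<open>j\<close> to occur in \<open>m\<close>. Each prime
  has at most one final stage, so finitely many \<open>v\<close> remain.\<close>

lemma finite_pval:
  assumes "f \<noteq> 0" shows "finite {v \<in> vidx. pval v f \<noteq> 0}"
proof -
  obtain m where m: "m \<in> keys f" using assms by (metis ex_in_conv keys_eq_empty)
  define N where "N = nat \<bar>lookup f m\<bar>"
  have N: "N > 0" using m by (simp add: N_def in_keys_iff)
  have "finite {j. final j \<and> pfst j \<le> N}"
  proof (rule finite_imageD[of pfst])
    show "finite (pfst ` {j. final j \<and> pfst j \<le> N})" by (rule finite_subset[of _ "{..N}"]) auto
    show "inj_on pfst {j. final j \<and> pfst j \<le> N}" using final_unique by (auto simp: inj_on_def)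
  qed
  hence "finite (Inl ` {..N} \<union> Inr ` {j. final j \<and> pfst j \<le> N} \<union> Inr ` {..rep_mon m})" by simp
  moreover have "{v \<in> vidx. pval v f \<noteq> 0} \<subseteq> Inl ` {..N} \<union> Inr ` {j. final j \<and> pfst j \<le> N} \<union> Inr ` {..rep_mon m}"
  proof (rule subsetI, rule ccontr)
    fix v assume "v \<in> {v \<in> vidx. pval v f \<noteq> 0}"
      "v \<notin> Inl ` {..N} \<union> Inr ` {j. final j \<and> pfst j \<le> N} \<union> Inr ` {..rep_mon m}"
    hence v: "v \<in> vidx" "pval v f \<noteq> 0" "v \<notin> Inr ` {..rep_mon m}"
      "v \<notin> Inr ` {j. final j \<and> pfst j \<le> N}" "v \<notin> Inl ` {..N}" by auto
    have "pval v f \<le> multiplicity (pr (base v)) N + weight v m"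
      unfolding pval_def N_def using gval_le[OF m] by (metis multiplicity_int_abs)
    moreover have "weight v m = 0"
    proof (cases v)
      case (Inr j)
      thus ?thesis using v(3) pr_le_of_multiplicity[of j "rep_mon m"] by force
    qed simp
    ultimately have "base v \<le> N" using v(2) pr_le_of_multiplicity[of "base v" N] by linarith
    thus False using v by (cases v) (auto simp: vidx_def)
  qed
  ultimately show ?thesis by (rule finite_subset[rotated])
qed

lemma finite_kval:
  assumes "x \<noteq> 0" shows "finite {v \<in> vidx. kval v x \<noteq> 0}"
proof (cases x)
  case (Fract g h)
  hence "g \<noteq> 0" using assms by (auto simp: fract_collapse)
  hence "{v \<in> vidx. kval v x \<noteq> 0} \<subseteq> {v \<in> vidx. pval v g \<noteq> 0} \<union> {v \<in> vidx. pval v h \<noteq> 0}"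
    using Fract by (auto simp: kval_Fract)
  thus ?thesis using finite_pval \<open>g \<noteq> 0\<close> Fract by (meson finite_UnI finite_subset)
qed

section \<open>Transporting a countable subring of a field to the natural numbers\<close>

definition idx :: "(nat \<Rightarrow> 'f) \<Rightarrow> 'f \<Rightarrow> nat" where
  "idx \<nu> x = (LEAST n. \<nu> n = x)"

text \<open>Each element is represented by its least code. Decidability of equality then decides the
  carrier, and decidability of the graphs turns the operations into searches.\<close>

definition numbered_ring :: "(nat \<Rightarrow> 'f::field) \<Rightarrow> nat ring" where
  "numbered_ring \<nu> = \<lparr>carrier = {n. idx \<nu> (\<nu> n) = n}, mult = \<lambda>a b. idx \<nu> (\<nu> a * \<nu> b), one = idx \<nu> 1,
     zero = idx \<nu> 0, add = \<lambda>a b. idx \<nu> (\<nu> a + \<nu> b)\<rparr>"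

locale numbered_subring =
  fixes \<nu> :: "nat \<Rightarrow> 'f::field"
  assumes zero_in: "0 \<in> range \<nu>" and one_in: "1 \<in> range \<nu>"
    and add_in: "x \<in> range \<nu> \<Longrightarrow> y \<in> range \<nu> \<Longrightarrow> x + y \<in> range \<nu>"
    and mult_in: "x \<in> range \<nu> \<Longrightarrow> y \<in> range \<nu> \<Longrightarrow> x * y \<in> range \<nu>"
    and uminus_in: "x \<in> range \<nu> \<Longrightarrow> - x \<in> range \<nu>"
begin

abbreviation "R \<equiv> numbered_ring \<nu>"

lemma nu_idx: "x \<in> range \<nu> \<Longrightarrow> \<nu> (idx \<nu> x) = x"
  unfolding idx_def by (metis (mono_tags, lifting) LeastI imageE)

lemma idx_in: "x \<in> range \<nu> \<Longrightarrow> idx \<nu> x \<in> carrier R"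
  by (simp add: numbered_ring_def nu_idx)

lemma nu_ring [simp]:
  "\<nu> (a \<otimes>\<^bsub>R\<^esub> b) = \<nu> a * \<nu> b" "\<nu> (a \<oplus>\<^bsub>R\<^esub> b) = \<nu> a + \<nu> b" "\<nu> \<one>\<^bsub>R\<^esub> = 1" "\<nu> \<zero>\<^bsub>R\<^esub> = 0"
  by (simp_all add: numbered_ring_def nu_idx zero_in one_in add_in mult_in)

lemma ring_closed [simp]:
  "a \<otimes>\<^bsub>R\<^esub> b \<in> carrier R" "a \<oplus>\<^bsub>R\<^esub> b \<in> carrier R" "\<one>\<^bsub>R\<^esub> \<in> carrier R" "\<zero>\<^bsub>R\<^esub> \<in> carrier R"
  by (simp_all add: numbered_ring_def nu_idx zero_in one_in add_in mult_in)

lemma nu_inj: "a \<in> carrier R \<Longrightarrow> b \<in> carrier R \<Longrightarrow> \<nu> a = \<nu> b \<Longrightarrow> a = b"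
  by (simp add: numbered_ring_def)

lemma nu_eq_0: "a \<in> carrier R \<Longrightarrow> \<nu> a = 0 \<longleftrightarrow> a = \<zero>\<^bsub>R\<^esub>"
  using nu_inj[of a "\<zero>\<^bsub>R\<^esub>"] by auto

lemma domain: "domain R"
proof -
  have "cring R"
  proof (rule cringI)
    show "abelian_group R"
    proof (rule abelian_groupI)
      fix x assume x: "x \<in> carrier R"
      have "idx \<nu> (- \<nu> x) \<oplus>\<^bsub>R\<^esub> x = \<zero>\<^bsub>R\<^esub>"
        by (rule nu_inj) (simp_all add: nu_idx uminus_in)
      thus "\<exists>y\<in>carrier R. y \<oplus>\<^bsub>R\<^esub> x = \<zero>\<^bsub>R\<^esub>"
        using idx_in[OF uminus_in, of "\<nu> x"] by blast
    qed (auto intro!: nu_inj simp: ac_simps)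
    show "Group.comm_monoid R"
      by (rule comm_monoidI) (auto intro!: nu_inj simp: ac_simps)
  qed (auto intro!: nu_inj simp: algebra_simps)
  thus ?thesis
  proof (rule domain.intro)
    show "domain_axioms R"
    proof
      show "\<one>\<^bsub>R\<^esub> \<noteq> \<zero>\<^bsub>R\<^esub>" using nu_ring(3,4) zero_neq_one by metis
      fix a b assume "a \<otimes>\<^bsub>R\<^esub> b = \<zero>\<^bsub>R\<^esub>" "a \<in> carrier R" "b \<in> carrier R"
      thus "a = \<zero>\<^bsub>R\<^esub> \<or> b = \<zero>\<^bsub>R\<^esub>"
        using nu_ring(1)[of a b] nu_eq_0 by (metis mult_eq_0_iff nu_ring(4))
    qed
  qed
qed

end

text \<open>As \<open>val_ring\<close> is cut out by the valuations, a quotient lies in it as soon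
  as its values are nonnegative; this gives divisibility from an inequality of values.\<close>

lemma valued_domain_numbered_ring:
  assumes "range \<nu> = val_ring"
  shows "valued_domain (numbered_ring \<nu>) vidx (\<lambda>v n. nat (kval v (\<nu> n))) (\<lambda>v. idx \<nu> (uniformizer v))"
proof -
  interpret numbered_subring \<nu>
    by unfold_locales (simp_all add: assms val_ring_0 val_ring_1 val_ring_add val_ring_mult val_ring_uminus)
  have nonneg: "0 \<le> kval v (\<nu> x)" "\<nu> x \<noteq> 0" if "x \<in> carrier R - {\<zero>\<^bsub>R\<^esub>}" "v \<in> vidx" for x v
  proof -
    show nz: "\<nu> x \<noteq> 0" using that nu_eq_0 by auto
    have "\<nu> x \<in> val_ring" using assms by blast
    thus "0 \<le> kval v (\<nu> x)" using nz that by (simp add: val_ring_def)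
  qed
  have nz: "\<nu> x \<noteq> 0" if "x \<in> carrier R - {\<zero>\<^bsub>R\<^esub>}" for x using that nu_eq_0 by auto
  have unif: "uniformizer v \<in> range \<nu>" if "v \<in> vidx" for v
    using that by (simp add: assms val_ring_def kval_uniformizer)
  show ?thesis
  proof (intro valued_domain.intro domain valued_domain_axioms.intro)
    fix v x y assume "v \<in> vidx" "x \<in> carrier R - {\<zero>\<^bsub>R\<^esub>}" "y \<in> carrier R - {\<zero>\<^bsub>R\<^esub>}"
    thus "nat (kval v (\<nu> (x \<otimes>\<^bsub>R\<^esub> y))) = nat (kval v (\<nu> x)) + nat (kval v (\<nu> y))"
      using nonneg by (simp add: kval_mult nat_add_distrib)
  next
    fix x y assume xy: "x \<in> carrier R - {\<zero>\<^bsub>R\<^esub>}" "y \<in> carrier R - {\<zero>\<^bsub>R\<^esub>}"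
      and le: "\<And>v. v \<in> vidx \<Longrightarrow> nat (kval v (\<nu> x)) \<le> nat (kval v (\<nu> y))"
    have "0 \<le> kval v (\<nu> y / \<nu> x)" if "v \<in> vidx" for v
      using le[OF that] nonneg[OF xy(1) that] nonneg[OF xy(2) that] by (simp add: kval_divide)
    hence "\<nu> y / \<nu> x \<in> range \<nu>" by (simp add: assms val_ring_def)
    hence "idx \<nu> (\<nu> y / \<nu> x) \<in> carrier R" "\<nu> (idx \<nu> (\<nu> y / \<nu> x)) = \<nu> y / \<nu> x"
      using idx_in nu_idx by blast+
    moreover from this have "y = x \<otimes>\<^bsub>R\<^esub> idx \<nu> (\<nu> y / \<nu> x)"
      by (intro nu_inj) (use xy nz[OF xy(1)] in simp_all)
    ultimately show "x divides\<^bsub>R\<^esub> y" by (auto simp: factor_def)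
  next
    fix x assume x: "x \<in> carrier R - {\<zero>\<^bsub>R\<^esub>}"
    have "{v \<in> vidx. nat (kval v (\<nu> x)) \<noteq> 0} \<subseteq> {v \<in> vidx. kval v (\<nu> x) \<noteq> 0}" by auto
    thus "finite {v \<in> vidx. nat (kval v (\<nu> x)) \<noteq> 0}"
      using finite_kval[OF nz[OF x]] finite_subset by blast
  next
    fix v assume "v \<in> vidx"
    thus "idx \<nu> (uniformizer v) \<in> carrier R - {\<zero>\<^bsub>R\<^esub>}"
      using unif uniformizer_nz nu_idx idx_in by (metis DiffI nu_ring(4) singletonD)
  next
    fix v u assume "v \<in> vidx" "u \<in> vidx"
    thus "nat (kval u (\<nu> (idx \<nu> (uniformizer v)))) = of_bool (u = v)"
      by (simp add: nu_idx unif kval_uniformizer)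
  qed
qed

text \<open>\<open>pr i\<close> has value 1 at every valuation over it and 0 at all others. So it is
  prime iff \<open>Inl i\<close> is the only valuation with base \<open>i\<close>, that is, iff no
  stage of \<open>i\<close> is final.\<close>

lemma ring_prime_pr_iff:
  assumes "range \<nu> = val_ring"
  shows "ring_prime\<^bsub>numbered_ring \<nu>\<^esub> (idx \<nu> (of_nat (pr i))) \<longleftrightarrow> (\<forall>x. \<exists>w. matrix i x w)"
proof -
  interpret valued_domain "numbered_ring \<nu>" vidx "\<lambda>v n. nat (kval v (\<nu> n))" "\<lambda>v. idx \<nu> (uniformizer v)"
    by (rule valued_domain_numbered_ring[OF assms])
  interpret numbered_subring \<nu>
    by unfold_locales (simp_all add: assms val_ring_0 val_ring_1 val_ring_add val_ring_mult val_ring_uminus)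
  have pr0: "pr i \<noteq> 0" using prime_pr[of i] by auto
  have kv: "kval v (of_nat (pr i)) = of_bool (base v = i)" for v
    by (simp add: kval_of_nat pr0 multiplicity_pr)
  have "of_nat (pr i) \<in> range \<nu>" by (simp add: assms val_ring_def kv)
  hence nu: "\<nu> (idx \<nu> (of_nat (pr i))) = of_nat (pr i)" and car: "idx \<nu> (of_nat (pr i)) \<in> carrier R"
    using idx_in nu_idx by blast+
  hence "idx \<nu> (of_nat (pr i)) \<in> carrier R - {\<zero>\<^bsub>R\<^esub>}" using pr_nz[of i] nu_ring(4) by force
  moreover have "nat (of_bool P) = of_bool Q \<longleftrightarrow> (P \<longleftrightarrow> Q)" for P Q by simp
  ultimately  have "ring_prime\<^bsub>R\<^esub> (idx \<nu> (of_nat (pr i))) \<longleftrightarrow> (\<exists>v\<in>vidx. \<forall>u\<in>vidx. base u = i \<longleftrightarrow> u = v)"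
    by (simp only: ring_prime_iff nu kv)
  also have "\<dots> \<longleftrightarrow> \<not> (\<exists>j. final j \<and> pfst j = i)"
  proof
    assume "\<exists>v\<in>vidx. \<forall>u\<in>vidx. base u = i \<longleftrightarrow> u = v"
    then obtain v where "\<And>u. u \<in> vidx \<Longrightarrow> base u = i \<Longrightarrow> u = v" by blast
    hence "u = u'" if "u \<in> vidx" "u' \<in> vidx" "base u = i" "base u' = i" for u u' using that by blast
    from this[of "Inl i" "Inr _"] show "\<not> (\<exists>j. final j \<and> pfst j = i)" by (auto simp: vidx_def)
  next
    assume no: "\<not> (\<exists>j. final j \<and> pfst j = i)"
    have "base u = i \<longleftrightarrow> u = Inl i" if "u \<in> vidx" for u
      using that no by (cases u) (auto simp: vidx_def)
    thus "\<exists>v\<in>vidx. \<forall>u\<in>vidx. base u = i \<longleftrightarrow> u = v"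
      by (intro bexI[of _ "Inl i"]) (auto simp: vidx_def)
  qed
  finally show ?thesis by (simp add: final_iff)
qed

section \<open>Coding the ring by natural numbers\<close>

text \<open>
  A function \<open>u :: nat \<Rightarrow> nat\<close> of finite support is coded by \<open>\<Prod>pr n ^ u n\<close>, and a Dirichlet
  polynomial by a pair of codes whose difference is its coefficient function.
\<close>

definition ccoef :: "nat \<Rightarrow> nat \<Rightarrow> int" where
  "ccoef z n = int (multiplicity (pr n) (pfst z)) - int (multiplicity (pr n) (psnd z))"

text \<open>Position 0 corresponds to no monomial and is ignored, which is why bounded quantifiers
  over coefficients carry the condition \<open>0 < m\<close>.\<close>

definition cpol :: "nat \<Rightarrow> dpol" where
  "cpol z = Poly_Mapping.Abs_poly_mapping (\<lambda>m. ccoef z (rep_mon m))"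

lemma ccoef_nz_le: "ccoef z n \<noteq> 0 \<Longrightarrow> n \<le> z"
  using pr_le_of_multiplicity[of n "pfst z"] pr_le_of_multiplicity[of n "psnd z"] pfst_le[of z] psnd_le[of z]
  by (cases "multiplicity (pr n) (pfst z) = 0") (auto simp: ccoef_def)

lemma abs_ccoef_le: "nat \<bar>ccoef z n\<bar> \<le> z"
  using multiplicity_le[OF prime_pr, of n "pfst z"] multiplicity_le[OF prime_pr, of n "psnd z"] pfst_le[of z] psnd_le[of z]
  by (auto simp: ccoef_def)

lemma lookup_cpol: "lookup (cpol z) m = ccoef z (rep_mon m)"
proof -
  have "{m. ccoef z (rep_mon m) \<noteq> 0} \<subseteq> Mon ` {..z}"
    using ccoef_nz_le by (force intro!: image_eqI[of _ Mon, OF rep_mon_inverse[symmetric]])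
  hence "finite {m. ccoef z (rep_mon m) \<noteq> 0}" by (rule finite_subset) simp
  thus ?thesis by (simp add: cpol_def)
qed

lemma keys_cpol: "m \<in> keys (cpol z) \<longleftrightarrow> ccoef z (rep_mon m) \<noteq> 0"
  by (simp add: in_keys_iff lookup_cpol)

lemma ex_multiplicities:
  assumes "finite S" shows "\<exists>a>0. \<forall>n. multiplicity (pr n) a = (if n \<in> S then u n else 0)"
  using assms
proof (induction S)
  case empty
  show ?case by (intro exI[of _ 1]) simp
next
  case (insert k S)
  then obtain a where a: "a > 0" "\<And>n. multiplicity (pr n) a = (if n \<in> S then u n else 0)" by blast
  have "multiplicity (pr n) (pr k ^ u k * a) = of_bool (n = k) * u k + multiplicity (pr n) a" for n
  proof -
    have "prime_elem (pr n)" using prime_pr by blast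
    thus ?thesis using a(1) prime_pr[of k]
      by (simp add: prime_elem_multiplicity_mult_distrib prime_elem_multiplicity_power_distrib multiplicity_pr)
  qed
  thus ?case using a insert.hyps prime_pr[of k]
    by (intro exI[of _ "pr k ^ u k * a"]) (auto simp: prime_gt_0_nat)
qed

lemma cpol_surj: "\<exists>z. cpol z = f"
proof -
  have fin: "finite (rep_mon ` keys f)" by simp
  obtain a where a: "\<And>n. multiplicity (pr n) a = (if n \<in> rep_mon ` keys f then nat (lookup f (Mon n)) else 0)"
    using ex_multiplicities[OF fin, of "\<lambda>n. nat (lookup f (Mon n))"] by blast
  obtain b where b: "\<And>n. multiplicity (pr n) b = (if n \<in> rep_mon ` keys f then nat (- lookup f (Mon n)) else 0)"
    using ex_multiplicities[OF fin, of "\<lambda>n. nat (- lookup f (Mon n))"] by blast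
  have "rep_mon m \<in> rep_mon ` keys f \<longleftrightarrow> m \<in> keys f" for m
    by (metis imageE imageI rep_mon_inverse)
  hence "lookup (cpol (prod_encode (a, b))) m = lookup f m" for m
    by (auto simp: lookup_cpol ccoef_def a b rep_mon_inverse in_keys_iff)
  thus ?thesis using poly_mapping_eqI by blast
qed

text \<open>The comparison of values without minima: every term of \<open>g\<close> is dominated by
  some term of \<open>h\<close>. In this form it becomes a bounded formula about codes, and it also
  holds for \<open>g = 0\<close>.\<close>

definition vle :: "nat + nat \<Rightarrow> dpol \<Rightarrow> dpol \<Rightarrow> bool" where
  "vle v h g \<longleftrightarrow> (\<forall>m\<in>keys g. \<exists>n\<in>keys h. multiplicity (pr (base v)) (nat \<bar>lookup h n\<bar>) + weight v n
     \<le> multiplicity (pr (base v)) (nat \<bar>lookup g m\<bar>) + weight v m)"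

lemma vle_iff:
  assumes "h \<noteq> 0" "g \<noteq> 0" shows "vle v h g \<longleftrightarrow> pval v h \<le> pval v g"
proof -
  have "pval v h \<le> k \<longleftrightarrow> (\<exists>n\<in>keys h. multiplicity (pr (base v)) (nat \<bar>lookup h n\<bar>) + weight v n \<le> k)" for k
    unfolding pval_def gval_def multiplicity_int_abs[symmetric] using assms by (subst Min_le_iff) auto
  thus ?thesis
    unfolding vle_def pval_def gval_ge_iff[OF assms(2)] multiplicity_int_abs[symmetric] by (simp add: pval_def)
qed

text \<open>A decidable approximation, monotone in \<open>s\<close>: some \<open>s\<close> satisfies
  it iff \<open>j\<close> is not final.\<close>

definition superseded :: "nat \<Rightarrow> nat \<Rightarrow> bool" where
  "superseded s j \<longleftrightarrow> \<not> active j \<or> (\<exists>j'\<le>s. j < j' \<and> pfst j' = pfst j \<and> active j')"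

text \<open>A code \<open>c\<close> consists of the coded fraction \<open>pfst c\<close>, numerator
  before denominator, and the stage bound \<open>psnd c\<close>.\<close>

definition cden :: "nat \<Rightarrow> dpol" where "cden c = cpol (psnd (pfst c))"
definition cnum :: "nat \<Rightarrow> dpol" where "cnum c = cpol (pfst (pfst c))"

text \<open>Only valuations with index up to the code of the fraction are tested;
  \<open>range_nu\<close> shows that the others impose nothing new. Stages that the bound reveals as
  not final are exempt, so validity is decidable without deciding finality.\<close>

definition valid :: "nat \<Rightarrow> bool" where
  "valid c \<longleftrightarrow> cden c \<noteq> 0 \<and> (\<forall>i\<le>pfst c. vle (Inl i) (cden c) (cnum c)) \<and>
     (\<forall>j\<le>pfst c. superseded (psnd c) j \<or> vle (Inr j) (cden c) (cnum c))"

definition nu :: "nat \<Rightarrow> dpol fract" where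
  "nu c = (if valid c then Fract (cnum c) (cden c) else 0)"

lemma multiplicity_pr_eq_0: "a \<le> n \<Longrightarrow> multiplicity (pr n) a = 0"
  using pr_le_of_multiplicity[of n a] by fastforce

lemma range_nu: "range nu = val_ring"
proof (intro equalityI subsetI)
  fix x assume "x \<in> range nu"
  then obtain c where x: "x = nu c" by blast
  show "x \<in> val_ring"
  proof (cases "valid c \<and> cnum c \<noteq> 0")
    case False
    thus ?thesis by (auto simp: x nu_def val_ring_def fract_collapse)
  next
    case True
    hence den: "cden c \<noteq> 0" by (simp add: valid_def)
    have bound: "pfst (pfst c) \<le> pfst c" "psnd (pfst c) \<le> pfst c" using pfst_le psnd_le by auto
    have Inl: "vle (Inl i) (cden c) (cnum c)" for i
    proof (cases "i \<le> pfst c")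
      case False
      \<comment> \<open>Coefficients of the denominator are at most its code, hence smaller than
        \<open>pr i\<close>; any term \<open>n\<close> of it has order 0 there.\<close>
      obtain n where n: "n \<in> keys (cden c)" using den by (metis ex_in_conv keys_eq_empty)
      have "nat \<bar>lookup (cden c) n\<bar> \<le> i"
        using abs_ccoef_le[of "psnd (pfst c)" "rep_mon n"] False bound by (simp add: cden_def lookup_cpol)
      hence "multiplicity (pr i) (nat \<bar>lookup (cden c) n\<bar>) = 0" by (rule multiplicity_pr_eq_0)
      thus ?thesis unfolding vle_def using n by (intro ballI bexI[of _ n]) auto
    qed (use True in \<open>simp add: valid_def\<close>)
    have Inr: "vle (Inr j) (cden c) (cnum c)" if "final j" for j
    proof (cases "j \<le> pfst c")
      case True
      moreover have "\<not> superseded (psnd c) j" using that by (auto simp: superseded_def final_def)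
      ultimately show ?thesis using \<open>valid c \<and> cnum c \<noteq> 0\<close> by (auto simp: valid_def)
    next
      case False
      \<comment> \<open>The variable \<open>j\<close> is too large to occur in the denominator, so
        the condition at \<open>Inr j\<close> follows from the one at
        \<open>Inl (pfst j)\<close>.\<close>
      have "weight (Inr j) n = 0" if "n \<in> keys (cden c)" for n
        using that ccoef_nz_le[of "psnd (pfst c)" "rep_mon n"] False bound
        by (auto simp: cden_def keys_cpol intro!: multiplicity_pr_eq_0)
      moreover have "multiplicity (pr (pfst j)) (nat \<bar>lookup (cden c) n\<bar>) \<le> multiplicity (pr (pfst j)) (nat \<bar>lookup (cnum c) m\<bar>)
          \<Longrightarrow> weight (Inr j) n = 0 \<Longrightarrow> multiplicity (pr (base (Inr j))) (nat \<bar>lookup (cden c) n\<bar>) + weight (Inr j) n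
            \<le> multiplicity (pr (base (Inr j))) (nat \<bar>lookup (cnum c) m\<bar>) + weight (Inr j) m" for m n
        by simp
      ultimately show ?thesis
        using Inl[of "pfst j"] unfolding vle_def base.simps(1) weight.simps(1) add_0_right by blast
    qed
    have "vle v (cden c) (cnum c)" if "v \<in> vidx" for v
      using that Inl Inr by (cases v) (auto simp: vidx_def)
    thus ?thesis using True den by (simp add: x nu_def val_ring_def kval_Fract vle_iff)
  qed
next
  fix x assume x: "x \<in> val_ring"
  obtain g h where gh: "x = Fract g h" "h \<noteq> 0" by (cases x)
  obtain a b where ab: "cpol a = g" "cpol b = h" using cpol_surj by metis
  define z where "z = prod_encode (a, b)"
  \<comment> \<open>Finitely many stages concern a given fraction, so a single bound reveals all
    those among them that are not final.\<close>
  have "\<exists>s. \<forall>j\<le>n. \<not> final j \<longrightarrow> superseded s j" for n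
  proof (induction n)
    case 0
    have "\<exists>s. \<not> final 0 \<longrightarrow> superseded s 0" by (auto simp: superseded_def final_def)
    thus ?case by simp
  next
    case (Suc n)
    then obtain s where s: "\<forall>j\<le>n. \<not> final j \<longrightarrow> superseded s j" by blast
    have "\<exists>s. \<not> final (Suc n) \<longrightarrow> superseded s (Suc n)" by (auto simp: superseded_def final_def)
    then obtain t where t: "\<not> final (Suc n) \<longrightarrow> superseded t (Suc n)" by blast
    have "superseded (max s t) j" if "superseded s j \<or> superseded t j" for j
      using that by (auto simp: superseded_def le_max_iff_disj)
    thus ?case using s t by (intro exI[of _ "max s t"]) (auto simp: le_Suc_eq)
  qed
  then obtain s where s: "\<And>j. j \<le> z \<Longrightarrow> \<not> final j \<Longrightarrow> superseded s j" by blast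
  define c where "c = prod_encode (z, s)"
  have c: "cnum c = g" "cden c = h" "pfst c = z" "psnd c = s"
    by (simp_all add: c_def z_def cnum_def cden_def ab)
  have "vle v h g" if "v \<in> vidx" for v
  proof (cases "g = 0")
    case False
    thus ?thesis using gh x that by (simp add: vle_iff val_ring_def kval_Fract Fract_eq_0_iff)
  qed (simp add: vle_def)
  hence "valid c" using s gh(2) unfolding valid_def c by (auto simp: vidx_def)
  hence "nu c = x" by (simp add: nu_def c gh)
  thus "x \<in> range nu" by blast
qed

section \<open>Computability of the ring\<close>

definition computable_int :: "nat \<Rightarrow> ((nat \<Rightarrow> nat) \<Rightarrow> int) \<Rightarrow> bool" where
  "computable_int k f \<longleftrightarrow> (\<exists>u v. computable k u \<and> computable k v \<and> (\<forall>e. f e = int (u e) - int (v e)))"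

lemma computable_intI:
  "computable k u \<Longrightarrow> computable k v \<Longrightarrow> (\<And>e. f e = int (u e) - int (v e)) \<Longrightarrow> computable_int k f"
  by (auto simp: computable_int_def)

lemma computable_int_const [comp_intros]: "computable_int k (\<lambda>_. c)"
  by (rule computable_intI[of _ "\<lambda>_. nat c" "\<lambda>_. nat (- c)"]) (auto intro: comp_intros)

lemma computable_int_add [comp_intros]:
  assumes "computable_int k f" "computable_int k g" shows "computable_int k (\<lambda>e. f e + g e)"
proof -
  obtain u v u' v' where *: "computable k u" "computable k v" "\<And>e. f e = int (u e) - int (v e)"
    "computable k u'" "computable k v'" "\<And>e. g e = int (u' e) - int (v' e)"
    using assms unfolding computable_int_def by metis
  show ?thesis
    by (rule computable_intI[of _ "\<lambda>e. u e + u' e" "\<lambda>e. v e + v' e"]) (intro comp_intros * | simp add: *)+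
qed

lemma computable_int_mult [comp_intros]:
  assumes "computable_int k f" "computable_int k g" shows "computable_int k (\<lambda>e. f e * g e)"
proof -
  obtain u v u' v' where *: "computable k u" "computable k v" "\<And>e. f e = int (u e) - int (v e)"
    "computable k u'" "computable k v'" "\<And>e. g e = int (u' e) - int (v' e)"
    using assms unfolding computable_int_def by metis
  show ?thesis
    by (rule computable_intI[of _ "\<lambda>e. u e * u' e + v e * v' e" "\<lambda>e. u e * v' e + v e * u' e"])
      (intro comp_intros * | simp add: * algebra_simps)+
qed

lemma computable_int_if [comp_intros]:
  assumes "decidable k P" "computable_int k f" "computable_int k g"
  shows "computable_int k (\<lambda>e. if P e then f e else g e)"
proof -
  obtain u v u' v' where *: "computable k u" "computable k v" "\<And>e. f e = int (u e) - int (v e)"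
    "computable k u'" "computable k v'" "\<And>e. g e = int (u' e) - int (v' e)"
    using assms(2,3) unfolding computable_int_def by metis
  show ?thesis
    by (rule computable_intI[of _ "\<lambda>e. if P e then u e else u' e" "\<lambda>e. if P e then v e else v' e"])
      (intro comp_intros assms * | simp add: *)+
qed

lemma computable_int_sum [comp_intros]:
  assumes "computable k b" "computable_int (Suc k) (\<lambda>e. f (e 0) (\<lambda>i. e (Suc i)))"
  shows "computable_int k (\<lambda>e. \<Sum>i<b e. f i e)"
proof -
  obtain u v where *: "computable (Suc k) u" "computable (Suc k) v"
    "\<And>e. f (e 0) (\<lambda>i. e (Suc i)) = int (u e) - int (v e)"
    using assms(2) unfolding computable_int_def by metis
  have f: "f i e = int (u (case_nat i e)) - int (v (case_nat i e))" for i e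
    using *(3)[of "case_nat i e"] by simp
  have cn: "(\<lambda>i. case_nat (e 0) (\<lambda>i. e (Suc i)) i) = e" for e :: "nat \<Rightarrow> nat"
    by (auto split: nat.splits)
  show ?thesis
    by (rule computable_intI[of _ "\<lambda>e. \<Sum>i<b e. u (case_nat i e)" "\<lambda>e. \<Sum>i<b e. v (case_nat i e)"])
      ((rule computable_sum[OF assms(1)], simp add: cn *) | simp add: f sum_subtractf)+
qed

lemma computable_int_compose:
  assumes "computable_int n f" "\<And>i. i < n \<Longrightarrow> computable k (g i)"
  shows "computable_int k (\<lambda>e. f (\<lambda>i. g i e))"
proof -
  obtain u v where *: "computable n u" "computable n v" "\<And>e. f e = int (u e) - int (v e)"
    using assms(1) unfolding computable_int_def by metis
  show ?thesis
    by (rule computable_intI[OF computable_compose[OF *(1)] computable_compose[OF *(2)]])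
       (use assms(2) *(3) in auto)
qed

lemma decidable_int_eq [comp_intros]:
  assumes "computable_int k f" "computable_int k g" shows "decidable k (\<lambda>e. f e = g e)"
proof -
  obtain u v u' v' where *: "computable k u" "computable k v" "\<And>e. f e = int (u e) - int (v e)"
    "computable k u'" "computable k v'" "\<And>e. g e = int (u' e) - int (v' e)"
    using assms unfolding computable_int_def by metis
  have "decidable k (\<lambda>e. u e + v' e = u' e + v e)" by (intro comp_intros *)
  moreover have "u e + v' e = u' e + v e \<longleftrightarrow> f e = g e" for e by (auto simp: *)
  ultimately show ?thesis by simp
qed

lemma computable_nat_abs [comp_intros]:
  assumes "computable_int k f" shows "computable k (\<lambda>e. nat \<bar>f e\<bar>)"
proof -
  obtain u v where *: "computable k u" "computable k v" "\<And>e. f e = int (u e) - int (v e)"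
    using assms unfolding computable_int_def by metis
  have "computable k (\<lambda>e. (u e - v e) + (v e - u e))" by (intro comp_intros *)
  moreover have "(u e - v e) + (v e - u e) = nat \<bar>f e\<bar>" for e by (auto simp: *)
  ultimately show ?thesis by simp
qed

lemma computable_ccoef [comp_intros]:
  "computable k f \<Longrightarrow> computable k g \<Longrightarrow> computable_int k (\<lambda>e. ccoef (f e) (g e))"
  unfolding ccoef_def by (rule computable_intI[OF _ _ refl]) (intro comp_intros; assumption)+

text \<open>\<open>q\<close> names the kind of valuation: 0 stands for \<open>Inl\<close>, and
  \<open>Suc j\<close> for \<open>Inr j\<close>.\<close>

definition cweight :: "nat \<Rightarrow> nat \<Rightarrow> nat" where
  "cweight q n = (if q = 0 then 0 else multiplicity (pr (q - 1)) n)"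

definition cvle :: "nat \<Rightarrow> nat \<Rightarrow> nat \<Rightarrow> nat \<Rightarrow> bool" where
  "cvle i q y z \<longleftrightarrow> (\<forall>m\<le>z. 0 < m \<and> ccoef z m \<noteq> 0 \<longrightarrow> (\<exists>n\<le>y. 0 < n \<and> ccoef y n \<noteq> 0 \<and>
     multiplicity (pr i) (nat \<bar>ccoef y n\<bar>) + cweight q n \<le> multiplicity (pr i) (nat \<bar>ccoef z m\<bar>) + cweight q m))"

lemma computable_cweight [comp_intros]:
  "computable k f \<Longrightarrow> computable k g \<Longrightarrow> computable k (\<lambda>e. cweight (f e) (g e))"
  unfolding cweight_def by (intro comp_intros)

lemma decidable_cvle [comp_intros]:
  assumes "computable k a" "computable k b" "computable k c" "computable k d"
  shows "decidable k (\<lambda>e. cvle (a e) (b e) (c e) (d e))"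
  by (rule decidable_app4[OF _ assms]) (unfold cvle_def, intro comp_intros; simp)

lemma ball_keys_cpol: "(\<forall>m\<in>keys (cpol z). P (rep_mon m)) \<longleftrightarrow> (\<forall>m\<le>z. 0 < m \<and> ccoef z m \<noteq> 0 \<longrightarrow> P m)"
  unfolding keys_cpol Ball_def using ccoef_nz_le by (metis Mon_inverse mem_Collect_eq rep_mon_pos)

lemma bex_keys_cpol: "(\<exists>m\<in>keys (cpol z). P (rep_mon m)) \<longleftrightarrow> (\<exists>m\<le>z. 0 < m \<and> ccoef z m \<noteq> 0 \<and> P m)"
  using ball_keys_cpol[of z "\<lambda>m. \<not> P m"] by blast

lemma ball_bex_keys_cpol:
  "(\<forall>m\<in>keys (cpol z). \<exists>n\<in>keys (cpol y). Q (rep_mon m) (rep_mon n)) \<longleftrightarrow>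
   (\<forall>m\<le>z. 0 < m \<and> ccoef z m \<noteq> 0 \<longrightarrow> (\<exists>n\<le>y. 0 < n \<and> ccoef y n \<noteq> 0 \<and> Q m n))"
  using ball_keys_cpol[of z "\<lambda>m. \<exists>n\<in>keys (cpol y). Q m (rep_mon n)"] bex_keys_cpol[of y "Q _"] by simp

lemma vle_cpol:
  "vle v (cpol y) (cpol z) \<longleftrightarrow> cvle (base v) (case v of Inl i \<Rightarrow> 0 | Inr j \<Rightarrow> Suc j) y z"
proof -
  define q where "q = (case v of Inl i \<Rightarrow> 0 | Inr j \<Rightarrow> Suc j)"
  have w: "weight v m = cweight q (rep_mon m)" for m
    by (cases v) (auto simp: cweight_def q_def)
  show ?thesis
    unfolding vle_def cvle_def w lookup_cpol q_def[symmetric]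
    by (rule ball_bex_keys_cpol[of z y "\<lambda>m n. multiplicity (pr (base v)) (nat \<bar>ccoef y n\<bar>) + cweight q n
          \<le> multiplicity (pr (base v)) (nat \<bar>ccoef z m\<bar>) + cweight q m"])
qed

lemma cpol_eq_0: "cpol z \<noteq> 0 \<longleftrightarrow> (\<exists>m\<le>z. 0 < m \<and> ccoef z m \<noteq> 0)"
  using bex_keys_cpol[of z "\<lambda>_. True"] by (auto simp flip: keys_eq_empty)

lemma decidable_superseded [comp_intros]:
  assumes "computable k f" "computable k g" shows "decidable k (\<lambda>e. superseded (f e) (g e))"
  by (rule decidable_app2[OF _ assms]) (unfold superseded_def, intro comp_intros; simp)

lemma decidable_valid [comp_intros]:
  assumes "computable k f" shows "decidable k (\<lambda>e. valid (f e))"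
  by (rule decidable_app1[OF _ assms])
     (unfold valid_def cnum_def cden_def vle_cpol cpol_eq_0 base.simps sum.case, intro comp_intros; simp)

subsection \<open>Identities between Dirichlet polynomials are decidable\<close>

definition coef :: "dpol \<Rightarrow> nat \<Rightarrow> int" where
  "coef f n = (if n = 0 then 0 else lookup f (Mon n))"

lemma coef_eqI: "(\<And>n. coef f n = coef g n) \<Longrightarrow> f = g"
  by (rule poly_mapping_eqI) (metis coef_def not_less_zero rep_mon_inverse rep_mon_pos)

lemma coef_rep_mon: "coef f (rep_mon m) = lookup f m"
  by (simp add: coef_def rep_mon_inverse)

lemma coef_cpol: "coef (cpol z) n = (if n = 0 then 0 else ccoef z n)"
  by (simp add: coef_def lookup_cpol Mon_inverse)

text \<open>Monomials multiply as numbers, so the product of polynomials is Dirichlet convolution.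
  The sums run over initial segments instead of supports in order to match
  \<open>computable_int_sum\<close>.\<close>

lemma coef_mult:
  "coef (f * g) n = (\<Sum>d<Suc n. \<Sum>c<Suc n. if d * c = n then coef f d * coef g c else 0)"
proof (cases "n = 0")
  case False
  define m where "m = Mon n"
  have n: "n = rep_mon m" using False by (simp add: m_def Mon_inverse)
  \<comment> \<open>A sum over the support becomes one over \<open>{..<Suc n}\<close>: terms outside
    the support vanish, and so do terms beyond \<open>n\<close>, where no divisor of
    \<open>n\<close> lies.\<close>
  have sums: "(\<Sum>l\<in>keys h. F (rep_mon l)) = (\<Sum>d<Suc n. F d)"
    if "\<And>d. 0 < d \<Longrightarrow> coef h d = 0 \<or> n < d \<Longrightarrow> F d = 0" "F 0 = 0" for h :: dpol and F :: "nat \<Rightarrow> int"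
  proof -
    have inj: "inj_on rep_mon (keys h)" by (simp add: inj_on_def rep_mon_inject)
    have "(\<Sum>l\<in>keys h. F (rep_mon l)) = (\<Sum>d\<in>rep_mon ` keys h. F d)"
      by (simp add: sum.reindex[OF inj])
    also have "\<dots> = (\<Sum>d\<in>rep_mon ` keys h \<union> {..<Suc n}. F d)"
    proof (rule sum.mono_neutral_left)
      show "\<forall>d\<in>rep_mon ` keys h \<union> {..<Suc n} - rep_mon ` keys h. F d = 0"
      proof
        fix d assume d: "d \<in> rep_mon ` keys h \<union> {..<Suc n} - rep_mon ` keys h"
        show "F d = 0"
        proof (cases "d = 0")
          case False
          hence "coef h d = 0"
            using d by (metis DiffD2 Mon_inverse coef_def image_eqI in_keys_iff mem_Collect_eq neq0_conv)
          thus ?thesis using that(1)[of d] False by simp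
        qed (simp add: that(2))
      qed
    qed auto
    also have "\<dots> = (\<Sum>d<Suc n. F d)"
      by (rule sum.mono_neutral_right) (use that(1) rep_mon_pos in auto)
    finally show ?thesis .
  qed
  have "coef (f * g) n = (\<Sum>l\<in>keys f. \<Sum>q\<in>keys g. if rep_mon l * rep_mon q = n then coef f (rep_mon l) * coef g (rep_mon q) else 0)"
    unfolding n coef_rep_mon lookup_mult_keys
    by (intro sum.cong refl if_cong) (auto simp: plus_mon.rep_eq[symmetric] rep_mon_inject)
  also have "\<dots> = (\<Sum>l\<in>keys f. \<Sum>c<Suc n. if rep_mon l * c = n then coef f (rep_mon l) * coef g c else 0)"
    by (intro sum.cong refl sums) (use False in auto)
  also have "\<dots> = (\<Sum>d<Suc n. \<Sum>c<Suc n. if d * c = n then coef f d * coef g c else 0)"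
    by (intro sums sum.neutral) (use False in auto)
  finally show ?thesis .
qed (simp add: coef_def)

text \<open>The computable bound on the support reduces equality of polynomials to finitely many
  comparisons of coefficients.\<close>

definition computable_dpol :: "nat \<Rightarrow> ((nat \<Rightarrow> nat) \<Rightarrow> dpol) \<Rightarrow> bool" where
  "computable_dpol k f \<longleftrightarrow> computable_int (Suc k) (\<lambda>e. coef (f (\<lambda>i. e (Suc i))) (e 0)) \<and>
     (\<exists>b. computable k b \<and> (\<forall>e n. coef (f e) n \<noteq> 0 \<longrightarrow> n \<le> b e))"

lemma computable_dpolI:
  "computable_int (Suc k) (\<lambda>e. coef (f (\<lambda>i. e (Suc i))) (e 0)) \<Longrightarrow> computable k b \<Longrightarrow>
     (\<And>e n. coef (f e) n \<noteq> 0 \<Longrightarrow> n \<le> b e) \<Longrightarrow> computable_dpol k f"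
  by (auto simp: computable_dpol_def)

lemma computable_dpol_const [comp_intros]: "computable_dpol k (\<lambda>e. c)"
proof -
  obtain z where z: "cpol z = c" using cpol_surj by blast
  show ?thesis
  proof (rule computable_dpolI[where b = "\<lambda>_. z"])
    show "computable_int (Suc k) (\<lambda>e. coef c (e 0))"
      unfolding z[symmetric] coef_cpol by (intro comp_intros; simp)
  qed (auto simp: z[symmetric] coef_cpol intro: ccoef_nz_le comp_intros split: if_splits)
qed

lemma computable_shift: "computable k f \<Longrightarrow> computable (Suc k) (\<lambda>e. f (\<lambda>i. e (Suc i)))"
  by (rule computable_compose) (auto intro: comp_intros)

lemma computable_dpol_cpol [comp_intros]:
  assumes "computable k f" shows "computable_dpol k (\<lambda>e. cpol (f e))"
proof (rule computable_dpolI[OF _ assms])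
  show "computable_int (Suc k) (\<lambda>e. coef (cpol (f (\<lambda>i. e (Suc i)))) (e 0))"
    unfolding coef_cpol by (intro comp_intros computable_shift assms; simp)
qed (auto simp: coef_cpol intro: ccoef_nz_le split: if_splits)

lemma computable_dpol_if [comp_intros]:
  assumes "decidable k P" "computable_dpol k f" "computable_dpol k g"
  shows "computable_dpol k (\<lambda>e. if P e then f e else g e)"
proof -
  obtain b b' where *: "computable k b" "\<And>e n. coef (f e) n \<noteq> 0 \<Longrightarrow> n \<le> b e"
    "computable k b'" "\<And>e n. coef (g e) n \<noteq> 0 \<Longrightarrow> n \<le> b' e"
    using assms(2,3) unfolding computable_dpol_def by metis
  have P: "decidable (Suc k) (\<lambda>e. P (\<lambda>i. e (Suc i)))"
    using computable_shift assms(1) unfolding decidable_def .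
  show ?thesis
  proof (rule computable_dpolI[where b = "\<lambda>e. if P e then b e else b' e"])
    have "computable_int (Suc k) (\<lambda>e. if P (\<lambda>i. e (Suc i)) then coef (f (\<lambda>i. e (Suc i))) (e 0) else coef (g (\<lambda>i. e (Suc i))) (e 0))"
      using assms(2,3) unfolding computable_dpol_def by (intro comp_intros P) auto
    thus "computable_int (Suc k) (\<lambda>e. coef (if P (\<lambda>i. e (Suc i)) then f (\<lambda>i. e (Suc i)) else g (\<lambda>i. e (Suc i))) (e 0))"
      by (simp only: if_distrib[of "\<lambda>f. coef f _"])
    show "computable k (\<lambda>e. if P e then b e else b' e)" by (intro comp_intros assms *)
  qed (auto simp: * split: if_splits)
qed

lemma computable_dpol_add [comp_intros]:
  assumes "computable_dpol k f" "computable_dpol k g" shows "computable_dpol k (\<lambda>e. f e + g e)"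
proof -
  obtain b b' where *: "computable k b" "\<And>e n. coef (f e) n \<noteq> 0 \<Longrightarrow> n \<le> b e"
    "computable k b'" "\<And>e n. coef (g e) n \<noteq> 0 \<Longrightarrow> n \<le> b' e"
    using assms unfolding computable_dpol_def by metis
  have add: "coef (p + q) n = coef p n + coef q n" for p q n by (simp add: coef_def lookup_add)
  show ?thesis
  proof (rule computable_dpolI[where b = "\<lambda>e. b e + b' e"])
    show "computable_int (Suc k) (\<lambda>e. coef (f (\<lambda>i. e (Suc i)) + g (\<lambda>i. e (Suc i))) (e 0))"
      unfolding add using assms unfolding computable_dpol_def by (intro comp_intros) auto
    show "computable k (\<lambda>e. b e + b' e)" by (intro comp_intros *)
    fix e n assume "coef (f e + g e) n \<noteq> 0"
    hence "coef (f e) n \<noteq> 0 \<or> coef (g e) n \<noteq> 0" by (auto simp: add)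
    thus "n \<le> b e + b' e" using *(2)[of e n] *(4)[of e n] by linarith
  qed
qed

lemma computable_dpol_mult [comp_intros]:
  assumes "computable_dpol k f" "computable_dpol k g" shows "computable_dpol k (\<lambda>e. f e * g e)"
proof -
  obtain b b' where *: "computable k b" "\<And>e n. coef (f e) n \<noteq> 0 \<Longrightarrow> n \<le> b e"
    "computable k b'" "\<And>e n. coef (g e) n \<noteq> 0 \<Longrightarrow> n \<le> b' e"
    using assms unfolding computable_dpol_def by metis
  \<comment> \<open>Under the two summation indices and the position, the original environment
    starts at entry 3; \<open>j\<close> selects the entry at which the coefficient is taken.\<close>
  have coef: "computable_int (Suc (Suc (Suc k))) (\<lambda>e. coef (h (\<lambda>i. e (Suc (Suc (Suc i))))) (e j))"
    if "computable_dpol k h" "j < 3" for h j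
  proof -
    have 1: "computable_int (Suc k) (\<lambda>e. coef (h (\<lambda>i. e (Suc i))) (e 0))"
      using that(1) by (simp add: computable_dpol_def)
    have 2: "computable (Suc (Suc (Suc k))) (\<lambda>e. if i = 0 then e j else e (Suc (Suc i)))" if "i < Suc k" for i
      using that \<open>j < 3\<close> by (cases "i = 0") (auto intro!: comp_intros)
    show ?thesis
      using computable_int_compose[OF 1, of _ "\<lambda>i e. if i = 0 then e j else e (Suc (Suc i))", OF 2] by simp
  qed
  show ?thesis
  proof (rule computable_dpolI[where b = "\<lambda>e. b e * b' e"])
    show "computable_int (Suc k) (\<lambda>e. coef (f (\<lambda>i. e (Suc i)) * g (\<lambda>i. e (Suc i))) (e 0))"
      unfolding coef_mult by (intro comp_intros coef assms; simp)
    show "computable k (\<lambda>e. b e * b' e)" by (intro comp_intros *)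
    fix e n assume nz: "coef (f e * g e) n \<noteq> 0"
    have "\<exists>d c. n = d * c \<and> coef (f e) d \<noteq> 0 \<and> coef (g e) c \<noteq> 0"
    proof (rule ccontr)
      assume none: "\<not> (\<exists>d c. n = d * c \<and> coef (f e) d \<noteq> 0 \<and> coef (g e) c \<noteq> 0)"
      have "coef (f e * g e) n = 0"
        unfolding coef_mult by (intro sum.neutral ballI) (use none in auto)
      thus False using nz by blast
    qed
    then obtain d c where "n = d * c" "d \<le> b e" "c \<le> b' e" using *(2,4) by blast
    thus "n \<le> b e * b' e" by (simp add: mult_mono)
  qed
qed

lemma decidable_dpol_eq [comp_intros]:
  assumes "computable_dpol k f" "computable_dpol k g" shows "decidable k (\<lambda>e. f e = g e)"
proof -
  obtain b b' where *: "computable k b" "\<And>e n. coef (f e) n \<noteq> 0 \<Longrightarrow> n \<le> b e"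
    "computable k b'" "\<And>e n. coef (g e) n \<noteq> 0 \<Longrightarrow> n \<le> b' e"
    using assms unfolding computable_dpol_def by metis
  have "decidable k (\<lambda>e. \<forall>n\<le>b e + b' e. coef (f e) n = coef (g e) n)"
    using assms unfolding computable_dpol_def by (intro comp_intros *) auto
  moreover have "(\<forall>n\<le>b e + b' e. coef (f e) n = coef (g e) n) \<longleftrightarrow> f e = g e" for e
  proof
    assume eq: "\<forall>n\<le>b e + b' e. coef (f e) n = coef (g e) n"
    show "f e = g e"
    proof (rule coef_eqI)
      fix n
      show "coef (f e) n = coef (g e) n"
      proof (cases "n \<le> b e + b' e")
        case False
        hence "coef (f e) n = 0" "coef (g e) n = 0"
          using *(2)[of e n] *(4)[of e n] by (meson le_add1 le_add2 order.trans)+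
        thus ?thesis by simp
      qed (use eq in blast)
    qed
  qed simp
  ultimately show ?thesis by simp
qed

subsection \<open>The numbered ring is computable\<close>

text \<open>Invalid codes are read as 0/1. Thus \<open>nu\<close> is always a fraction with nonzero
  denominator, and equations between its values become polynomial identities.\<close>

definition nnum :: "nat \<Rightarrow> dpol" where "nnum c = (if valid c then cnum c else 0)"
definition nden :: "nat \<Rightarrow> dpol" where "nden c = (if valid c then cden c else 1)"

lemma nden_nz: "nden c \<noteq> 0"
  by (simp add: nden_def valid_def)

lemma nu_Fract: "nu c = Fract (nnum c) (nden c)"
  by (simp add: nu_def nnum_def nden_def fract_collapse)

lemma computable_nnum [comp_intros]: "computable k f \<Longrightarrow> computable_dpol k (\<lambda>e. nnum (f e))"
  unfolding nnum_def cnum_def by (intro comp_intros)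

lemma computable_nden [comp_intros]: "computable k f \<Longrightarrow> computable_dpol k (\<lambda>e. nden (f e))"
  unfolding nden_def cden_def by (intro comp_intros)

lemma decidable_nu_eq:
  assumes "computable k a" "computable k b" shows "decidable k (\<lambda>e. nu (a e) = nu (b e))"
  unfolding nu_Fract eq_fract(1)[OF nden_nz nden_nz] by (intro comp_intros assms)

lemma decidable_nu_add:
  assumes "computable k a" "computable k b" "computable k c"
  shows "decidable k (\<lambda>e. nu (c e) = nu (a e) + nu (b e))"
  unfolding nu_Fract add_fract[OF nden_nz nden_nz] eq_fract(1)[OF nden_nz no_zero_divisors[OF nden_nz nden_nz]]
  by (intro comp_intros assms)

lemma decidable_nu_mult:
  assumes "computable k a" "computable k b" "computable k c"
  shows "decidable k (\<lambda>e. nu (c e) = nu (a e) * nu (b e))"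
  unfolding nu_Fract mult_fract eq_fract(1)[OF nden_nz no_zero_divisors[OF nden_nz nden_nz]]
  by (intro comp_intros assms)

lemma numbered_subring_nu: "numbered_subring nu"
  by unfold_locales (simp_all add: range_nu val_ring_0 val_ring_1 val_ring_add val_ring_mult val_ring_uminus)

lemma ex_nu: "x \<in> val_ring \<Longrightarrow> \<exists>n. nu n = x"
  using range_nu by (metis imageE)

lemma nu_in: "nu n \<in> val_ring"
  using range_nu by blast

lemma computable_phi:
  assumes "computable k f"
  obtains p where "\<And>xs. length xs = k \<Longrightarrow> eval p xs = Some (f ((!) xs))"
proof -
  obtain p where p: "\<And>e. eval p (map e [0..<k]) = Some (f e)" using assms by (auto simp: computable_def)
  have "eval p xs = Some (f ((!) xs))" if "length xs = k" for xs
    using p[of "(!) xs"] that by (metis map_nth)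
  thus ?thesis using that by blast
qed

definition the_ring :: "nat ring" where "the_ring = numbered_ring nu"

text \<open>Closure of \<open>val_ring\<close> under the operations makes the searches for least
  codes terminate.\<close>

lemma computable_the_ring: "\<exists>d s m. ring_index the_ring d s m"
proof -
  have "decidable 1 (\<lambda>e. (LEAST n. nu n = nu (e 0)) = e 0)"
    by (intro comp_intros decidable_nu_eq) auto
  hence d: "decidable 1 (\<lambda>e. e 0 \<in> carrier the_ring)"
    by (simp add: the_ring_def numbered_ring_def idx_def)
  obtain d where d: "\<And>x. eval d [x] = Some (of_bool (x \<in> carrier the_ring))"
    using computable_phi[OF d[unfolded decidable_def]] by (metis length_Cons list.size(3) nth_Cons_0 One_nat_def)
  have "computable 2 (\<lambda>e. LEAST n. nu n = nu (e 0) + nu (e 1))"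
    by (intro comp_intros decidable_nu_add) (auto intro!: ex_nu val_ring_add nu_in)
  then obtain s where s: "\<And>xs. length xs = 2 \<Longrightarrow> eval s xs = Some (LEAST n. nu n = nu (xs ! 0) + nu (xs ! 1))"
    using computable_phi by blast
  have "computable 2 (\<lambda>e. LEAST n. nu n = nu (e 0) * nu (e 1))"
    by (intro comp_intros decidable_nu_mult) (auto intro!: ex_nu val_ring_mult nu_in)
  then obtain m where m: "\<And>xs. length xs = 2 \<Longrightarrow> eval m xs = Some (LEAST n. nu n = nu (xs ! 0) * nu (xs ! 1))"
    using computable_phi by blast
  have "ring_index the_ring (encode d) (encode s) (encode m)"
    unfolding ring_index_def decides_def computes_binop_on_def
    by (auto simp: d s m the_ring_def numbered_ring_def idx_def)
  thus ?thesis by blast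
qed

lemma computable_UFD_the_ring: "computable_UFD the_ring"
proof -
  interpret valued_domain the_ring vidx "\<lambda>v n. nat (kval v (nu n))" "\<lambda>v. idx nu (uniformizer v)"
    unfolding the_ring_def by (rule valued_domain_numbered_ring[OF range_nu])
  show ?thesis
    using computable_the_ring factorial_domain ring_axioms by (auto simp: computable_UFD_def computable_ring_def)
qed

section \<open>Presentations\<close>

text \<open>\<open>\<psi>\<close> embeds the presentation into the field of fractions. It serves
  verification only: no program computes it.\<close>

locale presentation =
  fixes A' :: "nat ring" and \<psi> :: "nat \<Rightarrow> dpol fract" and d s m :: prog
  assumes ring_A': "ring A'"
    and index: "ring_index A' (encode d) (encode s) (encode m)"
    and inj: "inj_on \<psi> (carrier A')"
    and psi_add: "\<lbrakk>a \<in> carrier A'; b \<in> carrier A'\<rbrakk> \<Longrightarrow> \<psi> (a \<oplus>\<^bsub>A'\<^esub> b) = \<psi> a + \<psi> b"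
    and psi_mult: "\<lbrakk>a \<in> carrier A'; b \<in> carrier A'\<rbrakk> \<Longrightarrow> \<psi> (a \<otimes>\<^bsub>A'\<^esub> b) = \<psi> a * \<psi> b"
    and psi_one: "\<psi> \<one>\<^bsub>A'\<^esub> = 1"
    and prime_iff: "\<lbrakk>a \<in> carrier A'; \<psi> a = of_nat (pr i)\<rbrakk> \<Longrightarrow> ring_prime\<^bsub>A'\<^esub> a \<longleftrightarrow> (\<forall>x. \<exists>w. matrix i x w)"
begin

abbreviation "C \<equiv> carrier A'"

lemma eval_d: "eval d [x] = Some (of_bool (x \<in> C))"
  and eval_s: "x \<in> C \<Longrightarrow> y \<in> C \<Longrightarrow> eval s [x, y] = Some (x \<oplus>\<^bsub>A'\<^esub> y)"
  and eval_m: "x \<in> C \<Longrightarrow> y \<in> C \<Longrightarrow> eval m [x, y] = Some (x \<otimes>\<^bsub>A'\<^esub> y)"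
  using index by (auto simp: ring_index_def decides_def computes_binop_on_def)

lemma mult_comm: "x \<in> C \<Longrightarrow> y \<in> C \<Longrightarrow> x \<otimes>\<^bsub>A'\<^esub> y = y \<otimes>\<^bsub>A'\<^esub> x"
  by (rule inj_onD[OF inj]) (simp_all add: psi_mult ring_A' monoid.m_closed ring.is_monoid)

lemma closed [simp]: "\<one>\<^bsub>A'\<^esub> \<in> C" "\<zero>\<^bsub>A'\<^esub> \<in> C" "x \<in> C \<Longrightarrow> y \<in> C \<Longrightarrow> x \<otimes>\<^bsub>A'\<^esub> y \<in> C"
    "x \<in> C \<Longrightarrow> y \<in> C \<Longrightarrow> x \<oplus>\<^bsub>A'\<^esub> y \<in> C"
  using ring_A' by (simp_all add: ring.is_monoid monoid.m_closed monoid.one_closed ring.ring_simprules)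

lemma decidable_carrier [comp_intros]: "computable k f \<Longrightarrow> decidable k (\<lambda>e. f e \<in> C)"
  by (rule decidable_app1, unfold decidable_def) (rule computableI[of d], simp add: eval_d)

lemma computable_mult_ring:
  assumes "computable k f" "computable k g" "\<And>e. f e \<in> C" "\<And>e. g e \<in> C"
  shows "computable k (\<lambda>e. f e \<otimes>\<^bsub>A'\<^esub> g e)"
proof -
  obtain p q where "\<And>e. eval p (map e [0..<k]) = Some (f e)" "\<And>e. eval q (map e [0..<k]) = Some (g e)"
    using assms(1,2) unfolding computable_def by blast
  thus ?thesis using assms(3,4) by (intro computableI[of "PComp m [p, q]"]) (simp add: eval_m)
qed

text \<open>The matrix below must be decided for all numbers, while the operation programs may
  diverge outside the carrier; arguments are therefore moved into it.\<close>

definition tot :: "nat \<Rightarrow> nat" where "tot x = (if x \<in> C then x else \<zero>\<^bsub>A'\<^esub>)"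

lemma tot_in [simp]: "tot x \<in> C" and tot_id: "x \<in> C \<Longrightarrow> tot x = x"
  by (simp_all add: tot_def)

lemma computable_tot [comp_intros]: "computable k f \<Longrightarrow> computable k (\<lambda>e. tot (f e))"
  unfolding tot_def by (intro comp_intros)

text \<open>Divisibility is existential both in the premise and in the conclusion of primality.
  Hence \<open>x\<close> packs \<open>a\<close>, \<open>b\<close> and the cofactor \<open>c\<close>
  of the premise, while \<open>y\<close> is the cofactor of the conclusion. The same
  \<open>a\<close> runs through the possible inverses of \<open>p\<close>.\<close>

definition prime_matrix :: "nat \<Rightarrow> nat \<Rightarrow> nat \<Rightarrow> bool" where
  "prime_matrix x y p \<longleftrightarrow> (let a = pfst x; b = pfst (psnd x); c = psnd (psnd x) in
     p \<in> C \<and> p \<noteq> \<zero>\<^bsub>A'\<^esub> \<and> (a \<in> C \<longrightarrow> tot p \<otimes>\<^bsub>A'\<^esub> tot a \<noteq> \<one>\<^bsub>A'\<^esub>) \<and>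
     (a \<in> C \<and> b \<in> C \<and> c \<in> C \<and> tot a \<otimes>\<^bsub>A'\<^esub> tot b = tot p \<otimes>\<^bsub>A'\<^esub> tot c \<longrightarrow>
        y \<in> C \<and> (a = tot p \<otimes>\<^bsub>A'\<^esub> tot y \<or> b = tot p \<otimes>\<^bsub>A'\<^esub> tot y)))"

lemma decidable_prime_matrix: "decidable 3 (\<lambda>e. prime_matrix (e 0) (e 1) (e 2))"
  unfolding prime_matrix_def Let_def by (intro comp_intros computable_mult_ring; simp)

lemma primes_iff: "p \<in> primes_of A' \<longleftrightarrow> (\<forall>x. \<exists>y. prime_matrix x y p)"
proof -
  have Units: "p \<in> Units A' \<longleftrightarrow> (\<exists>a\<in>C. p \<otimes>\<^bsub>A'\<^esub> a = \<one>\<^bsub>A'\<^esub>)" if "p \<in> C" for p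
    using that by (auto simp: Units_def mult_comm)
  show ?thesis
  proof
    assume "p \<in> primes_of A'"
    hence p: "p \<in> C" "p \<noteq> \<zero>\<^bsub>A'\<^esub>" "p \<notin> Units A'"
      and pp: "\<And>a b. a \<in> C \<Longrightarrow> b \<in> C \<Longrightarrow> p divides\<^bsub>A'\<^esub> a \<otimes>\<^bsub>A'\<^esub> b \<Longrightarrow> p divides\<^bsub>A'\<^esub> a \<or> p divides\<^bsub>A'\<^esub> b"
      by (auto simp: primes_of_def ring_prime_def Divisibility.prime_def)
    show "\<forall>x. \<exists>y. prime_matrix x y p"
    proof
      fix x
      define a b c where "a = pfst x" and "b = pfst (psnd x)" and "c = psnd (psnd x)"
      note abc = a_def[symmetric] b_def[symmetric] c_def[symmetric]
      have nu: "a \<in> C \<Longrightarrow> p \<otimes>\<^bsub>A'\<^esub> a \<noteq> \<one>\<^bsub>A'\<^esub>" using p Units by blast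
      show "\<exists>y. prime_matrix x y p"
      proof (cases "a \<in> C \<and> b \<in> C \<and> c \<in> C \<and> a \<otimes>\<^bsub>A'\<^esub> b = p \<otimes>\<^bsub>A'\<^esub> c")
        case True
        hence "p divides\<^bsub>A'\<^esub> a \<otimes>\<^bsub>A'\<^esub> b" by (auto simp: factor_def)
        hence "\<exists>y\<in>C. a = p \<otimes>\<^bsub>A'\<^esub> y \<or> b = p \<otimes>\<^bsub>A'\<^esub> y" using pp[of a b] True by (auto simp: factor_def)
        thus ?thesis unfolding prime_matrix_def Let_def abc using p nu by (auto simp: tot_id)
      next
        case False
        thus ?thesis unfolding prime_matrix_def Let_def abc using p nu by (auto simp: tot_id)
      qed
    qed
  next
    assume pm: "\<forall>x. \<exists>y. prime_matrix x y p"
    have pm': "\<exists>y. p \<in> C \<and> p \<noteq> \<zero>\<^bsub>A'\<^esub> \<and> (a \<in> C \<longrightarrow> p \<otimes>\<^bsub>A'\<^esub> a \<noteq> \<one>\<^bsub>A'\<^esub>) \<and>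
        (a \<in> C \<and> b \<in> C \<and> c \<in> C \<and> a \<otimes>\<^bsub>A'\<^esub> b = p \<otimes>\<^bsub>A'\<^esub> c \<longrightarrow> y \<in> C \<and> (a = p \<otimes>\<^bsub>A'\<^esub> y \<or> b = p \<otimes>\<^bsub>A'\<^esub> y))" for a b c
    proof -
      obtain y where "prime_matrix (prod_encode (a, prod_encode (b, c))) y p" using pm by blast
      thus ?thesis by (intro exI[of _ y]) (auto simp: prime_matrix_def Let_def tot_id)
    qed
    hence p: "p \<in> C" "p \<noteq> \<zero>\<^bsub>A'\<^esub>" "p \<notin> Units A'" using Units by blast+
    have "p divides\<^bsub>A'\<^esub> a \<or> p divides\<^bsub>A'\<^esub> b"
      if ab: "a \<in> C" "b \<in> C" "p divides\<^bsub>A'\<^esub> a \<otimes>\<^bsub>A'\<^esub> b" for a b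
    proof -
      obtain c where "c \<in> C" "a \<otimes>\<^bsub>A'\<^esub> b = p \<otimes>\<^bsub>A'\<^esub> c" using ab(3) by (auto simp: factor_def)
      thus ?thesis using pm'[of a b c] ab(1,2) unfolding factor_def by blast
    qed
    with p show "p \<in> primes_of A'"
      by (auto simp: primes_of_def ring_prime_def Divisibility.prime_def)
  qed
qed

lemma Pi02_primes: "Pi02 (primes_of A')"
proof -
  obtain q where q: "\<And>xs. length xs = 3 \<Longrightarrow> eval q xs = Some (of_bool (prime_matrix (xs ! 0) (xs ! 1) (xs ! 2)))"
    using computable_phi[OF decidable_prime_matrix[unfolded decidable_def]] by blast
  have "decides3 (encode q) prime_matrix" by (simp add: decides3_def q)
  thus ?thesis unfolding Pi02_def using primes_iff by blast
qed

end

section \<open>Uniform reductions\<close>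

text \<open>The code of the program built from \<open>d\<close>, \<open>s\<close>, \<open>m\<close>
  is computable from their codes. The closure of this notion under the program constructors takes
  the part of the s-m-n theorem.\<close>

definition uniform :: "(prog \<Rightarrow> prog \<Rightarrow> prog \<Rightarrow> prog) \<Rightarrow> bool" where
  "uniform F \<longleftrightarrow> (\<exists>G. computable 3 (\<lambda>e. G (e 0) (e 1) (e 2)) \<and>
     (\<forall>d s m. encode (F d s m) = G (encode d) (encode s) (encode m)))"

lemma uniformI:
  "computable 3 (\<lambda>e. G (e 0) (e 1) (e 2)) \<Longrightarrow>
     (\<And>d s m. encode (F d s m) = G (encode d) (encode s) (encode m)) \<Longrightarrow> uniform F"
  unfolding uniform_def by blast

lemma uniform_const: "uniform (\<lambda>d s m. p)"
  by (rule uniformI[of "\<lambda>_ _ _. encode p"]) (auto intro: comp_intros)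

lemma uniform_index: "uniform (\<lambda>d s m. d)" "uniform (\<lambda>d s m. s)" "uniform (\<lambda>d s m. m)"
  by (rule uniformI[of "\<lambda>d s m. d"] uniformI[of "\<lambda>d s m. s"] uniformI[of "\<lambda>d s m. m"];
      auto intro: comp_intros)+

lemma uniform_list:
  assumes "\<forall>F\<in>set Fs. uniform F"
  shows "\<exists>G. computable 3 (\<lambda>e. G (e 0) (e 1) (e 2)) \<and>
     (\<forall>d s m. list_encode (map encode (map (\<lambda>F. F d s m) Fs)) = G (encode d) (encode s) (encode m))"
  using assms
proof (induction Fs)
  case Nil
  show ?case by (intro exI[of _ "\<lambda>_ _ _. 0"]) (simp add: comp_intros)
next
  case (Cons F Fs)
  then obtain G where G: "computable 3 (\<lambda>e. G (e 0) (e 1) (e 2))"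
    "\<And>d s m. list_encode (map encode (map (\<lambda>F. F d s m) Fs)) = G (encode d) (encode s) (encode m)" by auto
  obtain H where H: "computable 3 (\<lambda>e. H (e 0) (e 1) (e 2))"
    "\<And>d s m. encode (F d s m) = H (encode d) (encode s) (encode m)"
    using Cons.prems by (auto simp: uniform_def)
  have "computable 3 (\<lambda>e. Suc (prod_encode (H (e 0) (e 1) (e 2), G (e 0) (e 1) (e 2))))"
    by (intro comp_intros G H)
  thus ?case
    by (intro exI[of _ "\<lambda>x y z. Suc (prod_encode (H x y z, G x y z))"]) (simp add: G(2)[simplified] H)
qed

lemma uniform_comp:
  assumes "uniform F" "\<forall>F\<in>set Fs. uniform F"
  shows "uniform (\<lambda>d s m. PComp (F d s m) (map (\<lambda>F. F d s m) Fs))"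
proof -
  obtain H where H: "computable 3 (\<lambda>e. H (e 0) (e 1) (e 2))"
    "\<And>d s m. encode (F d s m) = H (encode d) (encode s) (encode m)"
    using assms(1) by (auto simp: uniform_def)
  obtain G where G: "computable 3 (\<lambda>e. G (e 0) (e 1) (e 2))"
    "\<And>d s m. list_encode (map encode (map (\<lambda>F. F d s m) Fs)) = G (encode d) (encode s) (encode m)"
    using uniform_list[OF assms(2)] by blast
  show ?thesis
    by (rule uniformI[of "\<lambda>x y z. prod_encode (3, prod_encode (H x y z, G x y z))"])
      ((intro comp_intros G H) | simp add: H G(2)[simplified])+
qed

lemma uniform_rec:
  assumes "uniform F" "uniform F'" shows "uniform (\<lambda>d s m. PRec (F d s m) (F' d s m))"
proof -
  obtain G where G: "computable 3 (\<lambda>e. G (e 0) (e 1) (e 2))"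
    "\<And>d s m. encode (F d s m) = G (encode d) (encode s) (encode m)"
    using assms(1) by (auto simp: uniform_def)
  obtain H where H: "computable 3 (\<lambda>e. H (e 0) (e 1) (e 2))"
    "\<And>d s m. encode (F' d s m) = H (encode d) (encode s) (encode m)"
    using assms(2) by (auto simp: uniform_def)
  show ?thesis
    by (rule uniformI[of "\<lambda>x y z. prod_encode (4, prod_encode (G x y z, H x y z))"])
      ((intro comp_intros G H) | simp add: G H)+
qed

lemma uniform_min:
  assumes "uniform F" shows "uniform (\<lambda>d s m. PMin (F d s m))"
proof -
  obtain G where G: "computable 3 (\<lambda>e. G (e 0) (e 1) (e 2))"
    "\<And>d s m. encode (F d s m) = G (encode d) (encode s) (encode m)"
    using assms by (auto simp: uniform_def)
  show ?thesis
    by (rule uniformI[of "\<lambda>x y z. prod_encode (5, G x y z)"]) ((intro comp_intros G) | simp add: G)+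
qed

lemma ex_prog_negate: "\<exists>p. \<forall>x. eval p [x] = Some (1 - x)"
proof -
  have "computable 1 (\<lambda>e. 1 - e 0)" by (intro comp_intros) auto
  from computable_phi[OF this] obtain p where "\<And>xs. length xs = 1 \<Longrightarrow> eval p xs = Some (1 - xs ! 0)" by blast
  thus ?thesis by (intro exI[of _ p]) simp
qed

lemma ex_prog_if: "\<exists>p. \<forall>b x y. eval p [b, x, y] = Some (if b = 0 then y else x)"
proof -
  have "computable 3 (\<lambda>e. if e 0 = 0 then e 2 else e 1)" by (intro comp_intros) auto
  from computable_phi[OF this] obtain p
    where "\<And>xs. length xs = 3 \<Longrightarrow> eval p xs = Some (if xs ! 0 = 0 then xs ! 2 else xs ! 1)" by blast
  thus ?thesis by (intro exI[of _ p]) simp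
qed

text \<open>\<open>b\<close> is a membership flag, \<open>u\<close> an element, \<open>v\<close> its
  square and \<open>w\<close> its double. Success is signalled by 0, as \<open>PMin\<close>
  expects.\<close>

lemma ex_prog_one_test: "\<exists>p. \<forall>b u v w. eval p [b, u, v, w] = Some (of_bool (\<not> (b \<noteq> 0 \<and> v = u \<and> w \<noteq> u)))"
proof -
  have "computable 4 (\<lambda>e. of_bool (\<not> (e 0 \<noteq> 0 \<and> e 2 = e 1 \<and> e 3 \<noteq> e 1)))" by (intro comp_intros) auto
  from computable_phi[OF this] obtain p
    where "\<And>xs. length xs = 4 \<Longrightarrow> eval p xs = Some (of_bool (\<not> (xs ! 0 \<noteq> 0 \<and> xs ! 2 = xs ! 1 \<and> xs ! 3 \<noteq> xs ! 1)))"
    by blast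
  thus ?thesis by (intro exI[of _ p]) simp
qed

text \<open>
  The identity of a presentation is found as its only idempotent \<open>u\<close> with \<open>u + u \<noteq> u\<close>.  Numbers
  outside the carrier are first replaced by the least element of the carrier, since the
  programs for the operations may diverge there.
\<close>

lemma uniform_of_nat:
  obtains F where "uniform F"
    "\<And>A' \<psi> d s m n. presentation A' \<psi> d s m \<Longrightarrow>
       \<exists>a\<in>carrier A'. eval (F d s m) [n] = Some a \<and> \<psi> a = of_nat (Suc n)"
proof -
  obtain neg where neg: "\<And>x. eval neg [x] = Some (1 - x)" using ex_prog_negate by blast
  obtain ite where ite: "\<And>b x y. eval ite [b, x, y] = Some (if b = 0 then y else x)" using ex_prog_if by blast
  obtain tst where tst: "\<And>b u v w. eval tst [b, u, v, w] = Some (of_bool (\<not> (b \<noteq> 0 \<and> v = u \<and> w \<noteq> u)))"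
    using ex_prog_one_test by blast
  \<comment> \<open>\<open>d\<close> is specified on lists of length one only, so the first argument
    is extracted. This allows the derived programs to run on the argument lists of different lengths
    that occur in minimisation and recursion.\<close>
  define mem where "mem d s m = PComp d [PProj 0]" for d s m :: prog
  define elt where "elt d s m = PMin (PComp neg [mem d s m])" for d s m
  define grd where "grd d s m = PComp ite [mem d s m, PProj 0, elt d s m]" for d s m
  define sqr where "sqr d s m = PComp m [grd d s m, grd d s m]" for d s m
  define dbl where "dbl d s m = PComp s [grd d s m, grd d s m]" for d s m
  define one where "one d s m = PMin (PComp tst [mem d s m, grd d s m, sqr d s m, dbl d s m])" for d s m
  define stp where "stp d s m = PComp s [PProj 1, one d s m]" for d s m
  \<comment> \<open>The recursion starts at the identity rather than at zero, so argument
    \<open>n\<close> yields the sum of \<open>n + 1\<close> identities.\<close>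
  define F where "F d s m = PRec (one d s m) (stp d s m)" for d s m
  have mem: "uniform mem"
    using uniform_comp[OF uniform_index(1), of "[\<lambda>_ _ _. PProj 0]"] uniform_const by (simp add: mem_def[abs_def])
  have elt: "uniform elt"
    using uniform_min[OF uniform_comp[OF uniform_const, of "[mem]" neg]] mem by (simp add: elt_def[abs_def])
  have grd: "uniform grd"
    using uniform_comp[OF uniform_const, of "[mem, \<lambda>_ _ _. PProj 0, elt]" ite] mem elt uniform_const
    by (simp add: grd_def[abs_def])
  have sqr: "uniform sqr"
    using uniform_comp[OF uniform_index(3), of "[grd, grd]"] grd by (simp add: sqr_def[abs_def])
  have dbl: "uniform dbl"
    using uniform_comp[OF uniform_index(2), of "[grd, grd]"] grd by (simp add: dbl_def[abs_def])
  have one: "uniform one"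
    using uniform_min[OF uniform_comp[OF uniform_const, of "[mem, grd, sqr, dbl]" tst]] mem grd sqr dbl
    by (simp add: one_def[abs_def])
  have stp: "uniform stp"
    using uniform_comp[OF uniform_index(2), of "[\<lambda>_ _ _. PProj 1, one]"] one uniform_const by (simp add: stp_def[abs_def])
  have F: "uniform F"
    using uniform_rec[OF one stp] by (simp add: F_def[abs_def])
  have "\<exists>a\<in>carrier A'. eval (F d s m) [n] = Some a \<and> \<psi> a = of_nat (Suc n)"
    if pres: "presentation A' \<psi> d s m" for A' \<psi> d s m n
  proof -
    interpret presentation A' \<psi> d s m by (rule pres)
    have mem: "eval (mem d s m) (x # xs) = Some (of_bool (x \<in> C))" for x xs
      by (simp add: mem_def eval_d)
    define c where "c = (LEAST x. x \<in> C)"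
    have c: "c \<in> C" unfolding c_def by (rule LeastI[of _ "\<one>\<^bsub>A'\<^esub>"]) simp
    have elt: "eval (elt d s m) xs = Some c" for xs
    proof -
      have "eval (PComp neg [mem d s m]) (x # xs) = Some 0 \<longleftrightarrow> x \<in> C"
        "eval (PComp neg [mem d s m]) (x # xs) \<noteq> None" for x
        by (simp_all add: mem neg)
      moreover have "\<exists>x. x \<in> C" using closed(1) by blast
      ultimately show ?thesis
        unfolding elt_def eval.simps(6) c_def by (simp del: eval.simps(4))
    qed
    define g where "g x = (if x \<in> C then x else c)" for x
    have g: "g x \<in> C" for x using c by (simp add: g_def)
    have grd: "eval (grd d s m) (x # xs) = Some (g x)" for x xs
      by (simp add: grd_def mem elt ite g_def)
    define P where "P x \<longleftrightarrow> x \<in> C \<and> g x \<otimes>\<^bsub>A'\<^esub> g x = g x \<and> g x \<oplus>\<^bsub>A'\<^esub> g x \<noteq> g x" for x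
    have P: "P x \<longleftrightarrow> x = \<one>\<^bsub>A'\<^esub>" for x
    proof
      assume "P x"
      hence x: "x \<in> C" "x \<otimes>\<^bsub>A'\<^esub> x = x" "x \<oplus>\<^bsub>A'\<^esub> x \<noteq> x" by (auto simp: P_def g_def)
      \<comment> \<open>An idempotent of a field is 0 or 1, and 0 is excluded since it equals its
        double.\<close>
      have "\<psi> x * \<psi> x = \<psi> x" using x psi_mult[of x x] by simp
      moreover have "\<psi> x \<noteq> 0"
        using x psi_add[of x x] inj_onD[OF inj, of "x \<oplus>\<^bsub>A'\<^esub> x" x] by auto
      ultimately have "\<psi> x = \<psi> \<one>\<^bsub>A'\<^esub>" by (simp add: psi_one)
      thus "x = \<one>\<^bsub>A'\<^esub>" using inj_onD[OF inj, of x "\<one>\<^bsub>A'\<^esub>"] x by simp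
    next
      assume x: "x = \<one>\<^bsub>A'\<^esub>"
      have "\<one>\<^bsub>A'\<^esub> \<oplus>\<^bsub>A'\<^esub> \<one>\<^bsub>A'\<^esub> \<noteq> \<one>\<^bsub>A'\<^esub>"
        using psi_add[of "\<one>\<^bsub>A'\<^esub>" "\<one>\<^bsub>A'\<^esub>"] psi_one
        by (metis add_cancel_right_right closed(1) zero_neq_one)
      moreover have "\<one>\<^bsub>A'\<^esub> \<otimes>\<^bsub>A'\<^esub> \<one>\<^bsub>A'\<^esub> = \<one>\<^bsub>A'\<^esub>"
        by (rule inj_onD[OF inj]) (simp_all add: psi_mult psi_one)
      ultimately show "P x" by (simp add: P_def g_def x)
    qed
    have "eval (PComp tst [mem d s m, grd d s m, sqr d s m, dbl d s m]) (x # xs) = Some 0 \<longleftrightarrow> x = \<one>\<^bsub>A'\<^esub>"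
      "eval (PComp tst [mem d s m, grd d s m, sqr d s m, dbl d s m]) (x # xs) \<noteq> None" for x xs
      unfolding P[symmetric] by (auto simp: mem grd sqr_def dbl_def eval_m eval_s g tst P_def)
    hence one: "eval (one d s m) xs = Some \<one>\<^bsub>A'\<^esub>" for xs
      unfolding one_def eval.simps(6) by (auto simp del: eval.simps(4) intro: Least_equality)
    show ?thesis
    proof (induction n)
      case 0
      show ?case by (intro bexI[of _ "\<one>\<^bsub>A'\<^esub>"]) (simp_all add: F_def one psi_one)
    next
      case (Suc n)
      then obtain a where a: "a \<in> C" "eval (F d s m) [n] = Some a" "\<psi> a = of_nat (Suc n)" by blast
      have "eval (F d s m) [Suc n] = Some (a \<oplus>\<^bsub>A'\<^esub> \<one>\<^bsub>A'\<^esub>)"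
        using a(1,2) by (simp add: F_def stp_def one eval_s)
      thus ?case using a by (intro bexI[of _ "a \<oplus>\<^bsub>A'\<^esub> \<one>\<^bsub>A'\<^esub>"]) (simp_all add: psi_add psi_one)
    qed
  qed
  with F that show ?thesis by blast
qed

text \<open>\<open>\<psi>\<close> is \<open>nu\<close> after an isomorphism. Divisibility, units and
  hence primality are carried across, which turns the criterion for \<open>pr i\<close> in
  \<open>the_ring\<close> into one in \<open>A'\<close>.\<close>

lemma presentation_of_index:
  assumes "computable_presentation the_ring A'" "ring_index A' d s m"
  obtains \<psi> d' s' m' where "d = encode d'" "s = encode s'" "m = encode m'" "presentation A' \<psi> d' s' m'"
proof -
  interpret numbered_subring nu by (rule numbered_subring_nu)
  have ring: "ring A'" using assms(1) by (auto simp: computable_presentation_def computable_ring_def)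
  have ringR: "ring the_ring"
    using computable_UFD_the_ring by (auto simp: computable_UFD_def computable_ring_def)
  obtain h where iso: "h \<in> ring_iso A' the_ring"
    using assms(1) by (auto simp: computable_presentation_def is_ring_iso_def)
  hence hom: "h \<in> ring_hom A' the_ring" and bij: "bij_betw h (carrier A') (carrier the_ring)"
    by (auto simp: ring_iso_def)
  have one: "\<one>\<^bsub>A'\<^esub> \<in> carrier A'" using ring by (simp add: ring.is_monoid monoid.one_closed)
  have "phi d [0] \<noteq> None" "phi s [\<one>\<^bsub>A'\<^esub>, \<one>\<^bsub>A'\<^esub>] \<noteq> None" "phi m [\<one>\<^bsub>A'\<^esub>, \<one>\<^bsub>A'\<^esub>] \<noteq> None"
    using assms(2) one by (auto simp: ring_index_def decides_def computes_binop_on_def)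
  then obtain d' s' m' where codes: "d = encode d'" "s = encode s'" "m = encode m'"
    by (auto simp: phi_def split: if_splits)
  note h = ring_hom_memE[OF hom]
  have hC: "h ` carrier A' = carrier the_ring" and hinj: "inj_on h (carrier A')"
    using bij by (auto simp: bij_betw_def)
  have hzero: "h \<zero>\<^bsub>A'\<^esub> = \<zero>\<^bsub>the_ring\<^esub>" by (rule ring_hom_zero[OF hom ring ringR])
  have m_closed: "a \<otimes>\<^bsub>A'\<^esub> b \<in> carrier A'" if "a \<in> carrier A'" "b \<in> carrier A'" for a b
    using that ring by (simp add: ring.is_monoid monoid.m_closed)
  have dvd: "a divides\<^bsub>A'\<^esub> b \<longleftrightarrow> h a divides\<^bsub>the_ring\<^esub> h b" if ab: "a \<in> carrier A'" "b \<in> carrier A'" for a b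
  proof -
    have "b = a \<otimes>\<^bsub>A'\<^esub> c \<longleftrightarrow> h b = h a \<otimes>\<^bsub>the_ring\<^esub> h c" if "c \<in> carrier A'" for c
      using inj_onD[OF hinj, of b "a \<otimes>\<^bsub>A'\<^esub> c"] ab that m_closed h(2) by auto
    thus ?thesis unfolding factor_def hC[symmetric] by auto
  qed
  have Units: "a \<in> Units A' \<longleftrightarrow> h a \<in> Units the_ring" if a: "a \<in> carrier A'" for a
  proof -
    have "x \<otimes>\<^bsub>A'\<^esub> y = \<one>\<^bsub>A'\<^esub> \<longleftrightarrow> h x \<otimes>\<^bsub>the_ring\<^esub> h y = \<one>\<^bsub>the_ring\<^esub>"
      if "x \<in> carrier A'" "y \<in> carrier A'" for x y
      using inj_on_eq_iff[OF hinj m_closed[OF that] one] that h(2,4) by simp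
    thus ?thesis unfolding Units_def hC[symmetric] using a by auto
  qed
  have prime: "ring_prime\<^bsub>A'\<^esub> a \<longleftrightarrow> ring_prime\<^bsub>the_ring\<^esub> (h a)" if a: "a \<in> carrier A'" for a
  proof -
    have "a \<noteq> \<zero>\<^bsub>A'\<^esub> \<longleftrightarrow> h a \<noteq> \<zero>\<^bsub>the_ring\<^esub>"
      using hzero inj_onD[OF hinj, of a "\<zero>\<^bsub>A'\<^esub>"] a ring by (auto simp: ring.ring_simprules)
    moreover have "(\<forall>x\<in>carrier A'. \<forall>y\<in>carrier A'. a divides\<^bsub>A'\<^esub> x \<otimes>\<^bsub>A'\<^esub> y \<longrightarrow> a divides\<^bsub>A'\<^esub> x \<or> a divides\<^bsub>A'\<^esub> y) \<longleftrightarrow>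
        (\<forall>x\<in>carrier A'. \<forall>y\<in>carrier A'. h a divides\<^bsub>the_ring\<^esub> h x \<otimes>\<^bsub>the_ring\<^esub> h y \<longrightarrow>
           h a divides\<^bsub>the_ring\<^esub> h x \<or> h a divides\<^bsub>the_ring\<^esub> h y)"
      using a m_closed by (intro ball_cong refl) (simp add: dvd h(2))
    ultimately show ?thesis
      unfolding ring_prime_def Divisibility.prime_def Units[OF a] hC[symmetric] by simp
  qed
  have "presentation A' (\<lambda>x. nu (h x)) d' s' m'"
  proof (rule presentation.intro)
    show "ring A'" by (rule ring)
    show "ring_index A' (encode d') (encode s') (encode m')" using assms(2) codes by simp
    show "inj_on (\<lambda>x. nu (h x)) (carrier A')"
      using hinj h(1) nu_inj[folded the_ring_def] unfolding inj_on_def by blast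
    fix a b assume "a \<in> carrier A'" "b \<in> carrier A'"
    thus "nu (h (a \<oplus>\<^bsub>A'\<^esub> b)) = nu (h a) + nu (h b)" "nu (h (a \<otimes>\<^bsub>A'\<^esub> b)) = nu (h a) * nu (h b)"
      by (simp_all add: h nu_ring[folded the_ring_def])
  next
    show "nu (h \<one>\<^bsub>A'\<^esub>) = 1" by (simp add: h nu_ring[folded the_ring_def])
  next
    fix a i assume a: "a \<in> carrier A'" "nu (h a) = of_nat (pr i)"
    have "h a = idx nu (nu (h a))" using h(1)[OF a(1)] by (simp add: the_ring_def numbered_ring_def)
    thus "ring_prime\<^bsub>A'\<^esub> a \<longleftrightarrow> (\<forall>x. \<exists>w. matrix i x w)"
      using prime[OF a(1)] ring_prime_pr_iff[OF range_nu, of i] a(2) by (simp add: the_ring_def)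
  qed
  with codes that show ?thesis by blast
qed

text \<open>The reduction sends \<open>i\<close> to the copy in \<open>A'\<close> of the rational
  prime attached to the instance \<open>prod_encode (k, i)\<close>; only the program locating it
  depends on the presentation.\<close>

lemma uniformly_Pi02_hard_the_ring: "uniformly_Pi02_hard_primes the_ring"
  unfolding uniformly_Pi02_hard_primes_def
proof (intro allI impI)
  fix Z assume "Pi02 Z"
  from Pi02_universal[OF this]
  obtain k where k: "\<And>i. i \<in> Z \<longleftrightarrow> (\<forall>x. \<exists>w. matrix (prod_encode (k, i)) x w)"
    by metis
  \<comment> \<open>The predecessor compensates for \<open>F\<close>, whose value at
    \<open>n\<close> represents \<open>Suc n\<close>.\<close>
  have "computable 1 (\<lambda>e. pr (prod_encode (k, e 0)) - 1)" by (intro comp_intros) auto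
  from computable_phi[OF this] obtain q
    where q': "\<And>xs. length xs = 1 \<Longrightarrow> eval q xs = Some (pr (prod_encode (k, xs ! 0)) - 1)" by blast
  have q: "eval q [i] = Some (pr (prod_encode (k, i)) - 1)" for i by (simp add: q')
  obtain F where F: "uniform F" "\<And>A' \<psi> d s m n. presentation A' \<psi> d s m \<Longrightarrow>
       \<exists>a\<in>carrier A'. eval (F d s m) [n] = Some a \<and> \<psi> a = of_nat (Suc n)"
    using uniform_of_nat by blast
  have "uniform (\<lambda>d s m. PComp (F d s m) [q])"
    using uniform_comp[OF F(1), of "[\<lambda>_ _ _. q]"] uniform_const by simp
  then obtain G where G: "computable 3 (\<lambda>e. G (e 0) (e 1) (e 2))"
    "\<And>d s m. encode (PComp (F d s m) [q]) = G (encode d) (encode s) (encode m)"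
    unfolding uniform_def by blast
  obtain g where g': "\<And>e. eval g (map e [0..<3]) = Some (G (e 0) (e 1) (e 2))"
    using G(1) unfolding computable_def by auto
  have g: "eval g [x, y, z] = Some (G x y z)" for x y z
    using g'[of "(!) [x, y, z]"] by (simp add: upt_rec)
  show "\<exists>g. \<forall>A' d s m. computable_presentation the_ring A' \<and> ring_index A' d s m \<longrightarrow>
      (\<exists>e. phi g [d, s, m] = Some e \<and> reduces_via e Z (primes_of A'))"
  proof (rule exI[of _ "encode g"], intro allI impI)
    fix A' d s m assume A': "computable_presentation the_ring A' \<and> ring_index A' d s m"
    from presentation_of_index[OF A'[THEN conjunct1] A'[THEN conjunct2]] obtain \<psi> d' s' m' where codes: "d = encode d'" "s = encode s'" "m = encode m'"
      and pres: "presentation A' \<psi> d' s' m'" by metis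
    interpret presentation A' \<psi> d' s' m' by (rule pres)
    have "\<exists>a\<in>C. eval (PComp (F d' s' m') [q]) [i] = Some a \<and> \<psi> a = of_nat (pr (prod_encode (k, i)))" for i
    proof -
      have "Suc (pr (prod_encode (k, i)) - 1) = pr (prod_encode (k, i))"
        using prime_pr[of "prod_encode (k, i)"] by (simp add: prime_gt_0_nat)
      thus ?thesis using F(2)[OF pres, of "pr (prod_encode (k, i)) - 1"] by (simp add: q)
    qed
    then obtain f where f: "\<And>i. f i \<in> C" "\<And>i. eval (PComp (F d' s' m') [q]) [i] = Some (f i)"
      "\<And>i. \<psi> (f i) = of_nat (pr (prod_encode (k, i)))" by metis
    have "reduces_via (encode (PComp (F d' s' m') [q])) Z (primes_of A')"
      unfolding reduces_via_def phi_encode using f k prime_iff by (intro exI[of _ f]) (simp add: primes_of_def)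
    moreover have "phi (encode g) [d, s, m] = Some (encode (PComp (F d' s' m') [q]))"
      unfolding G(2) by (simp add: g codes)
    ultimately show "\<exists>e. phi (encode g) [d, s, m] = Some e \<and> reduces_via e Z (primes_of A')" by blast
  qed
qed

theorem corollary1p7:
  shows "\<exists>A :: nat ring. computable_UFD A \<and>
           (\<forall>A'. computable_presentation A A' \<longrightarrow> Pi02_complete (primes_of A')) \<and>
           uniformly_Pi02_hard_primes A"
proof (intro exI[of _ the_ring] conjI allI impI)
  show "computable_UFD the_ring" by (rule computable_UFD_the_ring)
  show hard: "uniformly_Pi02_hard_primes the_ring" by (rule uniformly_Pi02_hard_the_ring)
  fix A' assume A': "computable_presentation the_ring A'"
  then obtain d s m where ind: "ring_index A' d s m"
    by (auto simp: computable_presentation_def computable_ring_def)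
  from presentation_of_index[OF A' ind] have "Pi02 (primes_of A')"
    using presentation.Pi02_primes by metis
  moreover have "\<exists>e. reduces_via e Z (primes_of A')" if "Pi02 Z" for Z
    using hard that A' ind unfolding uniformly_Pi02_hard_primes_def by blast
  ultimately show "Pi02_complete (primes_of A')" by (simp add: Pi02_complete_def)
qed

end
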